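(* The following statements hold: (i) For any $\beta\ge 0$ and $0<\gamma\le 1$, we have $\Omega(\beta,\gamma)=\{0\}$. (ii) For any $0\le\beta\le 1$ and $\gamma>1$, we have $0\notin\Omega(\beta,\gamma)$. (iii) For $\beta\ge 0$ and $\gamma>1$, let $\theta=\theta(\gamma)>0$ be the unique positive solution of $\tanh(\gamma\theta)=\theta$, and let $q=q(\beta)$ be the largest solution in $[0,1)$ of $q=\mathbb{E}\tanh^2(\beta\sqrt q\,z)$, where $z$ is a standard Gaussian random variable (thus $q(\beta)=0$ for $\beta\le 1$, and for $\beta>1$ it is the unique solution in $(0,1)$). Suppose $$\ln\cosh(\gamma\theta)-\frac{\gamma\theta^2}{2}\;>\;\mathbb{E}\ln\cosh\big(\beta\sqrt q\,z\big)+\frac{\beta^2}{4}(1-q)^2 .$$ Then $0\notin\Omega(\beta,\gamma)$. In particular, $0\notin\Omega(\beta,\gamma)$ whenever $$\gamma>\min\Big\{\frac{\beta^2}{2}+2\ln 2,\ \sqrt{\frac{2}{\pi}}\Big(2\beta+\frac1\beta\Big)\Big\}.$$ (iv) For $\beta>1$ and $\gamma\ge\beta^2$, we have $0\notin\Omega(\beta,\gamma)$. (v) For $\beta\ge 0$, $\gamma>1$ and $\theta=\theta(\gamma)$ as in (iii), suppose $$\ln\cosh(\gamma\theta)-\frac{\gamma\theta^2}{2}>\beta E_0,\qquad\text{where}\quad E_0:=\lim_{N\to\infty}\frac1N\,\mathbb{E}\max_{\sigma\in\{-1,+1\}^N}\frac{1}{\sqrt N}\sum_{1\le i<j\le N}g_{ij}\sigma_i\sigma_j$$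 (the ground-state energy of the Sherrington--Kirkpatrick model). Then $0\notin\Omega(\beta,\gamma)$. Moreover $E_0\le\sqrt{\ln 2}$, so the same conclusion holds under the explicit condition $\ln\cosh(\gamma\theta)-\frac{\gamma\theta^2}{2}>\beta\sqrt{\ln 2}$.
   Context: Let $(g_{ij})_{i<j}$ be i.i.d. standard Gaussian random variables. For $N\ge 1$, $\beta\ge 0$, $h\in\mathbb{R}$ and $\sigma\in\Sigma_N:=\{-1,+1\}^N$, put $m(\sigma):=\frac1N\sum_{i=1}^N\sigma_i$ and $H_N^{SK}(\sigma):=\frac{\beta}{\sqrt N}\sum_{1\le i<j\le N}g_{ij}\sigma_i\sigma_j$. The limiting free energy of the Sherrington--Kirkpatrick (SK) model with external field $h$ is $$F^{SK}(\beta,h):=\lim_{N\to\infty}\frac1N\,\mathbb{E}\ln\sum_{\sigma\in\Sigma_N}\exp\big(H_N^{SK}(\sigma)+hN\,m(\sigma)\big),$$ a limit which is known to exist. For $\beta,\gamma\ge 0$ define the set of maximizers $$\Omega(\beta,\gamma):=\operatorname*{arg\,max}_{\mu\in[-1,1]}\Big\{F^{SK}(\beta,\gamma\mu)-\frac{\gamma\mu^2}{2}\Big\}.$$ When $\beta=0$, read $1/\beta=+\infty$. *)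

theory Defs
  imports "HOL-Probability.Probability"
begin

definition iid_std_gaussian :: "'a measure \<Rightarrow> (nat \<Rightarrow> nat \<Rightarrow> 'a \<Rightarrow> real) \<Rightarrow> bool" where
  "iid_std_gaussian M g \<longleftrightarrow>
     prob_space M \<and>
     (\<forall>i j. 1 \<le> i \<and> i < j \<longrightarrow> distributed M lborel (g i j) std_normal_density) \<and>
     prob_space.indep_vars M (\<lambda>_. borel) (\<lambda>(i, j). g i j) {(i, j). 1 \<le> i \<and> i < j}"

text \<open>The sites are \<open>1, \<dots>, N\<close>; configurations are \<open>undefined\<close> elsewhere, so that
  there are exactly \<open>2 ^ N\<close> of them.\<close>

definition spins :: "nat \<Rightarrow> (nat \<Rightarrow> real) set" where
  "spins N = {1..N} \<rightarrow>\<^sub>E {-1, 1}"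

definition magnetization :: "nat \<Rightarrow> (nat \<Rightarrow> real) \<Rightarrow> real" where
  "magnetization N \<sigma> = 1 / real N * (\<Sum>i = 1..N. \<sigma> i)"

definition pair_sum :: "(nat \<Rightarrow> nat \<Rightarrow> 'a \<Rightarrow> real) \<Rightarrow> nat \<Rightarrow> (nat \<Rightarrow> real) \<Rightarrow> 'a \<Rightarrow> real" where
  "pair_sum g N \<sigma> \<omega> = (\<Sum>(i, j) \<in> {(i, j). 1 \<le> i \<and> i < j \<and> j \<le> N}. g i j \<omega> * \<sigma> i * \<sigma> j)"

definition H_SK :: "(nat \<Rightarrow> nat \<Rightarrow> 'a \<Rightarrow> real) \<Rightarrow> nat \<Rightarrow> real \<Rightarrow> (nat \<Rightarrow> real) \<Rightarrow> 'a \<Rightarrow> real" where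
  "H_SK g N \<beta> \<sigma> \<omega> = \<beta> / sqrt (real N) * pair_sum g N \<sigma> \<omega>"

definition F_SK :: "'a measure \<Rightarrow> (nat \<Rightarrow> nat \<Rightarrow> 'a \<Rightarrow> real) \<Rightarrow> real \<Rightarrow> real \<Rightarrow> real" where
  "F_SK M g \<beta> h = lim (\<lambda>N. 1 / real N *
     (LINT \<omega>|M. ln (\<Sum>\<sigma>\<in>spins N. exp (H_SK g N \<beta> \<sigma> \<omega> + h * real N * magnetization N \<sigma>))))"

definition Omega :: "'a measure \<Rightarrow> (nat \<Rightarrow> nat \<Rightarrow> 'a \<Rightarrow> real) \<Rightarrow> real \<Rightarrow> real \<Rightarrow> real set" where
  "Omega M g \<beta> \<gamma> =
     {\<mu>. is_arg_max (\<lambda>\<mu>. F_SK M g \<beta> (\<gamma> * \<mu>) - \<gamma> * \<mu>\<^sup>2 / 2) (\<lambda>\<mu>. \<mu> \<in> {-1..1}) \<mu>}"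

definition ground_state_energy :: "'a measure \<Rightarrow> (nat \<Rightarrow> nat \<Rightarrow> 'a \<Rightarrow> real) \<Rightarrow> real" where
  "ground_state_energy M g = lim (\<lambda>N. 1 / real N *
     (LINT \<omega>|M. Max ((\<lambda>\<sigma>. 1 / sqrt (real N) * pair_sum g N \<sigma> \<omega>) ` spins N)))"

definition theta :: "real \<Rightarrow> real" where
  "theta \<gamma> = (THE \<theta>. \<theta> > 0 \<and> tanh (\<gamma> * \<theta>) = \<theta>)"

definition overlap_fixpoint :: "real \<Rightarrow> real \<Rightarrow> bool" where
  "overlap_fixpoint \<beta> q \<longleftrightarrow>
     q = (LINT z|std_normal_distribution. (tanh (\<beta> * sqrt q * z))\<^sup>2)"

definition overlap :: "real \<Rightarrow> real" where
  "overlap \<beta> = (GREATEST q. q \<in> {0..<1} \<and> overlap_fixpoint \<beta> q)"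

text \<open>Extended reals, because \<open>1 / \<beta>\<close> is to be read as \<open>\<infinity>\<close> when \<open>\<beta> = 0\<close>;
  division on \<^typ>\<open>ereal\<close> satisfies \<open>1 / 0 = \<infinity>\<close>.\<close>

definition explicit_threshold :: "real \<Rightarrow> ereal" where
  "explicit_threshold \<beta> =
     min (ereal (\<beta>\<^sup>2 / 2 + 2 * ln 2))
         (ereal (sqrt (2 / pi)) * (2 * ereal \<beta> + 1 / ereal \<beta>))"

end

theory Submission
  imports Defs
begin

text \<open>Everything rests on one comparison principle: rotating one Gaussian family into another,
  Gaussian integration by parts expresses the change of \<open>E ln \<Sum> exp\<close> through the difference of the
  covariances. It gives superadditivity (hence the limits), Guerra's replica-symmetric bound,
  \<open>F(\<beta>, h) \<ge> ln 2 + ln cosh h\<close>, gauge invariance, and the Lipschitz bound in \<open>\<beta>\<^sup>2\<close>. Gauge averaging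
  yields \<open>F(\<beta>, h) \<le> F(\<beta>, 0) + ln cosh h\<close>, which is (i). Claims (iii) and (v) compare the lower bound
  at the field \<open>\<gamma> \<theta>\<close> (or \<open>\<gamma>\<close>) with upper bounds on \<open>F(\<beta>, 0)\<close>; the second explicit threshold uses
  Guerra's bound at \<open>q = 1\<close>. For (ii) and (iv), on the Nishimori line the model with ferromagnetic
  coupling \<open>b\<^sup>2\<close> is a planted model, whose free energy is at least the annealed value
  \<open>ln 2 + b\<^sup>2 / 4\<close> by convexity, while \<open>F(b, 0)\<close> is strictly smaller for \<open>b > 1\<close>. Hence some nonzero
  field is favourable at inverse temperature \<open>b\<close>, and it remains so for all \<open>\<beta>\<^sup>2 \<le> b\<^sup>2 \<le> \<gamma>\<close>.\<close>

section \<open>Standard Gaussian vectors\<close>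

text \<open>The elementary lower bound on F(\<beta>, h) carries no \<beta>^2/4, whereas F(\<beta>,
  0) is in general only bounded by ln 2 + \<beta>^2/4; so for \<gamma> slightly above 1 these two
  bounds alone do not exclude the zero field. The planted model supplies the missing \<beta>^2/4.
  Its extra energy is b^2 N m^2/2 up to O(1), and for \<mu> near m it is at most a field term b^2
  \<mu> N m - b^2 \<mu>^2 N/2 plus a small error. A finite grid of \<mu>, together with fluctuations
  of ln Z of order sqrt N only, turns the annealed bound into one nearly optimal field; this is what
  concentration is for. Transport from b down to \<beta> is lossless because F grows in \<beta>^2
  with slope at most 1/4, the slope of the annealed value. Strictness comes from expanding Guerra's
  bound at a small trial q: the linear terms cancel and the quadratic coefficient is negative
  exactly when b > 1. The definitions use \<open>lim\<close>, which says nothing unless the sequence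
  converges, so convergence comes before any bound can pass to the limit.\<close>

abbreviation gauss :: "'k set \<Rightarrow> ('k \<Rightarrow> real) measure" where
  "gauss K \<equiv> PiM K (\<lambda>_. std_normal_distribution)"

lemma prob_space_std_normal: "prob_space std_normal_distribution"
  by (rule prob_space_normal_density) simp

lemma product_prob_space_std_normal: "product_prob_space (\<lambda>_. std_normal_distribution)"
  by (intro product_prob_spaceI prob_space_std_normal)

lemma prob_space_gauss: "prob_space (gauss K)"
  by (intro prob_space_PiM prob_space_std_normal)

lemma measurable_gauss_component:
  "k \<in> K \<Longrightarrow> (\<lambda>x. x k) \<in> borel_measurable (gauss K)"
  using measurable_component_singleton[of k K "\<lambda>_. std_normal_distribution"] by simp

lemma (in prob_space) integrable_bounded:
  fixes f :: "_ \<Rightarrow> real"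
  assumes "f \<in> borel_measurable M" "\<And>x. \<bar>f x\<bar> \<le> B"
  shows "integrable M f"
  by (rule integrable_const_bound[where B = B]) (simp_all add: assms)

lemmas std_normal_integrable_bounded = prob_space.integrable_bounded[OF prob_space_std_normal]
lemmas gauss_integrable_bounded = prob_space.integrable_bounded[OF prob_space_gauss]

lemma gauss_distr_component:
  "k \<in> K \<Longrightarrow> distr (gauss K) borel (\<lambda>x. x k) = std_normal_distribution"
  using distr_PiM_component[of K "\<lambda>_. std_normal_distribution" k] prob_space_std_normal
  by (auto cong: distr_cong)

lemma gauss_integrable_component:
  fixes f :: "real \<Rightarrow> real"
  assumes "k \<in> K" "f \<in> borel_measurable borel" "integrable std_normal_distribution f"
  shows "integrable (gauss K) (\<lambda>x. f (x k))"
  using assms gauss_distr_component[of k K]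
    integrable_distr_eq[of "\<lambda>x. x k" "gauss K" borel f] by simp

lemma gauss_integral_component:
  fixes f :: "real \<Rightarrow> real"
  assumes "k \<in> K" "f \<in> borel_measurable borel"
  shows "(LINT x|gauss K. f (x k)) = (LINT z|std_normal_distribution. f z)"
  using assms gauss_distr_component[of k K]
    integral_distr[of "\<lambda>x. x k" "gauss K" borel f] by simp

text \<open>Coordinates read off along an injection form again a standard Gaussian vector, so a
  sub-family can be studied on the larger index set.\<close>

lemma gauss_integral_reindex:
  fixes f :: "_ \<Rightarrow> real"
  assumes "inj_on t K" "t ` K \<subseteq> J" "f \<in> borel_measurable (gauss K)"
  shows "(LINT x|gauss J. f (\<lambda>k\<in>K. x (t k))) = (LINT x|gauss K. f x)"
    and "integrable (gauss J) (\<lambda>x. f (\<lambda>k\<in>K. x (t k))) \<longleftrightarrow> integrable (gauss K) f"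
proof -
  have eq: "distr (gauss J) (gauss K) (\<lambda>x. \<lambda>k\<in>K. x (t k)) = gauss K"
    using assms(1,2) by (intro distr_PiM_reindex prob_space_std_normal) auto
  have m: "(\<lambda>x. \<lambda>k\<in>K. x (t k)) \<in> measurable (gauss J) (gauss K)"
    using assms(2) by (intro measurable_restrict measurable_component_singleton) auto
  show "(LINT x|gauss J. f (\<lambda>k\<in>K. x (t k))) = (LINT x|gauss K. f x)"
    using integral_distr[OF m assms(3)] unfolding eq by (rule sym)
  show "integrable (gauss J) (\<lambda>x. f (\<lambda>k\<in>K. x (t k))) \<longleftrightarrow> integrable (gauss K) f"
    using integrable_distr_eq[OF m assms(3)] unfolding eq by (rule sym)
qed

section \<open>Integration by parts in one Gaussian variable\<close>

lemma integrable_std_normal_id: "integrable std_normal_distribution (\<lambda>x. x)"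
  using integrable_std_normal_distribution_moment[of 1] by simp

lemma std_normal_density_deriv:
  "(std_normal_density has_real_derivative - y * std_normal_density y) (at y)"
proof -
  have "((\<lambda>x::real. - x\<^sup>2 / 2) has_real_derivative - y) (at y)"
    by (auto intro!: derivative_eq_intros)
  from DERIV_cmult[OF DERIV_chain2[OF DERIV_exp this], of "1 / sqrt (2 * pi)"]
  show ?thesis unfolding std_normal_density_def[abs_def] by (simp add: ac_simps)
qed

lemma std_normal_density_at_infinity:
  "(std_normal_density \<longlongrightarrow> 0) at_top" "(std_normal_density \<longlongrightarrow> 0) at_bot"
proof -
  have "(std_normal_density \<longlongrightarrow> 0) F" if "filterlim (\<lambda>x::real. x\<^sup>2) at_top F" for F
  proof -
    have "filterlim (\<lambda>x::real. x\<^sup>2 * (1 / 2)) at_top F"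
      using filterlim_at_top_mult_tendsto_pos[OF tendsto_const[of "1/2::real"] _ that] by simp
    then have "filterlim (\<lambda>x::real. - x\<^sup>2 / 2) at_bot F"
      unfolding filterlim_uminus_at_bot by simp
    then have "((\<lambda>x::real. exp (- x\<^sup>2 / 2)) \<longlongrightarrow> 0) F"
      by (rule filterlim_compose[OF exp_at_bot])
    then have "((\<lambda>x::real. (1 / sqrt (2 * pi)) * exp (- x\<^sup>2 / 2)) \<longlongrightarrow> 0) F"
      by (rule tendsto_mult_right_zero)
    then show ?thesis by (subst std_normal_density_def[abs_def])
  qed
  moreover have "filterlim (\<lambda>x::real. x\<^sup>2) at_top at_top"
    using filterlim_pow_at_top[OF _ filterlim_ident, of 2] by simp
  moreover have "filterlim (\<lambda>x::real. x\<^sup>2) at_top at_bot"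
    using filterlim_pow_at_bot_even[OF _ filterlim_ident, of 2] by simp
  ultimately show "(std_normal_density \<longlongrightarrow> 0) at_top" "(std_normal_density \<longlongrightarrow> 0) at_bot"
    by auto
qed

text \<open>The density satisfies \<phi>' = -y \<phi>, so \<phi> f' - y \<phi> f is the derivative
  of \<phi> f, which vanishes at both infinities because f is bounded.\<close>

lemma std_normal_integral_by_parts:
  fixes f f' :: "real \<Rightarrow> real"
  assumes der: "\<And>y. (f has_real_derivative f' y) (at y)"
    and cont: "\<And>y. isCont f' y"
    and bf: "\<And>y. \<bar>f y\<bar> \<le> B" and bf': "\<And>y. \<bar>f' y\<bar> \<le> B'"
  shows "(LINT y|std_normal_distribution. y * f y) = (LINT y|std_normal_distribution. f' y)"
proof -
  let ?\<phi> = std_normal_density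
  have contf: "isCont f y" for y using der DERIV_isCont by blast
  have [measurable]: "f \<in> borel_measurable borel" "f' \<in> borel_measurable borel"
    using contf cont by (simp_all add: borel_measurable_continuous_onI continuous_at_imp_continuous_on)
  have i1: "integrable std_normal_distribution f'"
    by (rule std_normal_integrable_bounded[where B = B']) (use bf' in simp_all)
  have i2: "integrable std_normal_distribution (\<lambda>y. y * f y)"
  proof (rule Bochner_Integration.integrable_bound)
    show "integrable std_normal_distribution (\<lambda>y. B * y)"
      using integrable_std_normal_id by simp
    have "norm (y * f y) \<le> norm (B * y)" for y
      unfolding real_norm_def abs_mult mult.commute[of "\<bar>y\<bar>"]
      by (rule mult_right_mono) (use bf[of y] in linarith, simp)
    then show "AE y in std_normal_distribution. norm (y * f y) \<le> norm (B * y)"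
      by simp
  qed simp
  have I1: "integrable lborel (\<lambda>y. ?\<phi> y * f' y)" "integrable lborel (\<lambda>y. ?\<phi> y * (y * f y))"
    using i1 i2 by (auto simp: integrable_density)
  have "(LBINT y=-\<infinity>..\<infinity>. ?\<phi> y * f' y - ?\<phi> y * (y * f y)) = 0 - 0"
  proof (rule interval_integral_FTC_integrable)
    show "((\<lambda>y. ?\<phi> y * f y) has_vector_derivative ?\<phi> x * f' x - ?\<phi> x * (x * f x)) (at x)" for x
      unfolding has_real_derivative_iff_has_vector_derivative[symmetric]
      using DERIV_mult[OF std_normal_density_deriv[of x] der[of x]] by (simp add: algebra_simps)
    have "isCont ?\<phi> x" for x using std_normal_density_deriv DERIV_isCont by blast
    then show "isCont (\<lambda>y. ?\<phi> y * f' y - ?\<phi> y * (y * f y)) x" for x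
      using contf cont by (intro continuous_intros) auto
    show "set_integrable lborel (einterval (- \<infinity>) \<infinity>) (\<lambda>y. ?\<phi> y * f' y - ?\<phi> y * (y * f y))"
      using I1 by (simp add: set_integrable_def einterval_eq_UNIV)
    have "((\<lambda>y. ?\<phi> y * f y) \<longlongrightarrow> 0) F" if "(?\<phi> \<longlongrightarrow> 0) F" for F
      by (rule Lim_null_comparison[where g = "\<lambda>y. ?\<phi> y * B"])
         (use bf tendsto_mult_left_zero[OF that, of B] in
           \<open>simp_all add: abs_mult normal_density_nonneg mult_left_mono\<close>)
    from this[OF std_normal_density_at_infinity(1)] this[OF std_normal_density_at_infinity(2)]
    show "(((\<lambda>y. ?\<phi> y * f y) \<circ> real_of_ereal) \<longlongrightarrow> 0) (at_right (- \<infinity>))"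
      "(((\<lambda>y. ?\<phi> y * f y) \<circ> real_of_ereal) \<longlongrightarrow> 0) (at_left \<infinity>)"
      by (simp_all add: ereal_tendsto_simps)
  qed simp
  then have "(LINT y|lborel. ?\<phi> y * f' y - ?\<phi> y * (y * f y)) = 0"
    by (simp add: interval_lebesgue_integral_def set_lebesgue_integral_def einterval_eq_UNIV)
  then have "(LINT y|lborel. ?\<phi> y * f' y) = (LINT y|lborel. ?\<phi> y * (y * f y))"
    using I1 by simp
  then show ?thesis by (simp add: integral_density normal_density_nonneg)
qed

text \<open>By the mean value inequality the difference quotients are dominated by G uniformly in
  the step, so dominated convergence applies along every sequence.\<close>

lemma integral_has_derivative:
  fixes f :: "real \<Rightarrow> 'a \<Rightarrow> real"
  assumes der: "\<And>t x. x \<in> space M \<Longrightarrow> ((\<lambda>t. f t x) has_real_derivative f' t x) (at t)"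
    and int: "\<And>t. integrable M (f t)"
    and bound: "\<And>t x. x \<in> space M \<Longrightarrow> \<bar>f' t x\<bar> \<le> G x" and G: "integrable M G"
    and [measurable]: "\<And>t. f' t \<in> borel_measurable M"
  shows "((\<lambda>t. LINT x|M. f t x) has_real_derivative (LINT x|M. f' t x)) (at t)"
  unfolding DERIV_def
proof (subst tendsto_at_iff_sequentially, intro allI impI)
  fix h :: "nat \<Rightarrow> real" assume h: "\<forall>i. h i \<in> UNIV - {0}" "h \<longlonglongrightarrow> 0"
  have [measurable]: "\<And>t. f t \<in> borel_measurable M" using int by auto
  have "(\<lambda>n. LINT x|M. (f (t + h n) x - f t x) / h n) \<longlonglongrightarrow> (LINT x|M. f' t x)"
  proof (rule integral_dominated_convergence[where w = G])
    show "AE x in M. (\<lambda>n. (f (t + h n) x - f t x) / h n) \<longlonglongrightarrow> f' t x"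
    proof (rule AE_I2)
      fix x assume "x \<in> space M"
      then have "((\<lambda>h. (f (t + h) x - f t x) / h) \<longlongrightarrow> f' t x) (at 0)"
        using der[of x t] by (simp add: DERIV_def)
      then show "(\<lambda>n. (f (t + h n) x - f t x) / h n) \<longlonglongrightarrow> f' t x"
        using h by (auto simp: tendsto_at_iff_sequentially comp_def)
    qed
    show "AE x in M. norm ((f (t + h n) x - f t x) / h n) \<le> G x" for n
    proof (rule AE_I2)
      fix x assume x: "x \<in> space M"
      have "\<bar>f (t + h n) x - f t x\<bar> \<le> G x * \<bar>(t + h n) - t\<bar>"
        using field_differentiable_bound[of UNIV "\<lambda>t. f t x" "\<lambda>t. f' t x" "G x" "t + h n" t]
          der[OF x] bound[OF x] by auto
      then show "norm ((f (t + h n) x - f t x) / h n) \<le> G x"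
        using h(1) by (auto simp: field_simps)
    qed
  qed (use G in auto)
  moreover have "(LINT x|M. (f (t + h n) x - f t x) / h n)
      = ((LINT x|M. f (t + h n) x) - (LINT x|M. f t x)) / h n" for n
    using int by (subst integral_divide_zero) simp
  ultimately show "((\<lambda>h. ((LINT x|M. f (t + h) x) - (LINT x|M. f t x)) / h) \<circ> h)
      \<longlonglongrightarrow> (LINT x|M. f' t x)"
    unfolding comp_def by (simp only:)
qed

section \<open>Gibbs measures of Gaussian Hamiltonians\<close>

text \<open>A Gaussian field indexed by \<sigma>, with mean \<open>d \<sigma>\<close> and covariance
  the sum over k of \<open>A \<sigma> k * A \<tau> k\<close>. Keeping coefficients instead of
  covariances lets an interpolation be a smooth path of coefficients.\<close>

definition energy :: "'k set \<Rightarrow> ('s \<Rightarrow> 'k \<Rightarrow> real) \<Rightarrow> ('s \<Rightarrow> real) \<Rightarrow> ('k \<Rightarrow> real) \<Rightarrow> 's \<Rightarrow> real" where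
  "energy K A d x \<sigma> = d \<sigma> + (\<Sum>k\<in>K. A \<sigma> k * x k)"

definition partition_sum :: "'k set \<Rightarrow> 's set \<Rightarrow> ('s \<Rightarrow> 'k \<Rightarrow> real) \<Rightarrow> ('s \<Rightarrow> real) \<Rightarrow> ('k \<Rightarrow> real) \<Rightarrow> real" where
  "partition_sum K S A d x = (\<Sum>\<sigma>\<in>S. exp (energy K A d x \<sigma>))"

definition gibbs :: "'k set \<Rightarrow> 's set \<Rightarrow> ('s \<Rightarrow> 'k \<Rightarrow> real) \<Rightarrow> ('s \<Rightarrow> real) \<Rightarrow> ('k \<Rightarrow> real) \<Rightarrow> 's \<Rightarrow> real" where
  "gibbs K S A d x \<sigma> = exp (energy K A d x \<sigma>) / partition_sum K S A d x"

definition free_energy :: "'k set \<Rightarrow> 's set \<Rightarrow> ('s \<Rightarrow> 'k \<Rightarrow> real) \<Rightarrow> ('s \<Rightarrow> real) \<Rightarrow> real" where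
  "free_energy K S A d = (LINT x|gauss K. ln (partition_sum K S A d x))"

lemma measurable_energy [measurable]: "(\<lambda>x. energy K A d x \<sigma>) \<in> borel_measurable (gauss K)"
  unfolding energy_def
  by (intro borel_measurable_add borel_measurable_const borel_measurable_sum borel_measurable_times
      measurable_gauss_component)

lemma measurable_partition [measurable]: "partition_sum K S A d \<in> borel_measurable (gauss K)"
  unfolding partition_sum_def[abs_def] by measurable

lemma measurable_gibbs [measurable]: "(\<lambda>x. gibbs K S A d x \<sigma>) \<in> borel_measurable (gauss K)"
  unfolding gibbs_def by measurable

lemma partition_pos: "finite S \<Longrightarrow> S \<noteq> {} \<Longrightarrow> 0 < partition_sum K S A d x"
  unfolding partition_sum_def by (intro sum_pos) auto

lemma gibbs_nonneg: "finite S \<Longrightarrow> S \<noteq> {} \<Longrightarrow> 0 \<le> gibbs K S A d x \<sigma>"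
  using partition_pos[of S K A d x] by (simp add: gibbs_def)

lemma sum_gibbs: "finite S \<Longrightarrow> S \<noteq> {} \<Longrightarrow> (\<Sum>\<sigma>\<in>S. gibbs K S A d x \<sigma>) = 1"
  using partition_pos[of S K A d x]
  by (simp add: gibbs_def partition_sum_def flip: sum_divide_distrib)

lemma gibbs_le_1:
  assumes "finite S" "\<sigma> \<in> S"
  shows "gibbs K S A d x \<sigma> \<le> 1"
proof -
  have "S \<noteq> {}" using assms by auto
  then show ?thesis
    using member_le_sum[of \<sigma> S "gibbs K S A d x"] sum_gibbs[of S K A d x] gibbs_nonneg[of S K A d x] assms
    by simp
qed

lemma ln_partition_ge:
  assumes "finite S" "\<sigma> \<in> S"
  shows "energy K A d x \<sigma> \<le> ln (partition_sum K S A d x)"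
proof -
  have "exp (energy K A d x \<sigma>) \<le> partition_sum K S A d x"
    unfolding partition_sum_def using assms by (intro member_le_sum) auto
  then show ?thesis using ln_ge_iff[of "partition_sum K S A d x"] by (smt (verit) exp_gt_zero)
qed

lemma ln_partition_le:
  assumes "finite S" "S \<noteq> {}" "\<And>\<sigma>. \<sigma> \<in> S \<Longrightarrow> energy K A d x \<sigma> \<le> c"
  shows "ln (partition_sum K S A d x) \<le> ln (real (card S)) + c"
proof -
  have "partition_sum K S A d x \<le> real (card S) * exp c"
    unfolding partition_sum_def using assms(3) by (intro sum_bounded_above) simp
  then have "ln (partition_sum K S A d x) \<le> ln (real (card S) * exp c)"
    using partition_pos[OF assms(1,2)] by (intro ln_mono) auto
  also have "\<dots> = ln (real (card S)) + c"
    using assms(1,2) by (subst ln_mult) (auto simp: card_gt_0_iff)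
  finally show ?thesis .
qed

lemma gauss_integrable_abs_component:
  "k \<in> K \<Longrightarrow> integrable (gauss K) (\<lambda>x. \<bar>x k\<bar>)"
  by (rule gauss_integrable_component[where f = abs])
     (simp_all add: integrable_abs integrable_std_normal_id)

lemma integrable_energy: "finite K \<Longrightarrow> integrable (gauss K) (\<lambda>x. energy K A d x \<sigma>)"
proof -
  have "prob_space (gauss K)" by (rule prob_space_gauss)
  then interpret prob_space "gauss K" .
  show ?thesis unfolding energy_def
    by (intro Bochner_Integration.integrable_add Bochner_Integration.integrable_sum
        integrable_mult_right gauss_integrable_component[where f = "\<lambda>x. x"] integrable_const)
       (simp_all add: integrable_std_normal_id)
qed

text \<open>The logarithm lies between any one energy and \<open>ln (real (card S))\<close> plus the
  sum of all absolute energies, and these are integrable.\<close>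

lemma integrable_ln_partition:
  assumes "finite K" "finite S" "S \<noteq> {}"
  shows "integrable (gauss K) (\<lambda>x. ln (partition_sum K S A d x))"
proof (rule Bochner_Integration.integrable_bound)
  have "prob_space (gauss K)" by (rule prob_space_gauss)
  then interpret prob_space "gauss K" .
  let ?E = "\<lambda>x. \<Sum>\<sigma>\<in>S. \<bar>energy K A d x \<sigma>\<bar>"
  show "integrable (gauss K) (\<lambda>x. ln (real (card S)) + ?E x)"
    by (intro Bochner_Integration.integrable_add Bochner_Integration.integrable_sum
        integrable_const integrable_abs integrable_energy assms(1))
  have le: "\<bar>energy K A d x \<sigma>\<bar> \<le> ?E x" if "\<sigma> \<in> S" for x \<sigma>
    using assms that by (intro member_le_sum) auto
  obtain \<sigma> where "\<sigma> \<in> S" using assms by auto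
  have "norm (ln (partition_sum K S A d x)) \<le> norm (ln (real (card S)) + ?E x)" for x
  proof -
    have "ln (partition_sum K S A d x) \<le> ln (real (card S)) + ?E x"
      using le[of _ x] by (intro ln_partition_le assms) (auto intro: order_trans[OF abs_ge_self])
    moreover have "- ?E x \<le> ln (partition_sum K S A d x)"
      using le[OF \<open>\<sigma> \<in> S\<close>, of x] ln_partition_ge[OF assms(2) \<open>\<sigma> \<in> S\<close>, of K A d x] by linarith
    moreover have "0 \<le> ln (real (card S))"
      using assms by (intro ln_ge_zero) (simp add: Suc_leI card_gt_0_iff)
    ultimately show ?thesis by simp
  qed
  then show "AE x in gauss K. norm (ln (partition_sum K S A d x)) \<le> norm (ln (real (card S)) + ?E x)"
    by simp
qed measurable

lemma softmax_has_derivative: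
  fixes a u :: "'s \<Rightarrow> real" and S :: "'s set"
  defines "p \<equiv> \<lambda>y \<sigma>. exp (u \<sigma> + a \<sigma> * y) / (\<Sum>\<tau>\<in>S. exp (u \<tau> + a \<tau> * y))"
  assumes "finite S" "\<sigma> \<in> S"
  shows "((\<lambda>y. p y \<sigma>) has_real_derivative p y \<sigma> * (a \<sigma> - (\<Sum>\<tau>\<in>S. p y \<tau> * a \<tau>))) (at y)"
proof -
  let ?Z = "\<lambda>y. \<Sum>\<tau>\<in>S. exp (u \<tau> + a \<tau> * y)"
  have Z: "?Z y > 0" using assms by (intro sum_pos) auto
  have e: "((\<lambda>y. exp (u \<tau> + a \<tau> * y)) has_real_derivative exp (u \<tau> + a \<tau> * y) * a \<tau>) (at y)" for \<tau>
    by (auto intro!: derivative_eq_intros)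
  have "((\<lambda>y. exp (u \<sigma> + a \<sigma> * y) / ?Z y) has_real_derivative
      (exp (u \<sigma> + a \<sigma> * y) * a \<sigma> * ?Z y
        - exp (u \<sigma> + a \<sigma> * y) * (\<Sum>\<tau>\<in>S. exp (u \<tau> + a \<tau> * y) * a \<tau>)) / (?Z y * ?Z y)) (at y)"
    using Z by (intro DERIV_divide e DERIV_sum) auto
  also have "(exp (u \<sigma> + a \<sigma> * y) * a \<sigma> * ?Z y
        - exp (u \<sigma> + a \<sigma> * y) * (\<Sum>\<tau>\<in>S. exp (u \<tau> + a \<tau> * y) * a \<tau>)) / (?Z y * ?Z y)
      = p y \<sigma> * (a \<sigma> - (\<Sum>\<tau>\<in>S. p y \<tau> * a \<tau>))"
    using Z by (simp add: p_def field_simps flip: sum_divide_distrib)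
  finally show ?thesis unfolding p_def .
qed

text \<open>Fubini isolates the coordinate k; in it the Gibbs weight is a softmax with slopes
  \<open>A \<tau> k\<close>, whose derivative is the weight times the slope centred at its Gibbs
  mean.\<close>

lemma gibbs_integral_by_parts:
  fixes A :: "'s \<Rightarrow> 'k \<Rightarrow> real"
  assumes K: "finite K" "k \<in> K" and S: "finite S" "\<sigma> \<in> S"
  shows "(LINT x|gauss K. x k * gibbs K S A d x \<sigma>)
       = (LINT x|gauss K. gibbs K S A d x \<sigma> * (A \<sigma> k - (\<Sum>\<tau>\<in>S. gibbs K S A d x \<tau> * A \<tau> k)))"
    and "integrable (gauss K) (\<lambda>x. x k * gibbs K S A d x \<sigma>)"
    and "integrable (gauss K) (\<lambda>x. gibbs K S A d x \<sigma> * (A \<sigma> k - (\<Sum>\<tau>\<in>S. gibbs K S A d x \<tau> * A \<tau> k)))"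
proof -
  have S': "S \<noteq> {}" using S by auto
  have p: "\<bar>gibbs K S A d x \<tau>\<bar> \<le> 1" if "\<tau> \<in> S" for x \<tau>
    using gibbs_nonneg[OF S(1) S', of K A d x \<tau>] gibbs_le_1[OF S(1) that, of K A d x] by simp
  define B where "B = \<bar>A \<sigma> k\<bar> + (\<Sum>\<tau>\<in>S. \<bar>A \<tau> k\<bar>)"
  have B: "\<bar>gibbs K S A d x \<sigma> * (A \<sigma> k - (\<Sum>\<tau>\<in>S. gibbs K S A d x \<tau> * A \<tau> k))\<bar> \<le> B" for x
  proof -
    have "\<bar>\<Sum>\<tau>\<in>S. gibbs K S A d x \<tau> * A \<tau> k\<bar> \<le> (\<Sum>\<tau>\<in>S. \<bar>A \<tau> k\<bar>)"
      using p by (intro order_trans[OF sum_abs] sum_mono) (auto simp: abs_mult intro!: mult_left_le_one_le)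
    then have "\<bar>A \<sigma> k - (\<Sum>\<tau>\<in>S. gibbs K S A d x \<tau> * A \<tau> k)\<bar> \<le> B" unfolding B_def by linarith
    then show ?thesis using p[OF S(2), of x]
      by (subst abs_mult) (meson abs_ge_zero mult_left_le_one_le order_trans)
  qed
  have meas: "(\<lambda>x. x k) \<in> borel_measurable (gauss K)"
    using K by (intro measurable_gauss_component)
  show int1: "integrable (gauss K) (\<lambda>x. x k * gibbs K S A d x \<sigma>)"
  proof (rule Bochner_Integration.integrable_bound)
    show "integrable (gauss K) (\<lambda>x. \<bar>x k\<bar>)" using K by (rule_tac gauss_integrable_abs_component)
    show "(\<lambda>x. x k * gibbs K S A d x \<sigma>) \<in> borel_measurable (gauss K)"
      by (intro borel_measurable_times meas measurable_gibbs)
    have "norm (x k * gibbs K S A d x \<sigma>) \<le> norm \<bar>x k\<bar>" for x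
      using p[OF S(2), of x] by (simp add: abs_mult mult_right_le_one_le)
    then show "AE x in gauss K. norm (x k * gibbs K S A d x \<sigma>) \<le> norm \<bar>x k\<bar>" by simp
  qed
  show int2: "integrable (gauss K)
      (\<lambda>x. gibbs K S A d x \<sigma> * (A \<sigma> k - (\<Sum>\<tau>\<in>S. gibbs K S A d x \<tau> * A \<tau> k)))"
    using B by (intro gauss_integrable_bounded[where B = B]) measurable
  define J where "J = K - {k}"
  have J: "K = insert k J" "finite J" "k \<notin> J" using K by (auto simp: J_def)
  interpret product_prob_space "\<lambda>_. std_normal_distribution" K by (rule product_prob_space_std_normal)
  have "(LINT y|std_normal_distribution. (x(k := y)) k * gibbs K S A d (x(k := y)) \<sigma>)
      = (LINT y|std_normal_distribution. gibbs K S A d (x(k := y)) \<sigma> *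
          (A \<sigma> k - (\<Sum>\<tau>\<in>S. gibbs K S A d (x(k := y)) \<tau> * A \<tau> k)))" for x
  proof -
    let ?p = "\<lambda>y \<tau>. gibbs K S A d (x(k := y)) \<tau>"
    let ?u = "\<lambda>\<tau>. d \<tau> + (\<Sum>i\<in>J. A \<tau> i * x i)"
    have en: "energy K A d (x(k := y)) \<tau> = ?u \<tau> + A \<tau> k * y" for y \<tau>
    proof -
      have "(\<Sum>i\<in>J. A \<tau> i * (x(k := y)) i) = (\<Sum>i\<in>J. A \<tau> i * x i)"
        using J(3) by (intro sum.cong) auto
      then show ?thesis using J(2,3) unfolding energy_def by (simp add: J(1))
    qed
    have pe: "?p y \<tau> = exp (?u \<tau> + A \<tau> k * y) / (\<Sum>\<tau>\<in>S. exp (?u \<tau> + A \<tau> k * y))" for y \<tau>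
      unfolding gibbs_def partition_sum_def en ..
    have der: "((\<lambda>y. ?p y \<tau>) has_real_derivative ?p y \<tau> * (A \<tau> k - (\<Sum>\<tau>\<in>S. ?p y \<tau> * A \<tau> k))) (at y)"
      if "\<tau> \<in> S" for y \<tau>
      unfolding pe by (rule softmax_has_derivative[OF S(1) that])
    have cont: "isCont (\<lambda>y. ?p y \<tau>) y" if "\<tau> \<in> S" for y \<tau>
      using der[OF that] DERIV_isCont by blast
    have "(LINT y|std_normal_distribution. y * ?p y \<sigma>)
      = (LINT y|std_normal_distribution. ?p y \<sigma> * (A \<sigma> k - (\<Sum>\<tau>\<in>S. ?p y \<tau> * A \<tau> k)))"
      by (rule std_normal_integral_by_parts[where B = 1 and B' = B])
         (use der[OF S(2)] cont S(2) B p in \<open>auto intro!: continuous_intros\<close>)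
    then show ?thesis by simp
  qed
  then show "(LINT x|gauss K. x k * gibbs K S A d x \<sigma>)
       = (LINT x|gauss K. gibbs K S A d x \<sigma> * (A \<sigma> k - (\<Sum>\<tau>\<in>S. gibbs K S A d x \<tau> * A \<tau> k)))"
    using product_integral_insert[OF J(2,3), folded J(1), OF int1]
      product_integral_insert[OF J(2,3), folded J(1), OF int2]
    by simp
qed

section \<open>Gaussian interpolation\<close>

text \<open>Differentiating ln Z produces \<open>x k\<close> times a Gibbs weight, and integration
  by parts removes the \<open>x k\<close>. Because the weights sum to 1, the centred slope becomes a
  Gibbs average over two replicas \<sigma>, \<tau>.\<close>

lemma free_energy_has_derivative:
  fixes C C' :: "real \<Rightarrow> 's \<Rightarrow> 'k \<Rightarrow> real"
  assumes K: "finite K" and S: "finite S" "S \<noteq> {}"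
    and der: "\<And>\<sigma> k s. ((\<lambda>s. C s \<sigma> k) has_real_derivative C' s \<sigma> k) (at s)"
    and bound: "\<And>\<sigma> k s. \<sigma> \<in> S \<Longrightarrow> k \<in> K \<Longrightarrow> \<bar>C' s \<sigma> k\<bar> \<le> B"
  shows "((\<lambda>s. free_energy K S (C s) d) has_real_derivative
    (LINT x|gauss K. (\<Sum>\<sigma>\<in>S. \<Sum>\<tau>\<in>S. gibbs K S (C s) d x \<sigma> * gibbs K S (C s) d x \<tau> *
      (\<Sum>k\<in>K. C' s \<sigma> k * (C s \<sigma> k - C s \<tau> k))))) (at s)"
proof -
  let ?g = "\<lambda>s. gibbs K S (C s) d"
  let ?D = "\<lambda>s x. \<Sum>\<sigma>\<in>S. \<Sum>k\<in>K. C' s \<sigma> k * (x k * ?g s x \<sigma>)"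
  have g: "\<bar>?g s x \<sigma>\<bar> \<le> 1" if "\<sigma> \<in> S" for s x \<sigma>
    using gibbs_nonneg[OF S, of K "C s" d x \<sigma>] gibbs_le_1[OF S(1) that, of K "C s" d x] by simp
  have "((\<lambda>s. LINT x|gauss K. ln (partition_sum K S (C s) d x)) has_real_derivative
      (LINT x|gauss K. ?D s x)) (at s)"
  proof (rule integral_has_derivative)
    fix s x
    have Z: "partition_sum K S (C s) d x > 0" using S by (intro partition_pos)
    have "((\<lambda>s. energy K (C s) d x \<sigma>) has_real_derivative (\<Sum>k\<in>K. C' s \<sigma> k * x k)) (at s)" for \<sigma>
      unfolding energy_def
      by (rule DERIV_cong[OF DERIV_add[OF DERIV_const DERIV_sum[OF DERIV_mult[OF der DERIV_const]]]])
        simp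
    then have "((\<lambda>s. partition_sum K S (C s) d x) has_real_derivative
        (\<Sum>\<sigma>\<in>S. exp (energy K (C s) d x \<sigma>) * (\<Sum>k\<in>K. C' s \<sigma> k * x k))) (at s)"
      unfolding partition_sum_def by (intro DERIV_sum DERIV_chain2[OF DERIV_exp])
    then have "((\<lambda>s. ln (partition_sum K S (C s) d x)) has_real_derivative
        1 / partition_sum K S (C s) d x *
        (\<Sum>\<sigma>\<in>S. exp (energy K (C s) d x \<sigma>) * (\<Sum>k\<in>K. C' s \<sigma> k * x k))) (at s)"
      by (rule DERIV_chain2[where f = ln and g = "\<lambda>s. partition_sum K S (C s) d x",
            OF DERIV_ln_divide[OF Z]])
    also have "1 / partition_sum K S (C s) d x *
        (\<Sum>\<sigma>\<in>S. exp (energy K (C s) d x \<sigma>) * (\<Sum>k\<in>K. C' s \<sigma> k * x k)) = ?D s x"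
      unfolding gibbs_def sum_distrib_left by (intro sum.cong refl) simp
    finally show "((\<lambda>s. ln (partition_sum K S (C s) d x)) has_real_derivative ?D s x) (at s)" .
  next
    show "integrable (gauss K) (\<lambda>x. ln (partition_sum K S (C s) d x))" for s
      using K S by (rule integrable_ln_partition)
  next
    fix s x
    show "\<bar>?D s x\<bar> \<le> (\<Sum>\<sigma>\<in>S. \<Sum>k\<in>K. B * \<bar>x k\<bar>)"
    proof (intro order_trans[OF sum_abs] sum_mono)
      fix \<sigma> k assume \<sigma>: "\<sigma> \<in> S" and k: "k \<in> K"
      have "\<bar>x k * ?g s x \<sigma>\<bar> \<le> \<bar>x k\<bar>"
        using g[OF \<sigma>, of s x] by (simp add: abs_mult mult_right_le_one_le)
      then show "\<bar>C' s \<sigma> k * (x k * ?g s x \<sigma>)\<bar> \<le> B * \<bar>x k\<bar>"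
        using bound[OF \<sigma> k, of s] unfolding abs_mult[of "C' s \<sigma> k"] by (intro mult_mono) auto
    qed
  next
    show "integrable (gauss K) (\<lambda>x. \<Sum>\<sigma>\<in>S. \<Sum>k\<in>K. B * \<bar>x k\<bar>)"
      by (intro Bochner_Integration.integrable_sum integrable_mult_right gauss_integrable_abs_component)
  next
    show "?D s \<in> borel_measurable (gauss K)" for s
      by (intro borel_measurable_sum borel_measurable_times borel_measurable_const
          measurable_gauss_component measurable_gibbs)
  qed
  also have "(LINT x|gauss K. ?D s x) = (\<Sum>\<sigma>\<in>S. \<Sum>k\<in>K. C' s \<sigma> k * (LINT x|gauss K. x k * ?g s x \<sigma>))"
    using gibbs_integral_by_parts(2)[OF K _ S(1)]
    by (simp add: Bochner_Integration.integral_sum Bochner_Integration.integrable_sum)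
  also have "\<dots> = (\<Sum>\<sigma>\<in>S. \<Sum>k\<in>K. C' s \<sigma> k *
      (LINT x|gauss K. ?g s x \<sigma> * (C s \<sigma> k - (\<Sum>\<tau>\<in>S. ?g s x \<tau> * C s \<tau> k))))"
    using gibbs_integral_by_parts(1)[OF K _ S(1)] by simp
  also have "\<dots> = (LINT x|gauss K. (\<Sum>\<sigma>\<in>S. \<Sum>k\<in>K. C' s \<sigma> k *
      (?g s x \<sigma> * (C s \<sigma> k - (\<Sum>\<tau>\<in>S. ?g s x \<tau> * C s \<tau> k)))))"
    using gibbs_integral_by_parts(3)[OF K _ S(1)]
    by (simp add: Bochner_Integration.integral_sum Bochner_Integration.integrable_sum)
  also have "\<dots> = (LINT x|gauss K. (\<Sum>\<sigma>\<in>S. \<Sum>\<tau>\<in>S. ?g s x \<sigma> * ?g s x \<tau> *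
      (\<Sum>k\<in>K. C' s \<sigma> k * (C s \<sigma> k - C s \<tau> k))))"
  proof (intro Bochner_Integration.integral_cong refl sum.cong)
    fix x \<sigma>
    have eq: "C s \<sigma> k - (\<Sum>\<tau>\<in>S. ?g s x \<tau> * C s \<tau> k) = (\<Sum>\<tau>\<in>S. ?g s x \<tau> * (C s \<sigma> k - C s \<tau> k))" for k
      using sum_gibbs[OF S, of K "C s" d x]
      by (simp add: right_diff_distrib sum_subtractf flip: sum_distrib_right)
    show "(\<Sum>k\<in>K. C' s \<sigma> k * (?g s x \<sigma> * (C s \<sigma> k - (\<Sum>\<tau>\<in>S. ?g s x \<tau> * C s \<tau> k))))
      = (\<Sum>\<tau>\<in>S. ?g s x \<sigma> * ?g s x \<tau> * (\<Sum>k\<in>K. C' s \<sigma> k * (C s \<sigma> k - C s \<tau> k)))"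
      unfolding eq sum_distrib_left by (subst sum.swap) (simp add: mult_ac)
  qed
  finally show ?thesis unfolding free_energy_def .
qed

lemma energy_restrict:
  assumes "finite J" "inj_on t K" "t ` K \<subseteq> J" "\<And>k. k \<in> K \<Longrightarrow> C \<sigma> (t k) = A \<sigma> k"
    and "\<And>j. j \<in> J - t ` K \<Longrightarrow> C \<sigma> j = 0"
  shows "energy J C d x \<sigma> = energy K A d (\<lambda>k\<in>K. x (t k)) \<sigma>"
proof -
  have "(\<Sum>j\<in>J. C \<sigma> j * x j) = (\<Sum>j\<in>t ` K. C \<sigma> j * x j)"
    using assms by (intro sum.mono_neutral_right) auto
  also have "\<dots> = (\<Sum>k\<in>K. A \<sigma> k * x (t k))"
    using assms by (subst sum.reindex) auto
  also have "\<dots> = (\<Sum>k\<in>K. A \<sigma> k * (\<lambda>k\<in>K. x (t k)) k)"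
    by (intro sum.cong) auto
  finally show ?thesis by (simp add: energy_def)
qed

lemma free_energy_reindex:
  assumes "finite J" "inj_on t K" "t ` K \<subseteq> J" "\<And>\<sigma> k. \<sigma> \<in> S \<Longrightarrow> k \<in> K \<Longrightarrow> C \<sigma> (t k) = A \<sigma> k"
    and "\<And>\<sigma> j. \<sigma> \<in> S \<Longrightarrow> j \<in> J - t ` K \<Longrightarrow> C \<sigma> j = 0"
  shows "free_energy J S C d = free_energy K S A d"
proof -
  have "partition_sum J S C d x = partition_sum K S A d (\<lambda>k\<in>K. x (t k))" for x
    unfolding partition_sum_def using energy_restrict[OF assms(1-3), of C _ A d x] assms(4,5)
    by (intro sum.cong) simp_all
  then show ?thesis
    unfolding free_energy_def
    using gauss_integral_reindex(1)[OF assms(2,3), of "\<lambda>x. ln (partition_sum K S A d x)"] by simp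
qed

text \<open>The two disorders live on the disjoint sum of the index sets and are mixed with weights
  sin s and cos s. The derivative is then sin s cos s times a Gibbs average of the left side of
  \<open>le\<close>, hence at most \<open>2 * sin s * cos s * c\<close>, which integrates to c over
  [0, pi/2]. The angle keeps the coefficients smooth up to the endpoints, where square-root weights
  would have infinite slope.\<close>

theorem free_energy_comparison:
  fixes A :: "'s \<Rightarrow> 'k \<Rightarrow> real" and B :: "'s \<Rightarrow> 'l \<Rightarrow> real"
  assumes K: "finite K" and L: "finite L" and S: "finite S" "S \<noteq> {}"
    and le: "\<And>\<sigma> \<tau>. \<sigma> \<in> S \<Longrightarrow> \<tau> \<in> S \<Longrightarrow>
      (\<Sum>k\<in>K. A \<sigma> k * (A \<sigma> k - A \<tau> k)) - (\<Sum>l\<in>L. B \<sigma> l * (B \<sigma> l - B \<tau> l)) \<le> 2 * c"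
  shows "free_energy K S A d \<le> free_energy L S B d + c"
proof -
  define J where "J = K <+> L"
  have J: "finite J" using K L by (simp add: J_def)
  define C where "C s \<sigma> = case_sum (\<lambda>k. sin s * A \<sigma> k) (\<lambda>l. cos s * B \<sigma> l)" for s \<sigma>
  define C' where "C' s \<sigma> = case_sum (\<lambda>k. cos s * A \<sigma> k) (\<lambda>l. - sin s * B \<sigma> l)" for s \<sigma>
  define M where "M = (\<Sum>\<sigma>\<in>S. (\<Sum>k\<in>K. \<bar>A \<sigma> k\<bar>) + (\<Sum>l\<in>L. \<bar>B \<sigma> l\<bar>))"
  let ?g = "\<lambda>s. gibbs J S (C s) d"
  let ?F' = "\<lambda>s. LINT x|gauss J. (\<Sum>\<sigma>\<in>S. \<Sum>\<tau>\<in>S. ?g s x \<sigma> * ?g s x \<tau> *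
      (\<Sum>j\<in>J. C' s \<sigma> j * (C s \<sigma> j - C s \<tau> j)))"
  have der: "((\<lambda>s. free_energy J S (C s) d) has_real_derivative ?F' s) (at s)" for s
  proof (rule free_energy_has_derivative[OF J S])
    show "((\<lambda>s. C s \<sigma> j) has_real_derivative C' s \<sigma> j) (at s)" for \<sigma> j s
      by (cases j) (auto simp: C_def C'_def intro!: derivative_eq_intros)
  next
    fix \<sigma> j s assume \<sigma>: "\<sigma> \<in> S" and j: "j \<in> J"
    have "\<bar>C' s \<sigma> j\<bar> \<le> (\<Sum>k\<in>K. \<bar>A \<sigma> k\<bar>) + (\<Sum>l\<in>L. \<bar>B \<sigma> l\<bar>)"
    proof (cases j)
      case (Inl k)
      then have "\<bar>A \<sigma> k\<bar> \<le> (\<Sum>k\<in>K. \<bar>A \<sigma> k\<bar>)" using j K by (intro member_le_sum) (auto simp: J_def)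
      moreover have "\<bar>cos s * A \<sigma> k\<bar> \<le> \<bar>A \<sigma> k\<bar>" by (simp add: abs_mult mult_left_le_one_le)
      moreover have "0 \<le> (\<Sum>l\<in>L. \<bar>B \<sigma> l\<bar>)" by (intro sum_nonneg) auto
      moreover have "C' s \<sigma> j = cos s * A \<sigma> k" by (simp add: C'_def Inl)
      ultimately show ?thesis by linarith
    next
      case (Inr l)
      then have "\<bar>B \<sigma> l\<bar> \<le> (\<Sum>l\<in>L. \<bar>B \<sigma> l\<bar>)" using j L by (intro member_le_sum) (auto simp: J_def)
      moreover have "\<bar>- sin s * B \<sigma> l\<bar> \<le> \<bar>B \<sigma> l\<bar>" by (simp add: abs_mult mult_left_le_one_le)
      moreover have "0 \<le> (\<Sum>k\<in>K. \<bar>A \<sigma> k\<bar>)" by (intro sum_nonneg) auto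
      moreover have "C' s \<sigma> j = - sin s * B \<sigma> l" by (simp add: C'_def Inr)
      ultimately show ?thesis by linarith
    qed
    also have "\<dots> \<le> M" unfolding M_def
      using S \<sigma> by (intro member_le_sum) (auto intro!: add_nonneg_nonneg sum_nonneg)
    finally show "\<bar>C' s \<sigma> j\<bar> \<le> M" .
  qed
  have bound: "?F' s \<le> 2 * sin s * cos s * c" if s: "0 \<le> s" "s \<le> pi / 2" for s
  proof -
    have sc: "0 \<le> sin s * cos s" using s by (intro mult_nonneg_nonneg sin_ge_zero cos_ge_zero) auto
    have inner: "(\<Sum>j\<in>J. C' s \<sigma> j * (C s \<sigma> j - C s \<tau> j)) \<le> 2 * sin s * cos s * c"
      if "\<sigma> \<in> S" "\<tau> \<in> S" for \<sigma> \<tau>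
    proof -
      have "(\<Sum>j\<in>J. C' s \<sigma> j * (C s \<sigma> j - C s \<tau> j)) = sin s * cos s *
          ((\<Sum>k\<in>K. A \<sigma> k * (A \<sigma> k - A \<tau> k)) - (\<Sum>l\<in>L. B \<sigma> l * (B \<sigma> l - B \<tau> l)))"
        unfolding J_def using K L
        by (simp add: sum.Plus C_def C'_def right_diff_distrib sum_distrib_left sum_subtractf
            sum_negf algebra_simps)
      also have "\<dots> \<le> sin s * cos s * (2 * c)" using le[OF that] sc by (rule mult_left_mono)
      finally show ?thesis by (simp add: mult_ac)
    qed
    have "prob_space (gauss J)" by (rule prob_space_gauss)
    then interpret prob_space "gauss J" .
    have "(\<Sum>\<sigma>\<in>S. \<Sum>\<tau>\<in>S. ?g s x \<sigma> * ?g s x \<tau> * (\<Sum>j\<in>J. C' s \<sigma> j * (C s \<sigma> j - C s \<tau> j)))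
        \<le> 2 * sin s * cos s * c" for x
    proof -
      have "(\<Sum>\<sigma>\<in>S. \<Sum>\<tau>\<in>S. ?g s x \<sigma> * ?g s x \<tau> * (\<Sum>j\<in>J. C' s \<sigma> j * (C s \<sigma> j - C s \<tau> j)))
          \<le> (\<Sum>\<sigma>\<in>S. \<Sum>\<tau>\<in>S. ?g s x \<sigma> * ?g s x \<tau> * (2 * sin s * cos s * c))"
        using gibbs_nonneg[OF S] inner by (intro sum_mono mult_left_mono mult_nonneg_nonneg) auto
      also have "\<dots> = (\<Sum>\<sigma>\<in>S. ?g s x \<sigma>) * (\<Sum>\<tau>\<in>S. ?g s x \<tau>) * (2 * sin s * cos s * c)"
        by (simp only: sum_product) (simp only: sum_distrib_right)
      finally show ?thesis using sum_gibbs[OF S, of J "C s" d x] by simp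
    qed
    moreover have "integrable (gauss J) (\<lambda>x. \<Sum>\<sigma>\<in>S. \<Sum>\<tau>\<in>S. ?g s x \<sigma> * ?g s x \<tau> *
      (\<Sum>j\<in>J. C' s \<sigma> j * (C s \<sigma> j - C s \<tau> j)))"
    proof (intro Bochner_Integration.integrable_sum integrable_mult_left integrable_bounded[where B = 1])
      fix \<sigma> \<tau> x assume "\<sigma> \<in> S" "\<tau> \<in> S"
      then show "\<bar>?g s x \<sigma> * ?g s x \<tau>\<bar> \<le> 1"
        using gibbs_nonneg[OF S, of J "C s" d x] gibbs_le_1[OF S(1), of _ J "C s" d x]
        by (simp add: mult_le_one)
    qed measurable
    ultimately show ?thesis by (intro integral_le_const) simp_all
  qed
  \<comment> \<open>Subtracting \<open>c * (sin s)\<^sup>2\<close>, a primitive of the bound, leaves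
    a nonincreasing function.\<close>
  have "free_energy J S (C 0) d - c * (sin 0)\<^sup>2 \<ge> free_energy J S (C (pi / 2)) d - c * (sin (pi / 2))\<^sup>2"
  proof (rule DERIV_nonpos_imp_nonincreasing[where f = "\<lambda>s. free_energy J S (C s) d - c * (sin s)\<^sup>2"])
    fix s :: real assume "0 \<le> s" "s \<le> pi / 2"
    then show "\<exists>y. ((\<lambda>s. free_energy J S (C s) d - c * (sin s)\<^sup>2) has_real_derivative y) (at s) \<and> y \<le> 0"
      using bound[of s]
      by (intro exI[of _ "?F' s - 2 * sin s * cos s * c"] conjI)
         (auto intro!: derivative_eq_intros der)
  qed simp
  moreover have "free_energy J S (C (pi / 2)) d = free_energy K S A d"
    by (rule free_energy_reindex[where t = Inl]) (use J in \<open>auto simp: J_def C_def\<close>)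
  moreover have "free_energy J S (C 0) d = free_energy L S B d"
    by (rule free_energy_reindex[where t = Inr]) (use J in \<open>auto simp: J_def C_def\<close>)
  ultimately show ?thesis by simp
qed

section \<open>Cameron--Martin formula and concentration\<close>

text \<open>Completing the square: \<phi>(y - v) = \<phi>(y) exp(v y - v^2/2). Working with
  nonnegative integrals keeps integrability questions out of the induction over coordinates.\<close>

lemma std_normal_nn_integral_shift:
  assumes [measurable]: "f \<in> borel_measurable borel"
  shows "(\<integral>\<^sup>+y. f (y + v) \<partial>std_normal_distribution)
       = (\<integral>\<^sup>+y. f y * ennreal (exp (v * y - v\<^sup>2 / 2)) \<partial>std_normal_distribution)"
proof -
  have dens: "std_normal_density (y - v) = std_normal_density y * exp (v * y - v\<^sup>2 / 2)" for y
    by (simp add: std_normal_density_def power2_diff add_divide_distrib diff_divide_distrib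
        mult.commute flip: exp_add)
  have "(\<integral>\<^sup>+y. f (y + v) \<partial>std_normal_distribution)
      = (\<integral>\<^sup>+y. ennreal (std_normal_density y) * f (y + v) \<partial>lborel)"
    by (subst nn_integral_density) auto
  also have "\<dots> = (\<integral>\<^sup>+y. ennreal (std_normal_density (y - v)) * f y \<partial>lborel)"
    by (subst (2) nn_integral_real_affine[where t = v and c = 1]) (auto simp: add.commute)
  also have "\<dots> = (\<integral>\<^sup>+y. ennreal (std_normal_density y) * (f y * ennreal (exp (v * y - v\<^sup>2 / 2))) \<partial>lborel)"
    by (intro nn_integral_cong)
       (simp add: dens ennreal_mult normal_density_nonneg mult_ac)
  also have "\<dots> = (\<integral>\<^sup>+y. f y * ennreal (exp (v * y - v\<^sup>2 / 2)) \<partial>std_normal_distribution)"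
    by (subst nn_integral_density) auto
  finally show ?thesis .
qed

lemma measurable_gauss_shift:
  "(\<lambda>x. \<lambda>k\<in>K. x k + v k) \<in> measurable (gauss K) (gauss K)"
  by (intro measurable_restrict)
     (simp add: borel_measurable_add measurable_gauss_component)

lemma measurable_gauss_linear:
  "(\<lambda>x. \<Sum>k\<in>K. v k * x k) \<in> borel_measurable (gauss K)"
  by (intro borel_measurable_sum borel_measurable_times borel_measurable_const measurable_gauss_component)

text \<open>Tonelli peels off one coordinate at a time, and the one-dimensional weights
  multiply.\<close>

lemma gauss_nn_integral_shift:
  assumes "finite K" "f \<in> borel_measurable (gauss K)"
  shows "(\<integral>\<^sup>+x. f (\<lambda>k\<in>K. x k + v k) \<partial>gauss K)
       = (\<integral>\<^sup>+x. f x * ennreal (exp ((\<Sum>k\<in>K. v k * x k) - (\<Sum>k\<in>K. (v k)\<^sup>2) / 2)) \<partial>gauss K)"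
  using assms
proof (induction K arbitrary: f)
  case empty
  interpret product_prob_space "\<lambda>_. std_normal_distribution" "{}" by (rule product_prob_space_std_normal)
  show ?case by (simp add: nn_integral_empty restrict_def prob_space.emeasure_space_1[OF prob_space_gauss])
next
  case (insert i I)
  interpret product_prob_space "\<lambda>_. std_normal_distribution" I by (rule product_prob_space_std_normal)
  let ?N = std_normal_distribution
  let ?e = "\<lambda>y. ennreal (exp (v i * y - (v i)\<^sup>2 / 2))"
  let ?E = "\<lambda>I x. ennreal (exp ((\<Sum>k\<in>I. v k * x k) - (\<Sum>k\<in>I. (v k)\<^sup>2) / 2))"
  have f: "f \<in> borel_measurable (gauss (insert i I))" by fact
  have upd: "(\<lambda>(x, y). f (x(i := y))) \<in> borel_measurable (gauss I \<Otimes>\<^sub>M ?N)"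
    using measurable_comp[OF measurable_add_dim f] by (simp add: comp_def case_prod_unfold)
  have fx: "(\<lambda>y. f (x(i := y))) \<in> borel_measurable borel" if "x \<in> space (gauss I)" for x
    using measurable_comp[OF measurable_component_update[OF that] f] insert.hyps(2)
    by (simp add: comp_def)
  have sp: "(\<lambda>k\<in>I. x k + v k) \<in> space (gauss I)" for x
    by (simp add: space_PiM)
  have shift: "(\<lambda>k\<in>insert i I. (x(i := y)) k + v k) = (\<lambda>k\<in>I. x k + v k)(i := y + v i)" for x y
    using insert.hyps(2) by (auto simp: restrict_def fun_eq_iff)
  have "(\<integral>\<^sup>+x. f (\<lambda>k\<in>insert i I. x k + v k) \<partial>gauss (insert i I))
     = (\<integral>\<^sup>+x. (\<integral>\<^sup>+y. f ((\<lambda>k\<in>I. x k + v k)(i := y + v i)) \<partial>?N) \<partial>gauss I)"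
    using measurable_comp[OF measurable_gauss_shift f, of v]
    by (subst product_nn_integral_insert[OF insert.hyps]) (simp_all only: comp_def shift)
  also have "\<dots> = (\<integral>\<^sup>+x. (\<integral>\<^sup>+y. f ((\<lambda>k\<in>I. x k + v k)(i := y)) * ?e y \<partial>?N) \<partial>gauss I)"
    using std_normal_nn_integral_shift[OF fx[OF sp]] by simp
  also have "\<dots> = (\<integral>\<^sup>+x. (\<integral>\<^sup>+y. f (x(i := y)) * ?e y \<partial>?N) * ?E I x \<partial>gauss I)"
    by (rule insert.IH) (use upd in measurable)
  also have "\<dots> = (\<integral>\<^sup>+x. (\<integral>\<^sup>+y. f (x(i := y)) * ?E (insert i I) (x(i := y)) \<partial>?N) \<partial>gauss I)"
  proof (rule nn_integral_cong)
    fix x assume x: "x \<in> space (gauss I)"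
    have upd_sum: "(\<Sum>k\<in>I. v k * (x(i := y)) k) = (\<Sum>k\<in>I. v k * x k)" for y
      using insert.hyps(2) by (intro sum.cong) auto
    have "?E (insert i I) (x(i := y)) = ?e y * ?E I x" for y
      using insert.hyps upd_sum[of y]
      by (simp add: add_divide_distrib diff_divide_distrib flip: ennreal_mult exp_add)
    then show "(\<integral>\<^sup>+y. f (x(i := y)) * ?e y \<partial>?N) * ?E I x
        = (\<integral>\<^sup>+y. f (x(i := y)) * ?E (insert i I) (x(i := y)) \<partial>?N)"
      using fx[OF x] by (subst nn_integral_multc[symmetric]) (auto simp: mult_ac)
  qed
  also have "\<dots> = (\<integral>\<^sup>+x. f x * ?E (insert i I) x \<partial>gauss (insert i I))"
  proof (rule product_nn_integral_insert[OF insert.hyps, symmetric])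
    show "(\<lambda>x. f x * ?E (insert i I) x) \<in> borel_measurable (gauss (insert i I))"
      using measurable_gauss_linear[of v "insert i I"] f by measurable
  qed
  finally show ?case .
qed

lemma gauss_integral_shift:
  fixes f :: "('k \<Rightarrow> real) \<Rightarrow> real" and v :: "'k \<Rightarrow> real"
  assumes K: "finite K" and f: "f \<in> borel_measurable (gauss K)"
  defines "w \<equiv> \<lambda>x. exp ((\<Sum>k\<in>K. v k * x k) - (\<Sum>k\<in>K. (v k)\<^sup>2) / 2)"
  shows "(LINT x|gauss K. f (\<lambda>k\<in>K. x k + v k)) = (LINT x|gauss K. w x * f x)"
    and "integrable (gauss K) (\<lambda>x. f (\<lambda>k\<in>K. x k + v k)) \<longleftrightarrow> integrable (gauss K) (\<lambda>x. w x * f x)"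
proof -
  have w [measurable]: "w \<in> borel_measurable (gauss K)"
    unfolding w_def using measurable_gauss_linear[of v K] by measurable
  \<comment> \<open>As an equality of measures, the formula transfers integrals of signed functions
    and integrability together.\<close>
  have eq: "distr (gauss K) (gauss K) (\<lambda>x. \<lambda>k\<in>K. x k + v k) = density (gauss K) w"
  proof (rule measure_eqI)
    fix X assume "X \<in> sets (distr (gauss K) (gauss K) (\<lambda>x. \<lambda>k\<in>K. x k + v k))"
    then have X: "X \<in> sets (gauss K)" by simp
    have "emeasure (distr (gauss K) (gauss K) (\<lambda>x. \<lambda>k\<in>K. x k + v k)) X
        = (\<integral>\<^sup>+x. indicator X x \<partial>distr (gauss K) (gauss K) (\<lambda>x. \<lambda>k\<in>K. x k + v k))"
      using X by simp
    also have "\<dots> = (\<integral>\<^sup>+x. indicator X (\<lambda>k\<in>K. x k + v k) \<partial>gauss K)"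
      using X by (subst nn_integral_distr[OF measurable_gauss_shift]) auto
    also have "\<dots> = (\<integral>\<^sup>+x. indicator X x * ennreal (w x) \<partial>gauss K)"
      unfolding w_def using X by (intro gauss_nn_integral_shift[OF K]) auto
    also have "\<dots> = emeasure (density (gauss K) w) X"
      using X by (subst emeasure_density) (auto simp: mult.commute)
    finally show "emeasure (distr (gauss K) (gauss K) (\<lambda>x. \<lambda>k\<in>K. x k + v k)) X
        = emeasure (density (gauss K) w) X" .
  qed simp
  have nn: "AE x in gauss K. 0 \<le> w x" by (simp add: w_def)
  show "(LINT x|gauss K. f (\<lambda>k\<in>K. x k + v k)) = (LINT x|gauss K. w x * f x)"
    using integral_distr[OF measurable_gauss_shift f, of v] integral_density[OF f w nn]
    unfolding eq by simp
  show "integrable (gauss K) (\<lambda>x. f (\<lambda>k\<in>K. x k + v k)) \<longleftrightarrow> integrable (gauss K) (\<lambda>x. w x * f x)"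
    using integrable_distr_eq[OF measurable_gauss_shift f, of v] integrable_density[OF f w nn]
    unfolding eq by simp
qed

section \<open>Variance of Lipschitz functions\<close>

lemma gauss_integrable_component_square:
  "k \<in> K \<Longrightarrow> integrable (gauss K) (\<lambda>x. (x k)\<^sup>2)"
  by (rule gauss_integrable_component[where f = "\<lambda>x. x\<^sup>2"])
     (simp_all add: integrable_std_normal_distribution_moment)

lemma (in prob_space) variance_le_second_moment:
  fixes f :: "'a \<Rightarrow> real"
  assumes "integrable M f" "integrable M (\<lambda>x. (f x)\<^sup>2)"
  shows "(LINT x|M. (f x)\<^sup>2) \<le> (LINT x|M. f x)\<^sup>2 + (LINT x|M. (f x - c)\<^sup>2)"
proof -
  have "(LINT x|M. (f x - c)\<^sup>2) = (LINT x|M. (f x)\<^sup>2) - 2 * c * (LINT x|M. f x) + c\<^sup>2"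
    unfolding power2_diff using assms by (simp add: prob_space mult_ac)
  moreover have "0 \<le> ((LINT x|M. f x) - c)\<^sup>2" by simp
  ultimately show ?thesis unfolding power2_diff by (simp add: mult_ac)
qed

text \<open>The mean minimises the second moment about a point, so the variance is at most E (f z -
  f 0)^2, hence at most L^2 E z^2 = L^2.\<close>

lemma std_normal_lipschitz_variance:
  fixes f :: "real \<Rightarrow> real"
  assumes [measurable]: "f \<in> borel_measurable borel" and lip: "\<And>x y. \<bar>f x - f y\<bar> \<le> L * \<bar>x - y\<bar>"
  shows "integrable std_normal_distribution f"
    and "(LINT x|std_normal_distribution. (f x)\<^sup>2) \<le> (LINT x|std_normal_distribution. f x)\<^sup>2 + L\<^sup>2"
proof -
  interpret prob_space std_normal_distribution by (rule prob_space_std_normal)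
  have sq: "integrable std_normal_distribution (\<lambda>x. x\<^sup>2)"
    by (rule integrable_std_normal_distribution_moment)
  have le: "(f x - f 0)\<^sup>2 \<le> L\<^sup>2 * x\<^sup>2" for x
    using power_mono[OF lip[of x 0], of 2] by (simp add: power_mult_distrib)
  have bound: "(f x)\<^sup>2 \<le> 2 * (f 0)\<^sup>2 + 2 * (L\<^sup>2 * x\<^sup>2)" for x
  proof -
    have "0 \<le> (f x - 2 * f 0)\<^sup>2" by simp
    then show ?thesis using le[of x] unfolding power2_diff by (simp add: mult_ac power_mult_distrib)
  qed
  have i2: "integrable std_normal_distribution (\<lambda>x. (f x)\<^sup>2)"
    by (rule Bochner_Integration.integrable_bound[where f = "\<lambda>x. 2 * (f 0)\<^sup>2 + 2 * (L\<^sup>2 * x\<^sup>2)"])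
       (use sq bound in \<open>auto\<close>)
  show i1: "integrable std_normal_distribution f"
    by (rule square_integrable_imp_integrable[OF _ i2]) simp
  have "(LINT x|std_normal_distribution. (f x - f 0)\<^sup>2) \<le> (LINT x|std_normal_distribution. L\<^sup>2 * x\<^sup>2)"
    using sq le by (intro integral_mono') auto
  also have "\<dots> = L\<^sup>2" using std_normal_distribution_even_moments(1)[of 1] by (simp add: fact_numeral)
  finally show "(LINT x|std_normal_distribution. (f x)\<^sup>2) \<le> (LINT x|std_normal_distribution. f x)\<^sup>2 + L\<^sup>2"
    using variance_le_second_moment[OF i1 i2, of "f 0"] by linarith
qed

text \<open>Comparison with the origin bounds f by a constant plus a weighted sum of the |x k|;
  Cauchy-Schwarz then bounds its square by a combination of the (x k)^2.\<close>

lemma gauss_lipschitz_square_integrable: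
  fixes f :: "('k \<Rightarrow> real) \<Rightarrow> real"
  assumes K: "finite K" and f: "f \<in> borel_measurable (gauss K)"
    and lip: "\<And>x y. x \<in> space (gauss K) \<Longrightarrow> y \<in> space (gauss K) \<Longrightarrow> \<bar>f x - f y\<bar> \<le> (\<Sum>k\<in>K. L k * \<bar>x k - y k\<bar>)"
  shows "integrable (gauss K) (\<lambda>x. (f x)\<^sup>2)" "integrable (gauss K) f"
proof -
  have "prob_space (gauss K)" by (rule prob_space_gauss)
  then interpret prob_space "gauss K" .
  let ?o = "\<lambda>k\<in>K. 0 :: real"
  show i2: "integrable (gauss K) (\<lambda>x. (f x)\<^sup>2)"
  proof (rule Bochner_Integration.integrable_bound)
    show "integrable (gauss K) (\<lambda>x. 2 * (f ?o)\<^sup>2 + 2 * (of_nat (card K) * (\<Sum>k\<in>K. (L k)\<^sup>2 * (x k)\<^sup>2)))"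
      by (intro Bochner_Integration.integrable_add integrable_mult_right integrable_const
          Bochner_Integration.integrable_sum gauss_integrable_component_square)
    show "(\<lambda>x. (f x)\<^sup>2) \<in> borel_measurable (gauss K)" using f by measurable
    show "AE x in gauss K. norm ((f x)\<^sup>2)
        \<le> norm (2 * (f ?o)\<^sup>2 + 2 * (of_nat (card K) * (\<Sum>k\<in>K. (L k)\<^sup>2 * (x k)\<^sup>2)))"
    proof (rule AE_I2)
      fix x assume x: "x \<in> space (gauss K)"
      have "\<bar>f x - f ?o\<bar> \<le> (\<Sum>k\<in>K. L k * \<bar>x k - ?o k\<bar>)"
        by (rule lip[OF x]) (simp add: space_PiM)
      also have "\<dots> = (\<Sum>k\<in>K. L k * \<bar>x k\<bar>)" by (intro sum.cong) auto
      finally have "(f x - f ?o)\<^sup>2 \<le> (\<Sum>k\<in>K. L k * \<bar>x k\<bar>)\<^sup>2"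
        by (metis abs_ge_zero power2_abs power_mono)
      also have "\<dots> \<le> of_nat (card K) * (\<Sum>k\<in>K. (L k)\<^sup>2 * (x k)\<^sup>2)"
        using sum_squared_le_sum_of_squares[of "\<lambda>k. L k * \<bar>x k\<bar>" K] K
        by (simp add: power_mult_distrib mult.commute)
      finally have "(f x - f ?o)\<^sup>2 \<le> of_nat (card K) * (\<Sum>k\<in>K. (L k)\<^sup>2 * (x k)\<^sup>2)" .
      moreover have "0 \<le> (f x - 2 * f ?o)\<^sup>2" by simp
      ultimately have "(f x)\<^sup>2 \<le> 2 * (f ?o)\<^sup>2 + 2 * (of_nat (card K) * (\<Sum>k\<in>K. (L k)\<^sup>2 * (x k)\<^sup>2))"
        unfolding power2_diff by (simp add: mult_ac power_mult_distrib)
      then show "norm ((f x)\<^sup>2)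
        \<le> norm (2 * (f ?o)\<^sup>2 + 2 * (of_nat (card K) * (\<Sum>k\<in>K. (L k)\<^sup>2 * (x k)\<^sup>2)))"
        by simp
    qed
  qed
  show "integrable (gauss K) f" by (rule square_integrable_imp_integrable[OF f i2])
qed

text \<open>Integrating out one coordinate costs at most its squared Lipschitz constant, by the
  one-dimensional bound, and the averaged function \<open>?h\<close> keeps the constants of the
  remaining coordinates. The induction adds up the costs.\<close>

lemma gauss_lipschitz_variance:
  fixes f :: "('k \<Rightarrow> real) \<Rightarrow> real"
  assumes "finite K" "f \<in> borel_measurable (gauss K)"
    and "\<And>x y. x \<in> space (gauss K) \<Longrightarrow> y \<in> space (gauss K) \<Longrightarrow> \<bar>f x - f y\<bar> \<le> (\<Sum>k\<in>K. L k * \<bar>x k - y k\<bar>)"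
  shows "(LINT x|gauss K. (f x)\<^sup>2) \<le> (LINT x|gauss K. f x)\<^sup>2 + (\<Sum>k\<in>K. (L k)\<^sup>2)"
  using assms
proof (induction K arbitrary: f)
  case empty
  have const: "(LINT x|gauss {}. h x) = h (\<lambda>_. undefined)" for h :: "('k \<Rightarrow> real) \<Rightarrow> real"
  proof -
    have "(LINT x|gauss {}. h x) = (LINT x|gauss ({} :: 'k set). h (\<lambda>_. undefined))"
      by (intro Bochner_Integration.integral_cong refl) (simp add: space_PiM)
    then show ?thesis by (simp add: prob_space.prob_space[OF prob_space_gauss])
  qed
  show ?case unfolding const by simp
next
  case (insert i I)
  interpret product_prob_space "\<lambda>_. std_normal_distribution" I by (rule product_prob_space_std_normal)
  let ?N = std_normal_distribution
  let ?h = "\<lambda>x. LINT y|?N. f (x(i := y))"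
  have f: "f \<in> borel_measurable (gauss (insert i I))" by fact
  have upd: "(\<lambda>(x, y). f (x(i := y))) \<in> borel_measurable (gauss I \<Otimes>\<^sub>M ?N)"
    using measurable_comp[OF measurable_add_dim f] by (simp add: comp_def case_prod_unfold)
  have fx: "(\<lambda>y. f (x(i := y))) \<in> borel_measurable borel" if "x \<in> space (gauss I)" for x
    using measurable_comp[OF measurable_component_update[OF that] f] insert.hyps(2)
    by (simp add: comp_def)
  have sp: "x(i := y) \<in> space (gauss (insert i I))" if "x \<in> space (gauss I)" for x and y :: real
    using that by (auto simp: space_PiM PiE_iff extensional_def)
  have ins_sum: "(\<Sum>k\<in>insert i I. L k * \<bar>(x(i := y)) k - (x'(i := y')) k\<bar>)
      = L i * \<bar>y - y'\<bar> + (\<Sum>k\<in>I. L k * \<bar>x k - x' k\<bar>)" for x x' y y'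
  proof -
    have "(\<Sum>k\<in>I. L k * \<bar>(x(i := y)) k - (x'(i := y')) k\<bar>) = (\<Sum>k\<in>I. L k * \<bar>x k - x' k\<bar>)"
      using insert.hyps(2) by (intro sum.cong) auto
    then show ?thesis using insert.hyps by simp
  qed
  have lip: "\<bar>f (x(i := y)) - f (x'(i := y'))\<bar> \<le> L i * \<bar>y - y'\<bar> + (\<Sum>k\<in>I. L k * \<bar>x k - x' k\<bar>)"
    if "x \<in> space (gauss I)" "x' \<in> space (gauss I)" for x x' y y'
    using insert.prems(2)[OF sp sp, OF that, of y y'] unfolding ins_sum .
  have one: "integrable ?N (\<lambda>y. f (x(i := y)))"
      "(LINT y|?N. (f (x(i := y)))\<^sup>2) \<le> (?h x)\<^sup>2 + (L i)\<^sup>2" if "x \<in> space (gauss I)" for x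
    using std_normal_lipschitz_variance[OF fx[OF that], of "L i"] lip[OF that that] by auto
  have h: "?h \<in> borel_measurable (gauss I)" using upd by measurable
  have hlip: "\<bar>?h x - ?h x'\<bar> \<le> (\<Sum>k\<in>I. L k * \<bar>x k - x' k\<bar>)"
    if x: "x \<in> space (gauss I)" "x' \<in> space (gauss I)" for x x'
  proof -
    have "?h x - ?h x' = (LINT y|?N. f (x(i := y)) - f (x'(i := y)))"
      using one(1) x by simp
    also have "\<bar>\<dots>\<bar> \<le> (LINT y|?N. \<bar>f (x(i := y)) - f (x'(i := y))\<bar>)"
      by (rule integral_abs_bound)
    also have "\<dots> \<le> (\<Sum>k\<in>I. L k * \<bar>x k - x' k\<bar>)"
      using lip[OF x, of y y for y] one(1) x by (intro prob_space.integral_le_const[OF prob_space_std_normal]) auto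
    finally show ?thesis .
  qed
  have int: "integrable (gauss (insert i I)) (\<lambda>x. (f x)\<^sup>2)" "integrable (gauss (insert i I)) f"
    using gauss_lipschitz_square_integrable[of "insert i I" f L] insert by auto
  have hint: "integrable (gauss I) (\<lambda>x. (?h x)\<^sup>2)"
    using gauss_lipschitz_square_integrable(1)[OF insert.hyps(1) h hlip] .
  have "prob_space (gauss I)" by (rule prob_space_gauss)
  then interpret P: prob_space "gauss I" .
  have "(LINT x|gauss (insert i I). (f x)\<^sup>2) = (LINT x|gauss I. (LINT y|?N. (f (x(i := y)))\<^sup>2))"
    by (rule product_integral_insert[OF insert.hyps int(1)])
  also have "\<dots> \<le> (LINT x|gauss I. (?h x)\<^sup>2 + (L i)\<^sup>2)"
    using one(2) hint by (intro integral_mono') auto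
  also have "\<dots> = (LINT x|gauss I. (?h x)\<^sup>2) + (L i)\<^sup>2"
    using hint by (simp add: P.prob_space)
  also have "\<dots> \<le> (LINT x|gauss I. ?h x)\<^sup>2 + (\<Sum>k\<in>insert i I. (L k)\<^sup>2)"
  proof -
    have "(LINT x|gauss I. (?h x)\<^sup>2) \<le> (LINT x|gauss I. ?h x)\<^sup>2 + (\<Sum>k\<in>I. (L k)\<^sup>2)"
      by (rule insert.IH[OF h hlip])
    moreover have "(\<Sum>k\<in>insert i I. (L k)\<^sup>2) = (L i)\<^sup>2 + (\<Sum>k\<in>I. (L k)\<^sup>2)"
      using insert.hyps by simp
    ultimately show ?thesis by linarith
  qed
  also have "(LINT x|gauss I. ?h x) = (LINT x|gauss (insert i I). f x)"
    by (rule product_integral_insert[OF insert.hyps int(2), symmetric])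
  finally show ?case .
qed

lemma ln_partition_lipschitz:
  fixes A :: "'s \<Rightarrow> 'k \<Rightarrow> real"
  assumes S: "finite S" "S \<noteq> {}" and A: "\<And>\<sigma> k. \<sigma> \<in> S \<Longrightarrow> k \<in> K \<Longrightarrow> \<bar>A \<sigma> k\<bar> \<le> L k"
  shows "\<bar>ln (partition_sum K S A d x) - ln (partition_sum K S A d y)\<bar> \<le> (\<Sum>k\<in>K. L k * \<bar>x k - y k\<bar>)"
proof -
  have "ln (partition_sum K S A d x) \<le> (\<Sum>k\<in>K. L k * \<bar>x k - y k\<bar>) + ln (partition_sum K S A d y)" for x y
  proof -
    let ?D = "\<Sum>k\<in>K. L k * \<bar>x k - y k\<bar>"
    have "energy K A d x \<sigma> \<le> ?D + energy K A d y \<sigma>" if "\<sigma> \<in> S" for \<sigma>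
    proof -
      have "energy K A d x \<sigma> - energy K A d y \<sigma> = (\<Sum>k\<in>K. A \<sigma> k * (x k - y k))"
        by (simp add: energy_def right_diff_distrib sum_subtractf)
      also have "\<dots> \<le> ?D"
      proof (rule sum_mono)
        fix k assume "k \<in> K"
        have "A \<sigma> k * (x k - y k) \<le> \<bar>A \<sigma> k\<bar> * \<bar>x k - y k\<bar>" by (metis abs_ge_self abs_mult)
        also have "\<dots> \<le> L k * \<bar>x k - y k\<bar>" using A[OF that \<open>k \<in> K\<close>] by (intro mult_right_mono) auto
        finally show "A \<sigma> k * (x k - y k) \<le> L k * \<bar>x k - y k\<bar>" .
      qed
      finally show ?thesis by simp
    qed
    then have "partition_sum K S A d x \<le> exp ?D * partition_sum K S A d y"
      unfolding partition_sum_def sum_distrib_left exp_add[symmetric] by (intro sum_mono) simp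
    then have "ln (partition_sum K S A d x) \<le> ln (exp ?D * partition_sum K S A d y)"
      using partition_pos[OF S, of K A d] by (intro ln_mono) auto
    then show ?thesis using partition_pos[OF S, of K A d y] by (simp add: ln_mult)
  qed
  from this[of x y] this[of y x] show ?thesis by (simp add: abs_minus_commute abs_le_iff)
qed

text \<open>The mean absolute deviation is at most the standard deviation, and ln Z is Lipschitz in
  each coordinate with any bound on its coefficients.\<close>

lemma ln_partition_concentration:
  fixes A :: "'s \<Rightarrow> 'k \<Rightarrow> real"
  assumes K: "finite K" and S: "finite S" "S \<noteq> {}" and A: "\<And>\<sigma> k. \<sigma> \<in> S \<Longrightarrow> k \<in> K \<Longrightarrow> \<bar>A \<sigma> k\<bar> \<le> L k"
  shows "(LINT x|gauss K. \<bar>ln (partition_sum K S A d x) - free_energy K S A d\<bar>) \<le> sqrt (\<Sum>k\<in>K. (L k)\<^sup>2)"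
proof -
  have "prob_space (gauss K)" by (rule prob_space_gauss)
  then interpret prob_space "gauss K" .
  let ?f = "\<lambda>x. ln (partition_sum K S A d x)"
  let ?m = "free_energy K S A d"
  have m: "?f \<in> borel_measurable (gauss K)" by measurable
  note lip = ln_partition_lipschitz[where d = d, OF S A]
  have i: "integrable (gauss K) (\<lambda>x. (?f x)\<^sup>2)" "integrable (gauss K) ?f"
    using gauss_lipschitz_square_integrable[OF K m lip] by auto
  have var: "(LINT x|gauss K. (?f x)\<^sup>2) \<le> ?m\<^sup>2 + (\<Sum>k\<in>K. (L k)\<^sup>2)"
    unfolding free_energy_def by (rule gauss_lipschitz_variance[OF K m lip])
  have "(LINT x|gauss K. \<bar>?f x - ?m\<bar>\<^sup>2) = (LINT x|gauss K. (?f x)\<^sup>2 + ?m\<^sup>2 - 2 * ?f x * ?m)"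
    by (simp add: power2_diff)
  also have "\<dots> = (LINT x|gauss K. (?f x)\<^sup>2) + ?m\<^sup>2 - 2 * ?m * ?m"
    using i by (simp add: prob_space free_energy_def mult_ac)
  also have "\<dots> \<le> (\<Sum>k\<in>K. (L k)\<^sup>2)" using var by (simp add: power2_eq_square)
  finally have v: "(LINT x|gauss K. \<bar>?f x - ?m\<bar>\<^sup>2) \<le> (\<Sum>k\<in>K. (L k)\<^sup>2)" .
  have "integrable (gauss K) (\<lambda>x. (?f x - ?m)\<^sup>2)"
    unfolding power2_diff using i by (intro Bochner_Integration.integrable_add
      Bochner_Integration.integrable_diff integrable_mult_left integrable_mult_right integrable_const)
  then have "(LINT x|gauss K. \<bar>?f x - ?m\<bar>)\<^sup>2 \<le> (LINT x|gauss K. \<bar>?f x - ?m\<bar>\<^sup>2)"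
    using i variance_eq[of "\<lambda>x. \<bar>?f x - ?m\<bar>"] variance_positive[of "\<lambda>x. \<bar>?f x - ?m\<bar>"] by simp
  then show ?thesis using v by (intro real_le_rsqrt) linarith
qed

section \<open>The Sherrington--Kirkpatrick model\<close>

definition pairs :: "nat \<Rightarrow> (nat \<times> nat) set" where
  "pairs N = {(i, j). 1 \<le> i \<and> i < j \<and> j \<le> N}"

definition coupling :: "nat \<Rightarrow> real \<Rightarrow> (nat \<Rightarrow> real) \<Rightarrow> nat \<times> nat \<Rightarrow> real" where
  "coupling N \<beta> \<sigma> = (\<lambda>(i, j). \<beta> / sqrt (real N) * \<sigma> i * \<sigma> j)"

definition field_energy :: "nat \<Rightarrow> real \<Rightarrow> (nat \<Rightarrow> real) \<Rightarrow> real" where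
  "field_energy N h \<sigma> = h * (\<Sum>i = 1..N. \<sigma> i)"

definition overlap_sum :: "nat \<Rightarrow> (nat \<Rightarrow> real) \<Rightarrow> (nat \<Rightarrow> real) \<Rightarrow> real" where
  "overlap_sum N \<sigma> \<tau> = (\<Sum>i = 1..N. \<sigma> i * \<tau> i)"

text \<open>The finite-volume free energy on the canonical product space, kept extensive (no
  division by N) so that it is superadditive.\<close>

definition sk :: "nat \<Rightarrow> real \<Rightarrow> real \<Rightarrow> real" where
  "sk N \<beta> h = free_energy (pairs N) (spins N) (coupling N \<beta>) (field_energy N h)"

lemma finite_pairs [simp]: "finite (pairs N)"
  by (rule finite_subset[of _ "{1..N} \<times> {1..N}"]) (auto simp: pairs_def)

lemma finite_spins [simp]: "finite (spins N)"
  unfolding spins_def by (intro finite_PiE) auto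

lemma card_spins: "card (spins N) = 2 ^ N"
  unfolding spins_def by (subst card_PiE) (auto simp: numeral_2_eq_2)

lemma spins_nonempty [simp]: "spins N \<noteq> {}"
  using card_spins[of N] by (metis card.empty power_not_zero zero_neq_numeral)

lemma spin_cases: "\<sigma> \<in> spins N \<Longrightarrow> i \<in> {1..N} \<Longrightarrow> \<sigma> i = -1 \<or> \<sigma> i = 1"
  by (auto simp: spins_def PiE_iff)

lemma spin_square: "\<sigma> \<in> spins N \<Longrightarrow> i \<in> {1..N} \<Longrightarrow> \<sigma> i * \<sigma> i = 1"
  using spin_cases by fastforce

lemma spin_abs: "\<sigma> \<in> spins N \<Longrightarrow> i \<in> {1..N} \<Longrightarrow> \<bar>\<sigma> i\<bar> = 1"
  using spin_cases by fastforce

lemma sum_pairs: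
  fixes u :: "nat \<Rightarrow> real"
  shows "2 * (\<Sum>(i, j)\<in>pairs N. u i * u j) = (\<Sum>i = 1..N. u i)\<^sup>2 - (\<Sum>i = 1..N. (u i)\<^sup>2)"
proof (induction N)
  case 0
  have "pairs 0 = {}" by (auto simp: pairs_def)
  then show ?case by simp
next
  case (Suc N)
  have split: "pairs (Suc N) = pairs N \<union> (\<lambda>i. (i, Suc N)) ` {1..N}"
    by (auto simp: pairs_def)
  have "(\<Sum>(i, j)\<in>pairs (Suc N). u i * u j)
      = (\<Sum>(i, j)\<in>pairs N. u i * u j) + (\<Sum>(i, j)\<in>(\<lambda>i. (i, Suc N)) ` {1..N}. u i * u j)"
    unfolding split using finite_pairs[of N] by (intro sum.union_disjoint) (auto simp: pairs_def)
  also have "(\<Sum>(i, j)\<in>(\<lambda>i. (i, Suc N)) ` {1..N}. u i * u j) = (\<Sum>i = 1..N. u i) * u (Suc N)"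
    by (subst sum.reindex) (auto simp: inj_on_def sum_distrib_right)
  finally show ?case using Suc by (simp add: power2_eq_square algebra_simps)
qed

lemma overlap_sum_self: "\<sigma> \<in> spins N \<Longrightarrow> overlap_sum N \<sigma> \<sigma> = real N"
  unfolding overlap_sum_def using spin_square[of \<sigma> N] by simp

lemma abs_overlap_sum_le:
  assumes "\<sigma> \<in> spins N" "\<tau> \<in> spins N" shows "\<bar>overlap_sum N \<sigma> \<tau>\<bar> \<le> real N"
proof -
  have "\<bar>overlap_sum N \<sigma> \<tau>\<bar> \<le> (\<Sum>i = 1..N. \<bar>\<sigma> i * \<tau> i\<bar>)"
    unfolding overlap_sum_def by (rule sum_abs)
  also have "\<dots> = (\<Sum>i = 1..N. 1)"
    using spin_abs[OF assms(1)] spin_abs[OF assms(2)] by (intro sum.cong refl) (simp add: abs_mult)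
  finally show ?thesis by simp
qed

text \<open>With u i = \<sigma> i \<tau> i the product of two coefficients is proportional to u i u
  j, so the pair sum is half of the squared overlap minus its diagonal N.\<close>

lemma coupling_inner:
  assumes "\<sigma> \<in> spins N" "\<tau> \<in> spins N"
  shows "(\<Sum>k\<in>pairs N. coupling N \<beta> \<sigma> k * coupling N \<beta> \<tau> k)
    = \<beta>\<^sup>2 / real N * (((overlap_sum N \<sigma> \<tau>)\<^sup>2 - real N) / 2)"
proof -
  let ?u = "\<lambda>i. \<sigma> i * \<tau> i"
  have "(\<Sum>k\<in>pairs N. coupling N \<beta> \<sigma> k * coupling N \<beta> \<tau> k)
      = (\<Sum>k\<in>pairs N. \<beta>\<^sup>2 / real N * (case k of (i, j) \<Rightarrow> ?u i * ?u j))"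
  proof (rule sum.cong[OF refl])
    fix k assume "k \<in> pairs N"
    obtain i j where k: "k = (i, j)" by (cases k)
    have "\<beta> / sqrt (real N) * (\<beta> / sqrt (real N)) = \<beta>\<^sup>2 / real N"
      by (simp add: power2_eq_square)
    then show "coupling N \<beta> \<sigma> k * coupling N \<beta> \<tau> k = \<beta>\<^sup>2 / real N * (case k of (i, j) \<Rightarrow> ?u i * ?u j)"
      unfolding k coupling_def by (simp add: mult_ac power2_eq_square)
  qed
  also have "\<dots> = \<beta>\<^sup>2 / real N * (\<Sum>(i, j)\<in>pairs N. ?u i * ?u j)"
    by (simp add: sum_distrib_left)
  also have "(\<Sum>(i, j)\<in>pairs N. ?u i * ?u j) = ((overlap_sum N \<sigma> \<tau>)\<^sup>2 - real N) / 2"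
  proof -
    have "(\<Sum>i = 1..N. (?u i)\<^sup>2) = (\<Sum>i = 1..N. 1)"
      using spin_square[OF assms(1)] spin_square[OF assms(2)]
      by (intro sum.cong refl) (simp only: power_mult_distrib, simp add: power2_eq_square)
    then show ?thesis using sum_pairs[of ?u N] by (simp add: overlap_sum_def)
  qed
  finally show ?thesis .
qed

text \<open>The missing diagonal contributes the same to both inner products and cancels, so the
  quantity entering the comparison is an exact function of the overlap.\<close>

lemma coupling_inner_diff:
  assumes "\<sigma> \<in> spins N" "\<tau> \<in> spins N" "0 < N"
  shows "(\<Sum>k\<in>pairs N. coupling N \<beta> \<sigma> k * (coupling N \<beta> \<sigma> k - coupling N \<beta> \<tau> k))
    = \<beta>\<^sup>2 / 2 * (real N - (overlap_sum N \<sigma> \<tau>)\<^sup>2 / real N)"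
  unfolding right_diff_distrib sum_subtractf
  using assms by (subst (1 2) coupling_inner) (auto simp: overlap_sum_self field_simps power2_eq_square)

lemma coupling_inner_self:
  assumes "\<sigma> \<in> spins N" "0 < N"
  shows "(\<Sum>k\<in>pairs N. coupling N \<beta> \<sigma> k * coupling N \<beta> \<sigma> k) = \<beta>\<^sup>2 / 2 * (real N - 1)"
  using assms by (subst coupling_inner) (auto simp: overlap_sum_self field_simps power2_eq_square)

text \<open>Independence makes the finitely many couplings of an N-site system a standard Gaussian
  vector, so the expectation no longer depends on the underlying probability space.\<close>

lemma sk_eq_gaussian:
  assumes g: "iid_std_gaussian M g"
  shows "(LINT \<omega>|M. ln (\<Sum>\<sigma>\<in>spins N. exp (H_SK g N \<beta> \<sigma> \<omega> + h * real N * magnetization N \<sigma>))) = sk N \<beta> h"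
    and "integrable M (\<lambda>\<omega>. ln (\<Sum>\<sigma>\<in>spins N. exp (H_SK g N \<beta> \<sigma> \<omega> + h * real N * magnetization N \<sigma>)))"
proof -
  let ?K = "pairs N" and ?X = "\<lambda>(i, j). g i j"
  interpret prob_space M using g by (simp add: iid_std_gaussian_def)
  have rv: "random_variable borel (?X k)" and law: "distr M borel (?X k) = std_normal_distribution"
    if "k \<in> ?K" for k
  proof -
    obtain i j where k: "k = (i, j)" by (cases k)
    then have d: "distributed M lborel (g i j) std_normal_density"
      using that g by (auto simp: iid_std_gaussian_def pairs_def)
    show "random_variable borel (?X k)" using distributed_measurable[OF d] by (simp add: k)
    have "distr M borel (g i j) = distr M lborel (g i j)" by (intro distr_cong) auto
    then show "distr M borel (?X k) = std_normal_distribution"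
      using distributed_distr_eq_density[OF d] by (simp add: k)
  qed
  have ind: "indep_vars (\<lambda>_. borel) ?X ?K"
    using g unfolding iid_std_gaussian_def
    by (auto intro: indep_vars_subset simp: pairs_def)
  have rv': "random_variable (gauss ?K) (\<lambda>\<omega>. \<lambda>k\<in>?K. ?X k \<omega>)"
    using rv by (intro measurable_restrict) simp
  have "distr M (gauss ?K) (\<lambda>\<omega>. \<lambda>k\<in>?K. ?X k \<omega>) = gauss ?K"
  proof (cases "?K = {}")
    \<comment> \<open>For N at most 1 there are no pairs, and the product characterisation of
      independence asks for a nonempty index set.\<close>
    case True
    show ?thesis
    proof (rule measure_eqI)
      fix A assume "A \<in> sets (distr M (gauss ?K) (\<lambda>\<omega>. \<lambda>k\<in>?K. ?X k \<omega>))"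
      then have A: "A = {} \<or> A = space (gauss ?K)" unfolding True by (simp add: sets_PiM_empty space_PiM_empty)
      have "emeasure (distr M (gauss ?K) (\<lambda>\<omega>. \<lambda>k\<in>?K. ?X k \<omega>)) (space (gauss ?K)) = 1"
        using prob_space.emeasure_space_1[OF prob_space_distr[OF rv']] by simp
      then show "emeasure (distr M (gauss ?K) (\<lambda>\<omega>. \<lambda>k\<in>?K. ?X k \<omega>)) A = emeasure (gauss ?K) A"
        using A prob_space.emeasure_space_1[OF prob_space_gauss[of ?K]] by auto
    qed simp
  next
    case False
    have "distr M (\<Pi>\<^sub>M k\<in>?K. borel) (\<lambda>\<omega>. \<lambda>k\<in>?K. ?X k \<omega>) = (\<Pi>\<^sub>M k\<in>?K. distr M borel (?X k))"
      using indep_vars_iff_distr_eq_PiM'[OF False rv] ind by simp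
    moreover have "(\<Pi>\<^sub>M k\<in>?K. distr M borel (?X k)) = gauss ?K"
      by (intro PiM_cong refl law)
    moreover have "distr M (\<Pi>\<^sub>M k\<in>?K. borel) (\<lambda>\<omega>. \<lambda>k\<in>?K. ?X k \<omega>)
        = distr M (gauss ?K) (\<lambda>\<omega>. \<lambda>k\<in>?K. ?X k \<omega>)"
      by (intro distr_cong sets_PiM_cong refl) auto
    ultimately show ?thesis by simp
  qed
  note eq = this
  let ?F = "\<lambda>x. ln (partition_sum ?K (spins N) (coupling N \<beta>) (field_energy N h) x)"
  have en: "H_SK g N \<beta> \<sigma> \<omega> + h * real N * magnetization N \<sigma>
      = energy ?K (coupling N \<beta>) (field_energy N h) (\<lambda>k\<in>?K. ?X k \<omega>) \<sigma>" for \<sigma> \<omega>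
  proof -
    have "H_SK g N \<beta> \<sigma> \<omega> = (\<Sum>k\<in>?K. coupling N \<beta> \<sigma> k * (\<lambda>k\<in>?K. ?X k \<omega>) k)"
      unfolding H_SK_def pair_sum_def sum_distrib_left pairs_def[symmetric]
      by (intro sum.cong) (auto simp: coupling_def)
    moreover have "h * real N * magnetization N \<sigma> = field_energy N h \<sigma>"
      \<comment> \<open>At N = 0 the magnetization divides by 0, and both sides vanish.\<close>
      by (cases "N = 0") (auto simp: magnetization_def field_energy_def)
    ultimately show ?thesis by (simp add: energy_def)
  qed
  have F: "ln (\<Sum>\<sigma>\<in>spins N. exp (H_SK g N \<beta> \<sigma> \<omega> + h * real N * magnetization N \<sigma>)) = ?F (\<lambda>k\<in>?K. ?X k \<omega>)"
    for \<omega> by (simp add: en partition_sum_def)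
  have m: "?F \<in> borel_measurable (gauss ?K)" by measurable
  show "(LINT \<omega>|M. ln (\<Sum>\<sigma>\<in>spins N. exp (H_SK g N \<beta> \<sigma> \<omega> + h * real N * magnetization N \<sigma>))) = sk N \<beta> h"
    using integral_distr[OF rv' m] unfolding eq F sk_def free_energy_def by simp
  have "integrable (gauss ?K) ?F" by (intro integrable_ln_partition) auto
  then show "integrable M (\<lambda>\<omega>. ln (\<Sum>\<sigma>\<in>spins N. exp (H_SK g N \<beta> \<sigma> \<omega> + h * real N * magnetization N \<sigma>)))"
    using integrable_distr_eq[OF rv' m] unfolding eq F by simp
qed

section \<open>Replica-symmetric bound and dependence on the temperature\<close>

lemma ln_cosh_nonneg: "0 \<le> ln (cosh (y :: real))"
  using cosh_real_ge_1[of y] by simp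

lemma ln_cosh_le_abs: "ln (cosh (y :: real)) \<le> \<bar>y\<bar>"
proof -
  have "cosh y \<le> exp \<bar>y\<bar>" by (cases "y \<ge> 0") (auto simp: cosh_def)
  then have "ln (cosh y) \<le> ln (exp \<bar>y\<bar>)" using cosh_real_pos[of y] by (intro ln_mono) auto
  then show ?thesis by simp
qed

lemma measurable_ln_cosh [measurable]: "(\<lambda>z :: real. ln (cosh (c * z))) \<in> borel_measurable borel"
  by (intro borel_measurable_continuous_onI continuous_intros) auto

lemma integrable_ln_cosh: "integrable std_normal_distribution (\<lambda>z. ln (cosh (c * z)))"
proof (rule Bochner_Integration.integrable_bound)
  show "integrable std_normal_distribution (\<lambda>z. c * z)" using integrable_std_normal_id by simp
  show "AE z in std_normal_distribution. norm (ln (cosh (c * z))) \<le> norm (c * z)"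
    using ln_cosh_nonneg ln_cosh_le_abs by simp
qed simp

lemma sum_spins_exp:
  "(\<Sum>\<sigma>\<in>spins N. exp (\<Sum>i = 1..N. c i * \<sigma> i)) = (\<Prod>i = 1..N. 2 * cosh (c i))"
proof -
  have "(\<Prod>i = 1..N. 2 * cosh (c i)) = (\<Prod>i = 1..N. \<Sum>s\<in>{-1, 1}. exp (c i * s))"
    by (intro prod.cong) (auto simp: cosh_def)
  also have "\<dots> = (\<Sum>\<sigma>\<in>spins N. \<Prod>i = 1..N. exp (c i * \<sigma> i))"
    unfolding spins_def by (intro prod_sum_PiE) auto
  finally show ?thesis by (simp add: exp_sum)
qed

text \<open>Guerra's replica-symmetric bound: the comparison error is
  \<open>\<beta>\<^sup>2 N / 4 * ((1 - q)\<^sup>2 - (R - q)\<^sup>2)\<close> in the overlap \<open>R\<close>.\<close>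

lemma sk_le_replica_symmetric:
  assumes N: "0 < N" and q: "0 \<le> q"
  shows "sk N \<beta> 0 \<le> real N * (ln 2 + (LINT z|std_normal_distribution. ln (cosh (\<beta> * sqrt q * z)))
    + \<beta>\<^sup>2 / 4 * (1 - q)\<^sup>2)"
proof -
  \<comment> \<open>The comparison model has independent site fields of variance \<beta>^2 q: its
    covariance is linear in the overlap and its partition sum factorises over sites.\<close>
  let ?B = "\<lambda>(\<sigma> :: nat \<Rightarrow> real) i. \<beta> * sqrt q * \<sigma> i"
  let ?d = "field_energy N 0"
  have "sk N \<beta> 0 \<le> free_energy {1..N} (spins N) ?B ?d + real N * (\<beta>\<^sup>2 / 4 * (1 - q)\<^sup>2)"
    unfolding sk_def
  proof (rule free_energy_comparison)
    fix \<sigma> \<tau> assume s: "\<sigma> \<in> spins N" "\<tau> \<in> spins N"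
    let ?r = "overlap_sum N \<sigma> \<tau>"
    have "?B \<sigma> i * (?B \<sigma> i - ?B \<tau> i) = \<beta>\<^sup>2 * q * (\<sigma> i * \<sigma> i - \<sigma> i * \<tau> i)" for i
    proof -
      have "\<beta> * s * a * (\<beta> * s * a - \<beta> * s * b) = \<beta>\<^sup>2 * s\<^sup>2 * (a * a - a * b)" for s a b :: real
        by (simp add: power2_eq_square algebra_simps)
      from this[of "sqrt q" "\<sigma> i" "\<tau> i"] show ?thesis using q by simp
    qed
    then have "(\<Sum>i = 1..N. ?B \<sigma> i * (?B \<sigma> i - ?B \<tau> i)) = \<beta>\<^sup>2 * q * (\<Sum>i = 1..N. \<sigma> i * \<sigma> i - \<sigma> i * \<tau> i)"
      by (simp add: sum_distrib_left)
    also have "(\<Sum>i = 1..N. \<sigma> i * \<sigma> i - \<sigma> i * \<tau> i) = real N - ?r"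
      using overlap_sum_self[OF s(1)] unfolding overlap_sum_def sum_subtractf by simp
    finally have B: "(\<Sum>i = 1..N. ?B \<sigma> i * (?B \<sigma> i - ?B \<tau> i)) = \<beta>\<^sup>2 * q * (real N - ?r)" .
    \<comment> \<open>Only a nonpositive multiple of (R - q)^2 is discarded, so the upper bound
      holds for every trial q.\<close>
    have "\<beta>\<^sup>2 / 2 * (real N - ?r\<^sup>2 / real N) - \<beta>\<^sup>2 * q * (real N - ?r)
      = 2 * (real N * (\<beta>\<^sup>2 / 4 * (1 - q)\<^sup>2)) - \<beta>\<^sup>2 / 2 * real N * (?r / real N - q)\<^sup>2"
      using N by (simp add: field_simps power2_eq_square)
    moreover have "0 \<le> \<beta>\<^sup>2 / 2 * real N * (?r / real N - q)\<^sup>2" by simp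
    ultimately show "(\<Sum>k\<in>pairs N. coupling N \<beta> \<sigma> k * (coupling N \<beta> \<sigma> k - coupling N \<beta> \<tau> k))
        - (\<Sum>i = 1..N. ?B \<sigma> i * (?B \<sigma> i - ?B \<tau> i)) \<le> 2 * (real N * (\<beta>\<^sup>2 / 4 * (1 - q)\<^sup>2))"
      unfolding B coupling_inner_diff[OF s N] by linarith
  qed auto
  also have "free_energy {1..N} (spins N) ?B ?d
      = (LINT x|gauss {1..N}. (\<Sum>i = 1..N. ln 2 + ln (cosh (\<beta> * sqrt q * x i))))"
    unfolding free_energy_def
  proof (rule Bochner_Integration.integral_cong[OF refl])
    fix x
    have "partition_sum {1..N} (spins N) ?B ?d x = (\<Sum>\<sigma>\<in>spins N. exp (\<Sum>i = 1..N. (\<beta> * sqrt q * x i) * \<sigma> i))"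
      by (simp add: partition_sum_def energy_def field_energy_def mult_ac)
    also have "\<dots> = (\<Prod>i = 1..N. 2 * cosh (\<beta> * sqrt q * x i))" by (rule sum_spins_exp)
    finally show "ln (partition_sum {1..N} (spins N) ?B ?d x) = (\<Sum>i = 1..N. ln 2 + ln (cosh (\<beta> * sqrt q * x i)))"
      by (simp add: ln_prod ln_mult)
  qed
  also have "\<dots> = (\<Sum>i = 1..N. ln 2 + (LINT z|std_normal_distribution. ln (cosh (\<beta> * sqrt q * z))))"
  proof -
    have int: "integrable (gauss {1..N}) (\<lambda>x. ln (cosh (\<beta> * sqrt q * x i)))"
      and eq: "(LINT x|gauss {1..N}. ln (cosh (\<beta> * sqrt q * x i)))
        = (LINT z|std_normal_distribution. ln (cosh (\<beta> * sqrt q * z)))" if "i \<in> {1..N}" for i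
      using gauss_integrable_component[OF that measurable_ln_cosh integrable_ln_cosh]
        gauss_integral_component[OF that measurable_ln_cosh] by auto
    have "prob_space (gauss {1..N})" by (rule prob_space_gauss)
    then interpret prob_space "gauss {1..N}" .
    have "(LINT x|gauss {1..N}. (\<Sum>i = 1..N. ln 2 + ln (cosh (\<beta> * sqrt q * x i))))
        = (\<Sum>i = 1..N. (LINT x|gauss {1..N}. ln 2 + ln (cosh (\<beta> * sqrt q * x i))))"
      using int by (intro Bochner_Integration.integral_sum Bochner_Integration.integrable_add integrable_const)
    also have "\<dots> = (\<Sum>i = 1..N. ln 2 + (LINT z|std_normal_distribution. ln (cosh (\<beta> * sqrt q * z))))"
    proof (rule sum.cong[OF refl])
      fix i assume i: "i \<in> {1..N}"
      show "(LINT x|gauss {1..N}. ln 2 + ln (cosh (\<beta> * sqrt q * x i)))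
          = ln 2 + (LINT z|std_normal_distribution. ln (cosh (\<beta> * sqrt q * z)))"
        unfolding eq[OF i, symmetric]
        using Bochner_Integration.integral_add[OF integrable_const int[OF i], of "ln 2"] prob_space
        by (simp del: One_nat_def)
    qed
    finally show ?thesis .
  qed
  finally show ?thesis by (simp add: algebra_simps)
qed

lemma overlap_sum_square_le:
  assumes "\<sigma> \<in> spins N" "\<tau> \<in> spins N" "0 < N"
  shows "(overlap_sum N \<sigma> \<tau>)\<^sup>2 / real N \<le> real N"
proof -
  have "(overlap_sum N \<sigma> \<tau>)\<^sup>2 \<le> (real N)\<^sup>2"
    using power_mono[OF abs_overlap_sum_le[OF assms(1,2)], of 2] by simp
  then show ?thesis using assms(3) by (simp add: field_simps power2_eq_square)
qed

text \<open>N - R^2/N lies between 0 and N, R being the unnormalised overlap: the lower bound gives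
  monotonicity, the upper one the slope 1/4 in \<beta>^2.\<close>

lemma sk_mono_beta:
  assumes N: "0 < N" and le: "\<beta>\<^sup>2 \<le> \<beta>'\<^sup>2"
  shows "sk N \<beta> h \<le> sk N \<beta>' h"
    and "sk N \<beta>' h \<le> sk N \<beta> h + real N * ((\<beta>'\<^sup>2 - \<beta>\<^sup>2) / 4)"
proof -
  have X: "0 \<le> real N - (overlap_sum N \<sigma> \<tau>)\<^sup>2 / real N" "real N - (overlap_sum N \<sigma> \<tau>)\<^sup>2 / real N \<le> real N"
    if "\<sigma> \<in> spins N" "\<tau> \<in> spins N" for \<sigma> \<tau>
    using overlap_sum_square_le[OF that N] by auto
  have "sk N \<beta> h \<le> sk N \<beta>' h + 0"
    unfolding sk_def
  proof (rule free_energy_comparison)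
    fix \<sigma> \<tau> assume s: "\<sigma> \<in> spins N" "\<tau> \<in> spins N"
    show "(\<Sum>k\<in>pairs N. coupling N \<beta> \<sigma> k * (coupling N \<beta> \<sigma> k - coupling N \<beta> \<tau> k)) -
        (\<Sum>k\<in>pairs N. coupling N \<beta>' \<sigma> k * (coupling N \<beta>' \<sigma> k - coupling N \<beta>' \<tau> k)) \<le> 2 * 0"
      unfolding coupling_inner_diff[OF s N] using X(1)[OF s] le
        mult_right_mono[of "\<beta>\<^sup>2 / 2" "\<beta>'\<^sup>2 / 2" "real N - (overlap_sum N \<sigma> \<tau>)\<^sup>2 / real N"] by simp
  qed auto
  then show "sk N \<beta> h \<le> sk N \<beta>' h" by simp
  show "sk N \<beta>' h \<le> sk N \<beta> h + real N * ((\<beta>'\<^sup>2 - \<beta>\<^sup>2) / 4)"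
    unfolding sk_def
  proof (rule free_energy_comparison)
    fix \<sigma> \<tau> assume s: "\<sigma> \<in> spins N" "\<tau> \<in> spins N"
    have "(\<beta>'\<^sup>2 - \<beta>\<^sup>2) / 2 * (real N - (overlap_sum N \<sigma> \<tau>)\<^sup>2 / real N) \<le> (\<beta>'\<^sup>2 - \<beta>\<^sup>2) / 2 * real N"
      using X(2)[OF s] le by (intro mult_left_mono) auto
    then show "(\<Sum>k\<in>pairs N. coupling N \<beta>' \<sigma> k * (coupling N \<beta>' \<sigma> k - coupling N \<beta>' \<tau> k)) -
        (\<Sum>k\<in>pairs N. coupling N \<beta> \<sigma> k * (coupling N \<beta> \<sigma> k - coupling N \<beta> \<tau> k))
        \<le> 2 * (real N * ((\<beta>'\<^sup>2 - \<beta>\<^sup>2) / 4))"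
      unfolding coupling_inner_diff[OF s N] by (simp add: algebra_simps diff_divide_distrib)
  qed auto
qed

lemma sk_beta_zero: "sk N 0 h = real N * (ln 2 + ln (cosh h))"
proof -
  have "partition_sum (pairs N) (spins N) (coupling N 0) (field_energy N h) x = (2 * cosh h) ^ N" for x
  proof -
    have "energy (pairs N) (coupling N 0) (field_energy N h) x \<sigma> = (\<Sum>i = 1..N. h * \<sigma> i)" for \<sigma>
      by (simp add: energy_def coupling_def field_energy_def sum_distrib_left case_prod_unfold)
    then show ?thesis using sum_spins_exp[of "\<lambda>_. h" N] by (simp add: partition_sum_def)
  qed
  then show ?thesis
    unfolding sk_def free_energy_def
    by (simp add: ln_realpow ln_mult distrib_left prob_space.prob_space[OF prob_space_gauss])
qed

section \<open>Gauge invariance and the effect of a field\<close>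

definition flip_spins :: "nat \<Rightarrow> (nat \<Rightarrow> real) \<Rightarrow> (nat \<Rightarrow> real) \<Rightarrow> nat \<Rightarrow> real" where
  "flip_spins N \<tau> \<sigma> = (\<lambda>i\<in>{1..N}. \<sigma> i * \<tau> i)"

lemma flip_spins_in_spins:
  assumes "\<tau> \<in> spins N" "\<sigma> \<in> spins N" shows "flip_spins N \<tau> \<sigma> \<in> spins N"
  using spin_cases[OF assms(1)] spin_cases[OF assms(2)]
  unfolding flip_spins_def spins_def by fastforce

lemma flip_spins_flip_spins:
  assumes "\<tau> \<in> spins N" "\<sigma> \<in> spins N" shows "flip_spins N \<tau> (flip_spins N \<tau> \<sigma>) = \<sigma>"
proof
  fix i
  have "\<sigma> i * \<tau> i * \<tau> i = \<sigma> i" if "i \<in> {1..N}"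
    using spin_square[OF assms(1) that] by (simp add: mult.assoc)
  moreover have "\<sigma> i = undefined" if "i \<notin> {1..N}"
    using assms(2) that by (auto simp: spins_def PiE_iff extensional_def)
  ultimately show "flip_spins N \<tau> (flip_spins N \<tau> \<sigma>) i = \<sigma> i" by (simp add: flip_spins_def)
qed

lemma bij_betw_flip_spins: "\<tau> \<in> spins N \<Longrightarrow> bij_betw (flip_spins N \<tau>) (spins N) (spins N)"
  by (rule bij_betw_byWitness[where f' = "flip_spins N \<tau>"]) (auto simp: flip_spins_flip_spins flip_spins_in_spins)

lemma overlap_sum_flip_spins:
  assumes "\<tau> \<in> spins N"
  shows "overlap_sum N (flip_spins N \<tau> \<sigma>) (flip_spins N \<tau> \<rho>) = overlap_sum N \<sigma> \<rho>"
  unfolding overlap_sum_def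
proof (rule sum.cong[OF refl])
  fix i assume i: "i \<in> {1..N}"
  have "flip_spins N \<tau> \<sigma> i * flip_spins N \<tau> \<rho> i = \<sigma> i * \<rho> i * (\<tau> i * \<tau> i)" using i by (simp add: flip_spins_def)
  then show "flip_spins N \<tau> \<sigma> i * flip_spins N \<tau> \<rho> i = \<sigma> i * \<rho> i" using spin_square[OF assms i] by simp
qed

text \<open>Reindexing the configurations by \<tau> moves the flip into the couplings. Their
  covariances depend only on overlaps, which are invariant, so comparison with c = 0 in both
  directions gives equality.\<close>

lemma free_energy_gauge:
  assumes N: "0 < N" and \<tau>: "\<tau> \<in> spins N"
  shows "free_energy (pairs N) (spins N) (coupling N \<beta>) (\<lambda>\<sigma>. d (flip_spins N \<tau> \<sigma>))
       = free_energy (pairs N) (spins N) (coupling N \<beta>) d"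
proof -
  let ?A = "\<lambda>\<sigma>. coupling N \<beta> (flip_spins N \<tau> \<sigma>)"
  have "partition_sum (pairs N) (spins N) (coupling N \<beta>) (\<lambda>\<sigma>. d (flip_spins N \<tau> \<sigma>)) x
      = partition_sum (pairs N) (spins N) ?A d x" for x
  proof -
    have "partition_sum (pairs N) (spins N) (coupling N \<beta>) (\<lambda>\<sigma>. d (flip_spins N \<tau> \<sigma>)) x
      = (\<Sum>\<sigma>\<in>spins N. exp (energy (pairs N) (coupling N \<beta>) (\<lambda>\<sigma>. d (flip_spins N \<tau> \<sigma>)) x (flip_spins N \<tau> \<sigma>)))"
      unfolding partition_sum_def
      by (rule sum.reindex_bij_betw[OF bij_betw_flip_spins[OF \<tau>], symmetric])
    also have "\<dots> = partition_sum (pairs N) (spins N) ?A d x"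
      unfolding partition_sum_def by (intro sum.cong refl) (simp add: energy_def flip_spins_flip_spins[OF \<tau>])
    finally show ?thesis .
  qed
  then have 1: "free_energy (pairs N) (spins N) (coupling N \<beta>) (\<lambda>\<sigma>. d (flip_spins N \<tau> \<sigma>))
      = free_energy (pairs N) (spins N) ?A d"
    by (simp add: free_energy_def)
  have inner: "(\<Sum>k\<in>pairs N. ?A \<sigma> k * (?A \<sigma> k - ?A \<rho> k))
      = (\<Sum>k\<in>pairs N. coupling N \<beta> \<sigma> k * (coupling N \<beta> \<sigma> k - coupling N \<beta> \<rho> k))"
    if "\<sigma> \<in> spins N" "\<rho> \<in> spins N" for \<sigma> \<rho>
    using that \<tau> N by (simp add: coupling_inner_diff flip_spins_in_spins overlap_sum_flip_spins)
  have "free_energy (pairs N) (spins N) ?A d \<le> free_energy (pairs N) (spins N) (coupling N \<beta>) d + 0"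
    by (rule free_energy_comparison) (simp_all add: inner)
  moreover have "free_energy (pairs N) (spins N) (coupling N \<beta>) d \<le> free_energy (pairs N) (spins N) ?A d + 0"
    by (rule free_energy_comparison) (simp_all add: inner)
  ultimately show ?thesis using 1 by simp
qed

text \<open>The tangent of the concave logarithm at y. Averaged with y equal to the mean, it plays
  the part of Jensen's inequality.\<close>

lemma ln_le_tangent: "0 < z \<Longrightarrow> 0 < y \<Longrightarrow> ln z \<le> ln y + (z / y - 1)" for y z :: real
  using ln_le_minus_one[of "z / y"] by (simp add: ln_div)

text \<open>By gauge invariance the uniform field may be replaced by \<open>h \<tau>\<^sub>i\<close> for every spin
  configuration \<open>\<tau>\<close>; averaging over \<open>\<tau>\<close> inside the logarithm yields the factor \<open>cosh h ^ N\<close>.\<close>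

lemma sk_field_le:
  assumes N: "0 < N"
  shows "sk N \<beta> h \<le> sk N \<beta> 0 + real N * ln (cosh h)"
proof -
  let ?S = "spins N" and ?K = "pairs N"
  let ?Z = "\<lambda>d. partition_sum ?K ?S (coupling N \<beta>) d"
  let ?d = "\<lambda>\<tau> \<sigma>. field_energy N h (flip_spins N \<tau> \<sigma>)"
  \<comment> \<open>The mean over \<tau> of the gauged partition sums, as \<open>avg\<close> shows;
    this makes the linear terms of the tangent bound cancel.\<close>
  let ?Y = "\<lambda>x. ?Z (field_energy N 0) x * cosh h ^ N"
  have Zpos: "0 < ?Z d x" for d x by (rule partition_pos) auto
  have Y: "0 < ?Y x" for x using Zpos[of "field_energy N 0" x] by simp
  have avg: "(\<Sum>\<tau>\<in>?S. ?Z (?d \<tau>) x) = 2 ^ N * ?Y x" for x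
  proof -
    have "(\<Sum>\<tau>\<in>?S. exp (?d \<tau> \<sigma>)) = (2 * cosh h) ^ N" if \<sigma>: "\<sigma> \<in> ?S" for \<sigma>
    proof -
      have "(\<Sum>\<tau>\<in>?S. exp (?d \<tau> \<sigma>)) = (\<Sum>\<tau>\<in>?S. exp (\<Sum>i = 1..N. h * \<sigma> i * \<tau> i))"
        by (intro sum.cong refl) (simp add: field_energy_def flip_spins_def sum_distrib_left mult.assoc)
      also have "\<dots> = (\<Prod>i = 1..N. 2 * cosh (h * \<sigma> i))" by (rule sum_spins_exp)
      also have "\<dots> = (\<Prod>i = 1..N. 2 * cosh h)"
        using spin_cases[OF \<sigma>] by (intro prod.cong refl) (metis cosh_minus mult.right_neutral mult_minus1_right)
      finally show ?thesis by simp
    qed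
    note inner = this
    have "(\<Sum>\<tau>\<in>?S. ?Z (?d \<tau>) x) = (\<Sum>\<tau>\<in>?S. \<Sum>\<sigma>\<in>?S. exp (energy ?K (coupling N \<beta>) (field_energy N 0) x \<sigma>) * exp (?d \<tau> \<sigma>))"
      unfolding partition_sum_def by (intro sum.cong refl) (simp add: energy_def field_energy_def mult.commute flip: exp_add)
    also have "\<dots> = (\<Sum>\<sigma>\<in>?S. exp (energy ?K (coupling N \<beta>) (field_energy N 0) x \<sigma>) * (\<Sum>\<tau>\<in>?S. exp (?d \<tau> \<sigma>)))"
      by (subst sum.swap) (simp add: sum_distrib_left)
    also have "\<dots> = 2 ^ N * ?Y x"
      using inner by (simp add: partition_sum_def power_mult_distrib mult_ac flip: sum_distrib_left)
    finally show ?thesis .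
  qed
  have jensen: "(\<Sum>\<tau>\<in>?S. ln (?Z (?d \<tau>) x)) \<le> 2 ^ N * ln (?Y x)" for x
  proof -
    have "ln (?Z (?d \<tau>) x) \<le> ln (?Y x) + (?Z (?d \<tau>) x / ?Y x - 1)" for \<tau>
      by (rule ln_le_tangent[OF Zpos Y])
    then have "(\<Sum>\<tau>\<in>?S. ln (?Z (?d \<tau>) x)) \<le> (\<Sum>\<tau>\<in>?S. ln (?Y x) + (?Z (?d \<tau>) x / ?Y x - 1))"
      by (intro sum_mono)
    also have "\<dots> = 2 ^ N * ln (?Y x) + ((\<Sum>\<tau>\<in>?S. ?Z (?d \<tau>) x) / ?Y x - 2 ^ N)"
      by (simp add: sum.distrib sum_subtractf card_spins sum_divide_distrib)
    also have "\<dots> = 2 ^ N * ln (?Y x)" unfolding avg using Zpos[of "field_energy N 0" x] by simp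
    finally show ?thesis .
  qed
  have int: "integrable (gauss ?K) (\<lambda>x. ln (?Z d x))" for d by (rule integrable_ln_partition) auto
  have "prob_space (gauss ?K)" by (rule prob_space_gauss)
  then interpret prob_space "gauss ?K" .
  have lnY: "ln (?Y x) = ln (?Z (field_energy N 0) x) + real N * ln (cosh h)" for x
    using Zpos[of "field_energy N 0" x] by (simp add: ln_mult ln_realpow)
  have "2 ^ N * sk N \<beta> h = (\<Sum>\<tau>\<in>?S. free_energy ?K ?S (coupling N \<beta>) (?d \<tau>))"
    using free_energy_gauge[OF N, of _ \<beta> "field_energy N h"] by (simp add: sk_def card_spins)
  also have "\<dots> = (LINT x|gauss ?K. (\<Sum>\<tau>\<in>?S. ln (?Z (?d \<tau>) x)))"
    unfolding free_energy_def by (rule Bochner_Integration.integral_sum[symmetric]) (rule int)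
  also have "\<dots> \<le> (LINT x|gauss ?K. 2 ^ N * (ln (?Z (field_energy N 0) x) + real N * ln (cosh h)))"
    using jensen unfolding lnY
    by (intro integral_mono Bochner_Integration.integrable_sum integrable_mult_right
        Bochner_Integration.integrable_add int integrable_const)
  also have "\<dots> = 2 ^ N * (sk N \<beta> 0 + real N * ln (cosh h))"
    using Bochner_Integration.integral_add[OF int integrable_const] prob_space
    by (simp add: sk_def free_energy_def)
  finally show ?thesis by simp
qed

section \<open>Thermodynamic limits\<close>

definition left_block :: "nat \<Rightarrow> (nat \<Rightarrow> real) \<Rightarrow> nat \<Rightarrow> real" where
  "left_block m \<sigma> = (\<lambda>i\<in>{1..m}. \<sigma> i)"

definition right_block :: "nat \<Rightarrow> nat \<Rightarrow> (nat \<Rightarrow> real) \<Rightarrow> nat \<Rightarrow> real" where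
  "right_block m n \<sigma> = (\<lambda>i\<in>{1..n}. \<sigma> (i + m))"

lemma block_in_spins:
  assumes "\<sigma> \<in> spins (m + n)"
  shows "left_block m \<sigma> \<in> spins m" "right_block m n \<sigma> \<in> spins n"
proof -
  have "\<sigma> i \<in> {-1, 1}" if "i \<in> {1..m + n}" for i using spin_cases[OF assms that] by auto
  then show "left_block m \<sigma> \<in> spins m" "right_block m n \<sigma> \<in> spins n"
    unfolding left_block_def right_block_def spins_def restrict_PiE_iff by simp_all
qed

lemma sum_split_blocks:
  fixes f :: "nat \<Rightarrow> real"
  shows "(\<Sum>i = 1..m + n. f i) = (\<Sum>i = 1..m. f i) + (\<Sum>i = 1..n. f (i + m))"
proof -
  have "(\<Sum>i = 1..m + n. f i) = (\<Sum>i = 1..m. f i) + (\<Sum>i = m + 1..m + n. f i)"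
    by (rule sum.ub_add_nat) simp
  also have "(\<Sum>i = m + 1..m + n. f i) = (\<Sum>i = 1..n. f (i + m))"
    using sum.shift_bounds_cl_nat_ivl[of f 1 m n] by (simp add: add.commute)
  finally show ?thesis .
qed

lemma bij_betw_blocks:
  "bij_betw (\<lambda>\<sigma>. (left_block m \<sigma>, right_block m n \<sigma>)) (spins (m + n)) (spins m \<times> spins n)"
proof (rule bij_betw_byWitness[where f' = "\<lambda>(a, b). \<lambda>i\<in>{1..m + n}. if i \<le> m then a i else b (i - m)"])
  show "\<forall>\<sigma>\<in>spins (m + n). (case (left_block m \<sigma>, right_block m n \<sigma>) of (a, b) \<Rightarrow>
      \<lambda>i\<in>{1..m + n}. if i \<le> m then a i else b (i - m)) = \<sigma>"
    by (auto simp: left_block_def right_block_def spins_def PiE_iff extensional_def fun_eq_iff)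
  show "\<forall>p\<in>spins m \<times> spins n. (\<lambda>\<sigma>. (left_block m \<sigma>, right_block m n \<sigma>))
      (case p of (a, b) \<Rightarrow> \<lambda>i\<in>{1..m + n}. if i \<le> m then a i else b (i - m)) = p"
    by (auto simp: left_block_def right_block_def spins_def PiE_iff extensional_def fun_eq_iff)
  show "(\<lambda>\<sigma>. (left_block m \<sigma>, right_block m n \<sigma>)) ` spins (m + n) \<subseteq> spins m \<times> spins n"
    by (auto simp: block_in_spins)
  show "(\<lambda>(a, b). \<lambda>i\<in>{1..m + n}. if i \<le> m then a i else b (i - m)) ` (spins m \<times> spins n) \<subseteq> spins (m + n)"
  proof (rule image_subsetI)
    fix p assume p: "p \<in> spins m \<times> spins n"
    obtain a b where ab: "p = (a, b)" by (cases p)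
    have a: "a i \<in> {-1, 1}" if "i \<in> {1..m}" for i using p that by (auto simp: ab spins_def)
    have b: "b i \<in> {-1, 1}" if "i \<in> {1..n}" for i using p that by (auto simp: ab spins_def)
    show "(case p of (a, b) \<Rightarrow> \<lambda>i\<in>{1..m + n}. if i \<le> m then a i else b (i - m)) \<in> spins (m + n)"
      unfolding ab spins_def prod.case restrict_PiE_iff
    proof
      fix i assume i: "i \<in> {1..m + n}"
      show "(if i \<le> m then a i else b (i - m)) \<in> {-1, 1}"
      proof (cases "i \<le> m")
        case True
        then show ?thesis using a[of i] i by auto
      next
        case False
        then have "i - m \<in> {1..n}" using i by auto
        with b[OF this] False show ?thesis by simp
      qed
    qed
  qed
qed

text \<open>Weighted convexity of the square; the defect is itself a square.\<close>

lemma square_sum_div_le: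
  fixes r s a b :: real
  assumes "0 < a" "0 < b"
  shows "(r + s)\<^sup>2 / (a + b) \<le> r\<^sup>2 / a + s\<^sup>2 / b"
proof -
  have "r\<^sup>2 / a + s\<^sup>2 / b - (r + s)\<^sup>2 / (a + b) = (r * b - s * a)\<^sup>2 / (a * b * (a + b))"
    using assms by (simp add: divide_simps) (simp add: algebra_simps power2_eq_square)
  also have "\<dots> \<ge> 0" using assms by simp
  finally show ?thesis by simp
qed

text \<open>Interpolation of Guerra and Toninelli: the whole system is compared with two independent
  blocks. Block overlaps add up, and convexity of the square puts R^2/N of the whole below the sum
  of the block terms, so the whole system has the larger free energy.\<close>

lemma sk_superadditive:
  assumes m: "0 < m" and n: "0 < n"
  shows "sk m \<beta> h + sk n \<beta> h \<le> sk (m + n) \<beta> h"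
proof -
  let ?l = "left_block m" and ?r = "right_block m n" and ?S = "spins (m + n)"
  let ?L = "pairs m <+> pairs n"
  define B where "B \<sigma> = case_sum (coupling m \<beta> (?l \<sigma>)) (coupling n \<beta> (?r \<sigma>))" for \<sigma>
  have "free_energy ?L ?S B (field_energy (m + n) h) \<le> sk (m + n) \<beta> h + 0"
    unfolding sk_def
  proof (rule free_energy_comparison)
    fix \<sigma> \<tau> assume s: "\<sigma> \<in> ?S" "\<tau> \<in> ?S"
    let ?a = "overlap_sum m (?l \<sigma>) (?l \<tau>)" and ?b = "overlap_sum n (?r \<sigma>) (?r \<tau>)"
    have ov: "overlap_sum (m + n) \<sigma> \<tau> = ?a + ?b"
      unfolding overlap_sum_def sum_split_blocks by (simp add: left_block_def right_block_def)
    have "(\<Sum>l\<in>?L. B \<sigma> l * (B \<sigma> l - B \<tau> l))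
        = \<beta>\<^sup>2 / 2 * (real m - ?a\<^sup>2 / real m) + \<beta>\<^sup>2 / 2 * (real n - ?b\<^sup>2 / real n)"
      using s m n by (simp add: sum.Plus B_def coupling_inner_diff block_in_spins)
    moreover have "(\<Sum>k\<in>pairs (m + n). coupling (m + n) \<beta> \<sigma> k * (coupling (m + n) \<beta> \<sigma> k - coupling (m + n) \<beta> \<tau> k))
        = \<beta>\<^sup>2 / 2 * (real m + real n - (?a + ?b)\<^sup>2 / (real m + real n))"
      using s m by (simp add: coupling_inner_diff ov)
    moreover have "\<beta>\<^sup>2 / 2 * ((?a + ?b)\<^sup>2 / (real m + real n)) \<le> \<beta>\<^sup>2 / 2 * (?a\<^sup>2 / real m + ?b\<^sup>2 / real n)"
      using m n by (intro mult_left_mono square_sum_div_le) auto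
    ultimately show "(\<Sum>l\<in>?L. B \<sigma> l * (B \<sigma> l - B \<tau> l)) - (\<Sum>k\<in>pairs (m + n).
        coupling (m + n) \<beta> \<sigma> k * (coupling (m + n) \<beta> \<sigma> k - coupling (m + n) \<beta> \<tau> k)) \<le> 2 * 0"
      by (simp add: right_diff_distrib distrib_left)
  qed auto
  moreover have "free_energy ?L ?S B (field_energy (m + n) h) = sk m \<beta> h + sk n \<beta> h"
  proof -
    let ?Zm = "partition_sum (pairs m) (spins m) (coupling m \<beta>) (field_energy m h)"
    let ?Zn = "partition_sum (pairs n) (spins n) (coupling n \<beta>) (field_energy n h)"
    let ?x = "\<lambda>x. \<lambda>k\<in>pairs m. x (Inl k)" and ?y = "\<lambda>x. \<lambda>k\<in>pairs n. x (Inr k)"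
    have "partition_sum ?L ?S B (field_energy (m + n) h) x = ?Zm (?x x) * ?Zn (?y x)" for x
    proof -
      let ?e = "\<lambda>p. exp (energy (pairs m) (coupling m \<beta>) (field_energy m h) (?x x) (fst p)
          + energy (pairs n) (coupling n \<beta>) (field_energy n h) (?y x) (snd p))"
      have "energy ?L B (field_energy (m + n) h) x \<sigma>
          = energy (pairs m) (coupling m \<beta>) (field_energy m h) (?x x) (?l \<sigma>)
          + energy (pairs n) (coupling n \<beta>) (field_energy n h) (?y x) (?r \<sigma>)" for \<sigma>
        unfolding energy_def field_energy_def sum_split_blocks
        by (simp add: sum.Plus B_def left_block_def right_block_def distrib_left)
      then have "partition_sum ?L ?S B (field_energy (m + n) h) x = (\<Sum>\<sigma>\<in>?S. ?e (?l \<sigma>, ?r \<sigma>))"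
        by (simp add: partition_sum_def)
      also have "\<dots> = (\<Sum>p\<in>spins m \<times> spins n. ?e p)"
        by (rule sum.reindex_bij_betw[OF bij_betw_blocks])
      also have "\<dots> = ?Zm (?x x) * ?Zn (?y x)"
        by (simp add: partition_sum_def sum_product sum.cartesian_product exp_add case_prod_unfold)
      finally show ?thesis .
    qed
    moreover have "0 < ?Zm x" "0 < ?Zn x" for x by (rule partition_pos; simp)+
    ultimately have "free_energy ?L ?S B (field_energy (m + n) h)
        = (LINT x|gauss ?L. ln (?Zm (?x x)) + ln (?Zn (?y x)))"
      by (simp add: free_energy_def ln_mult less_imp_neq[THEN not_sym])
    also have "\<dots> = (LINT x|gauss ?L. ln (?Zm (?x x))) + (LINT x|gauss ?L. ln (?Zn (?y x)))"
    proof (rule Bochner_Integration.integral_add)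
      show "integrable (gauss ?L) (\<lambda>x. ln (?Zm (?x x)))"
        by (subst gauss_integral_reindex(2)[where f = "\<lambda>x. ln (?Zm x)"])
           (auto intro!: integrable_ln_partition)
      show "integrable (gauss ?L) (\<lambda>x. ln (?Zn (?y x)))"
        by (subst gauss_integral_reindex(2)[where f = "\<lambda>x. ln (?Zn x)"])
           (auto intro!: integrable_ln_partition)
    qed
    also have "(LINT x|gauss ?L. ln (?Zm (?x x))) = sk m \<beta> h"
      unfolding sk_def free_energy_def
      by (rule gauss_integral_reindex(1)[where f = "\<lambda>x. ln (?Zm x)"]) auto
    also have "(LINT x|gauss ?L. ln (?Zn (?y x))) = sk n \<beta> h"
      unfolding sk_def free_energy_def
      by (rule gauss_integral_reindex(1)[where f = "\<lambda>x. ln (?Zn x)"]) auto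
    finally show ?thesis .
  qed
  ultimately show ?thesis by simp
qed

section \<open>Fekete's lemma and the thermodynamic limits\<close>

lemma superadditive_convergent:
  fixes a :: "nat \<Rightarrow> real"
  assumes super: "\<And>m n. 0 < m \<Longrightarrow> 0 < n \<Longrightarrow> a m + a n \<le> a (m + n)"
    and bound: "\<And>n. 0 < n \<Longrightarrow> a n \<le> C * real n"
  shows "convergent (\<lambda>n. a n / real n)"
proof -
  let ?A = "(\<lambda>n. a n / real n) ` {0<..}"
  define L where "L = Sup ?A"
  have bdd: "bdd_above ?A" using bound by (intro bdd_aboveI[of _ C]) (auto simp: field_simps)
  have upper: "a n / real n \<le> L" if "0 < n" for n
    unfolding L_def using bdd that by (intro cSup_upper) auto
  have mult: "real q * a m + a r \<le> a (q * m + r)" if "0 < m" "0 < r" for q m r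
  proof (induction q)
    case (Suc q)
    show ?case using super[of m "q * m + r"] that Suc by (simp add: algebra_simps)
  qed simp
  have "(\<lambda>n. a n / real n) \<longlonglongrightarrow> L"
  proof (rule LIMSEQ_I)
    fix e :: real assume e: "0 < e"
    obtain m where m: "0 < m" "L - e / 2 < a m / real m"
      using less_cSupD[of ?A "L - e / 2"] e by (auto simp: L_def)
    define s where "s = a m / real m"
    define D where "D = real m * \<bar>s\<bar> + (\<Sum>r = 1..m. \<bar>a r\<bar>)"
    have lower: "real n * s - D \<le> a n" if "0 < n" for n
    proof -
      \<comment> \<open>The remainder runs over 1..m instead of 0..m-1 because superadditivity is
        assumed only for positive arguments.\<close>
      define q r where "q = (n - 1) div m" and "r = (n - 1) mod m + 1"
      have n: "n = q * m + r" using that by (simp add: q_def r_def)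
      have r: "0 < r" "r \<le> m" using m(1) by (auto simp: r_def Suc_leI)
      have "a r \<ge> - (\<Sum>r = 1..m. \<bar>a r\<bar>)"
        using member_le_sum[of r "{1..m}" "\<lambda>r. \<bar>a r\<bar>"] r by auto
      moreover have "real q * a m = real n * s - real r * s"
        using m(1) by (simp add: n s_def algebra_simps)
      moreover have "real r * s \<le> real m * \<bar>s\<bar>"
      proof -
        have "real r * s \<le> real r * \<bar>s\<bar>" by (intro mult_left_mono) auto
        also have "\<dots> \<le> real m * \<bar>s\<bar>" using r by (intro mult_right_mono) auto
        finally show ?thesis .
      qed
      ultimately show ?thesis using mult[OF m(1) r(1), of q] by (simp add: n D_def)
    qed
    obtain n0 where n0: "D * 2 / e < real n0" using reals_Archimedean2 by blast
    show "\<exists>n0. \<forall>n\<ge>n0. norm (a n / real n - L) < e"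
    proof (intro exI allI impI)
      fix n assume n: "n \<ge> Suc n0"
      then have "D < e / 2 * real n" using n0 e by (simp add: field_simps) (smt (verit) mult_left_mono of_nat_mono Suc_leD)
      then have "real n * (s - e / 2) < a n" using lower[of n] n by (simp add: algebra_simps)
      then have "s - e / 2 < a n / real n" using n by (simp add: field_simps)
      then have "L - e < a n / real n" using m(2) by (simp add: s_def)
      then show "norm (a n / real n - L) < e" using upper[of n] n e by simp
    qed
  qed
  then show ?thesis by (rule convergentI)
qed

text \<open>Comparison with \<beta> = 0 provides the linear bound that Fekete's lemma asks
  for.\<close>

lemma sk_le_annealed:
  assumes "0 < N" shows "sk N \<beta> h \<le> real N * (ln 2 + ln (cosh h) + \<beta>\<^sup>2 / 4)"
  using sk_mono_beta(2)[OF assms, of 0 \<beta> h] sk_beta_zero[of N h] by (simp add: algebra_simps)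

lemma sk_convergent: "convergent (\<lambda>N. sk N \<beta> h / real N)"
  by (rule superadditive_convergent[OF sk_superadditive, where C = "ln 2 + ln (cosh h) + \<beta>\<^sup>2 / 4"])
     (use sk_le_annealed in \<open>auto simp: mult.commute\<close>)

lemma F_SK_limit:
  assumes "iid_std_gaussian M g"
  shows "(\<lambda>N. sk N \<beta> h / real N) \<longlonglongrightarrow> F_SK M g \<beta> h"
  using sk_convergent[of \<beta> h]
  unfolding F_SK_def sk_eq_gaussian(1)[OF assms] by (simp add: convergent_LIMSEQ_iff)

text \<open>The sum of 2^N exponentials lies between its largest term and 2^N times it. The same
  sandwich at inverse temperature 1 shows that the maximum is integrable.\<close>

lemma max_energy_bounds:
  fixes M :: "'a measure"
  assumes g: "iid_std_gaussian M g" and \<beta>: "0 \<le> \<beta>"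
  defines "E \<equiv> \<lambda>N. LINT \<omega>|M. Max ((\<lambda>\<sigma>. 1 / sqrt (real N) * pair_sum g N \<sigma> \<omega>) ` spins N)"
  shows "\<beta> * E N \<le> sk N \<beta> 0" "sk N \<beta> 0 \<le> real N * ln 2 + \<beta> * E N"
proof -
  interpret prob_space M using g by (simp add: iid_std_gaussian_def)
  let ?X = "\<lambda>\<sigma> \<omega>. 1 / sqrt (real N) * pair_sum g N \<sigma> \<omega>"
  let ?m = "\<lambda>\<omega>. Max ((\<lambda>\<sigma>. ?X \<sigma> \<omega>) ` spins N)"
  let ?f = "\<lambda>\<beta> \<omega>. ln (\<Sum>\<sigma>\<in>spins N. exp (\<beta> * ?X \<sigma> \<omega>))"
  have fH: "?f \<beta> \<omega> = ln (\<Sum>\<sigma>\<in>spins N. exp (H_SK g N \<beta> \<sigma> \<omega> + 0 * real N * magnetization N \<sigma>))" for \<beta> \<omega>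
    by (simp add: H_SK_def)
  have f: "integrable M (?f \<beta>)" "integral\<^sup>L M (?f \<beta>) = sk N \<beta> 0" for \<beta>
    unfolding fH by (rule sk_eq_gaussian[OF g])+
  have Max_mem: "?m \<omega> \<in> (\<lambda>\<sigma>. ?X \<sigma> \<omega>) ` spins N" for \<omega> by (intro Max_in) auto
  have lower: "\<beta> * ?m \<omega> \<le> ?f \<beta> \<omega>" for \<beta> \<omega>
  proof -
    obtain \<sigma> where \<sigma>: "\<sigma> \<in> spins N" "?m \<omega> = ?X \<sigma> \<omega>" using Max_mem[of \<omega>] by blast
    have "exp (\<beta> * ?X \<sigma> \<omega>) \<le> (\<Sum>\<sigma>\<in>spins N. exp (\<beta> * ?X \<sigma> \<omega>))"
      using \<sigma>(1) by (intro member_le_sum) auto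
    then have "ln (exp (\<beta> * ?X \<sigma> \<omega>)) \<le> ?f \<beta> \<omega>" by (intro ln_mono) auto
    then show ?thesis unfolding \<sigma>(2) by simp
  qed
  have upper: "?f \<beta> \<omega> \<le> real N * ln 2 + \<beta> * ?m \<omega>" if "0 \<le> \<beta>" for \<beta> \<omega>
  proof -
    have "\<beta> * ?X \<sigma> \<omega> \<le> \<beta> * ?m \<omega>" if "\<sigma> \<in> spins N" for \<sigma>
      using that \<open>0 \<le> \<beta>\<close> by (intro mult_left_mono Max_ge) auto
    then have "(\<Sum>\<sigma>\<in>spins N. exp (\<beta> * ?X \<sigma> \<omega>)) \<le> real (card (spins N)) * exp (\<beta> * ?m \<omega>)"
      by (intro sum_bounded_above) simp
    moreover have "0 < (\<Sum>\<sigma>\<in>spins N. exp (\<beta> * ?X \<sigma> \<omega>))" by (intro sum_pos) auto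
    ultimately have "?f \<beta> \<omega> \<le> ln (2 ^ N * exp (\<beta> * ?m \<omega>))"
      by (intro ln_mono) (auto simp: card_spins)
    then show ?thesis by (simp add: ln_mult ln_realpow)
  qed
  have rv: "random_variable borel (?X \<sigma>)" for \<sigma>
  proof -
    have "random_variable borel (g i j)" if "1 \<le> i" "i < j" for i j
      using g that distributed_measurable[of M lborel "g i j"] by (auto simp: iid_std_gaussian_def)
    then show ?thesis unfolding pair_sum_def
      by (intro borel_measurable_times borel_measurable_const borel_measurable_sum)
         (auto intro!: borel_measurable_times)
  qed
  have "integrable M ?m"
  proof (rule Bochner_Integration.integrable_bound)
    show "integrable M (\<lambda>\<omega>. \<bar>?f 1 \<omega>\<bar> + real N * ln 2)"
      using f(1)[of 1] by (intro Bochner_Integration.integrable_add integrable_abs integrable_const)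
    show "?m \<in> borel_measurable M" using rv by (intro borel_measurable_Max) auto
    have "0 \<le> real N * ln 2" by simp
    then have "norm (?m \<omega>) \<le> norm (\<bar>?f 1 \<omega>\<bar> + real N * ln 2)" for \<omega>
      using lower[of 1 \<omega>] upper[of 1 \<omega>] by (simp only: real_norm_def mult_1) linarith
    then show "AE \<omega> in M. norm (?m \<omega>) \<le> norm (\<bar>?f 1 \<omega>\<bar> + real N * ln 2)" by simp
  qed
  note m = this
  have "\<beta> * E N = (LINT \<omega>|M. \<beta> * ?m \<omega>)" by (simp add: E_def)
  also have "\<dots> \<le> integral\<^sup>L M (?f \<beta>)" using m f(1) lower by (intro integral_mono) auto
  finally show "\<beta> * E N \<le> sk N \<beta> 0" by (simp only: f(2))
  have "integral\<^sup>L M (?f \<beta>) \<le> (LINT \<omega>|M. real N * ln 2 + \<beta> * ?m \<omega>)"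
    using m f(1) upper[OF \<beta>] by (intro integral_mono) auto
  also have "\<dots> = real N * ln 2 + \<beta> * E N"
    using m by (subst Bochner_Integration.integral_add) (auto simp: E_def prob_space)
  finally show "sk N \<beta> 0 \<le> real N * ln 2 + \<beta> * E N" by (simp only: f(2))
qed

text \<open>Dividing the sandwich by \<beta> N, the convergent sequence sk / (N \<beta>)
  approximates the ground state sequence within ln 2 / \<beta>, uniformly in N. Large \<beta> makes
  the latter Cauchy.\<close>

lemma ground_state_energy_limit:
  assumes g: "iid_std_gaussian M g"
  shows "(\<lambda>N. 1 / real N * (LINT \<omega>|M. Max ((\<lambda>\<sigma>. 1 / sqrt (real N) * pair_sum g N \<sigma> \<omega>) ` spins N)))
    \<longlonglongrightarrow> ground_state_energy M g"
proof -
  let ?E = "\<lambda>N. LINT \<omega>|M. Max ((\<lambda>\<sigma>. 1 / sqrt (real N) * pair_sum g N \<sigma> \<omega>) ` spins N)"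
  have approx: "\<bar>1 / real N * ?E N - sk N \<beta> 0 / real N / \<beta>\<bar> \<le> ln 2 / \<beta>" if "0 < \<beta>" "0 < N" for N \<beta>
  proof -
    have "1 / real N * ?E N - sk N \<beta> 0 / real N / \<beta> = (\<beta> * ?E N - sk N \<beta> 0) / (real N * \<beta>)"
      using that by (simp add: diff_divide_distrib)
    moreover have "\<bar>\<beta> * ?E N - sk N \<beta> 0\<bar> \<le> real N * ln 2"
      using max_energy_bounds[OF g, of \<beta> N] that(1) by (simp only: abs_le_iff) linarith
    then have "\<bar>\<beta> * ?E N - sk N \<beta> 0\<bar> / (real N * \<beta>) \<le> real N * ln 2 / (real N * \<beta>)"
      using that by (intro divide_right_mono) auto
    moreover have "real N * ln 2 / (real N * \<beta>) = ln 2 / \<beta>" "\<bar>real N * \<beta>\<bar> = real N * \<beta>"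
      using that by simp_all
    ultimately show ?thesis by (simp only: abs_divide)
  qed
  have "Cauchy (\<lambda>N. 1 / real N * ?E N)"
  proof (rule metric_CauchyI)
    fix e :: real assume e: "0 < e"
    \<comment> \<open>Error e/4 at each of the two indices, leaving e/2 for the convergent
      sequence.\<close>
    define \<beta> where "\<beta> = 4 * ln 2 / e"
    have \<beta>: "0 < \<beta>" "ln 2 / \<beta> = e / 4" using e by (auto simp: \<beta>_def)
    have "convergent (\<lambda>N. sk N \<beta> 0 / real N / \<beta>)"
    proof -
      obtain L where "(\<lambda>N. sk N \<beta> 0 / real N) \<longlonglongrightarrow> L"
        using sk_convergent[of \<beta> 0] unfolding convergent_def by blast
      then have "(\<lambda>N. sk N \<beta> 0 / real N / \<beta>) \<longlonglongrightarrow> L / \<beta>"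
        using \<beta>(1) by (intro tendsto_divide tendsto_const) auto
      then show ?thesis by (rule convergentI)
    qed
    then have "Cauchy (\<lambda>N. sk N \<beta> 0 / real N / \<beta>)" by (rule convergent_Cauchy)
    from metric_CauchyD[OF this, of "e / 2"] e
    obtain n0 where n0: "\<forall>m\<ge>n0. \<forall>n\<ge>n0.
        dist (sk m \<beta> 0 / real m / \<beta>) (sk n \<beta> 0 / real n / \<beta>) < e / 2"
      by auto
    show "\<exists>n0. \<forall>m\<ge>n0. \<forall>n\<ge>n0. dist (1 / real m * ?E m) (1 / real n * ?E n) < e"
    proof (intro exI allI impI)
      \<comment> \<open>\<open>Suc n0\<close> makes both sizes positive, as \<open>approx\<close>
        requires.\<close>
      fix m n assume "m \<ge> Suc n0" "n \<ge> Suc n0"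
      then have mn: "dist (sk m \<beta> 0 / real m / \<beta>) (sk n \<beta> 0 / real n / \<beta>) < e / 2" "0 < m" "0 < n"
        using n0 by auto
      have tri: "\<bar>a - b\<bar> < e" if "\<bar>s - t\<bar> < e / 2" "\<bar>a - s\<bar> \<le> e / 4" "\<bar>b - t\<bar> \<le> e / 4" for a b s t :: real
        using that by linarith
      show "dist (1 / real m * ?E m) (1 / real n * ?E n) < e"
        using mn(1) approx[OF \<beta>(1) mn(2)] approx[OF \<beta>(1) mn(3)]
        unfolding \<beta>(2) dist_real_def by (rule tri)
    qed
  qed
  then show ?thesis
    unfolding ground_state_energy_def by (simp add: Cauchy_convergent_iff convergent_LIMSEQ_iff)
qed

section \<open>The planted model\<close>

lemma free_energy_cong:
  assumes "\<And>\<sigma>. \<sigma> \<in> S \<Longrightarrow> d \<sigma> = d' \<sigma>"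
  shows "free_energy K S A d = free_energy K S A d'"
  unfolding free_energy_def partition_sum_def energy_def using assms by simp

text \<open>Subtracting \<open>real N\<close> removes the diagonal, leaving the energy \<gamma>/N
  over pairs i < j. For \<gamma> = \<beta>^2 this is exactly the covariance of the coupling energies
  of \<sigma> and of the all-plus configuration.\<close>

definition curie_weiss :: "nat \<Rightarrow> real \<Rightarrow> (nat \<Rightarrow> real) \<Rightarrow> real" where
  "curie_weiss N \<gamma> \<sigma> = \<gamma> / real N * (((\<Sum>i = 1..N. \<sigma> i)\<^sup>2 - real N) / 2)"

text \<open>A translation of the disorder is an added deterministic energy: the link between a
  planted configuration and the Cameron-Martin weight.\<close>

lemma energy_shift:
  "energy K A d (\<lambda>k\<in>K. x k + v k) \<sigma> = energy K A (\<lambda>\<sigma>. d \<sigma> + (\<Sum>k\<in>K. A \<sigma> k * v k)) x \<sigma>"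
  by (simp add: energy_def distrib_left sum.distrib cong: sum.cong)

text \<open>With the ferromagnetic coupling \<open>\<beta>\<^sup>2\<close> (the Nishimori line) the disorder is that of the
  model with a planted configuration \<open>\<tau>\<close>. By the Cameron--Martin formula, averaging over \<open>\<tau>\<close>
  gives a density proportional to the partition function \<open>Z\<close> of the model without the planted
  configuration, and \<open>Z ln Z\<close> is convex.\<close>

lemma planted_free_energy_ge:
  assumes N: "0 < N"
  shows "real N * ln 2 + \<beta>\<^sup>2 * (real N - 1) / 4
    \<le> free_energy (pairs N) (spins N) (coupling N \<beta>) (curie_weiss N (\<beta>\<^sup>2))"
proof -
  let ?S = "spins N" and ?K = "pairs N" and ?v = "coupling N \<beta>"
  let ?W = "free_energy ?K ?S ?v (curie_weiss N (\<beta>\<^sup>2))"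
  \<comment> \<open>The energy that \<sigma> gains when the disorder is shifted by the coefficients
    of the planted \<tau>.\<close>
  let ?d = "\<lambda>\<tau> \<sigma>. (\<Sum>k\<in>?K. ?v \<sigma> k * ?v \<tau> k)"
  define V where "V = \<beta>\<^sup>2 / 2 * (real N - 1)"
  define w where "w \<tau> x = exp ((\<Sum>k\<in>?K. ?v \<tau> k * x k) - (\<Sum>k\<in>?K. (?v \<tau> k)\<^sup>2) / 2)" for \<tau> x
  let ?Z = "partition_sum ?K ?S ?v (\<lambda>_. 0)"
  have Z: "0 < ?Z x" for x by (rule partition_pos) auto
  have lnZ: "(\<lambda>x. ln (?Z x)) \<in> borel_measurable (gauss ?K)" by measurable
  have self: "(\<Sum>k\<in>?K. (?v \<tau> k)\<^sup>2) = V" if "\<tau> \<in> ?S" for \<tau>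
    using coupling_inner_self[OF that N] by (simp add: V_def power2_eq_square)
  have planted: "free_energy ?K ?S ?v (?d \<tau>) = ?W" if \<tau>: "\<tau> \<in> ?S" for \<tau>
  proof -
    have "?d \<tau> \<sigma> = curie_weiss N (\<beta>\<^sup>2) (flip_spins N \<tau> \<sigma>)" if "\<sigma> \<in> ?S" for \<sigma>
      using coupling_inner[OF that \<tau>, of \<beta>] by (simp add: curie_weiss_def flip_spins_def overlap_sum_def)
    then have "free_energy ?K ?S ?v (?d \<tau>) = free_energy ?K ?S ?v (\<lambda>\<sigma>. curie_weiss N (\<beta>\<^sup>2) (flip_spins N \<tau> \<sigma>))"
      by (intro free_energy_cong)
    then show ?thesis using free_energy_gauge[OF N \<tau>] by simp
  qed
  have shifted: "ln (partition_sum ?K ?S ?v (?d \<tau>) x) = ln (?Z (\<lambda>k\<in>?K. x k + ?v \<tau> k))" for \<tau> x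
    by (simp add: partition_sum_def energy_shift)
  have W: "?W = (LINT x|gauss ?K. w \<tau> x * ln (?Z x))" and Wint: "integrable (gauss ?K) (\<lambda>x. w \<tau> x * ln (?Z x))"
    if \<tau>: "\<tau> \<in> ?S" for \<tau>
  proof -
    show "?W = (LINT x|gauss ?K. w \<tau> x * ln (?Z x))"
      unfolding planted[OF \<tau>, symmetric] w_def
      unfolding free_energy_def shifted
      by (rule gauss_integral_shift(1)[OF finite_pairs lnZ])
    have "integrable (gauss ?K) (\<lambda>x. ln (?Z (\<lambda>k\<in>?K. x k + ?v \<tau> k)))"
      unfolding shifted[symmetric] by (rule integrable_ln_partition) auto
    then show "integrable (gauss ?K) (\<lambda>x. w \<tau> x * ln (?Z x))"
      unfolding w_def using gauss_integral_shift(2)[OF finite_pairs lnZ] by simp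
  qed
  have one: "(LINT x|gauss ?K. w \<tau> x) = 1" "integrable (gauss ?K) (w \<tau>)" for \<tau>
  proof -
    have "prob_space (gauss ?K)" by (rule prob_space_gauss)
    then interpret prob_space "gauss ?K" .
    show "(LINT x|gauss ?K. w \<tau> x) = 1" "integrable (gauss ?K) (w \<tau>)"
      using gauss_integral_shift[where f = "\<lambda>_. 1" and v = "?v \<tau>", OF finite_pairs[of N] borel_measurable_const]
        integrable_const[of "1 :: real"] prob_space
      unfolding w_def by (simp_all del: integrable_const)
  qed
  \<comment> \<open>All self-covariances equal V, so the weights of the planted configurations add
    up to a constant multiple of Z.\<close>
  have sum_w: "(\<Sum>\<tau>\<in>?S. w \<tau> x) = exp (- V / 2) * ?Z x" for x
    by (simp add: partition_sum_def energy_def w_def self sum_distrib_left flip: exp_add)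
  \<comment> \<open>The annealed mean of Z, where the tangent to t ln t is taken.\<close>
  define c where "c = 2 ^ N * exp (V / 2)"
  have c: "0 < c" "ln c = real N * ln 2 + V / 2"
    by (simp_all add: c_def ln_mult ln_realpow)
  \<comment> \<open>Tangent at c to the convex function t ln t, at t = \<open>?Z x\<close> and
    scaled by exp(-V/2).\<close>
  have pointwise: "(\<Sum>\<tau>\<in>?S. w \<tau> x) * (1 + ln c) - 2 ^ N \<le> (\<Sum>\<tau>\<in>?S. w \<tau> x * ln (?Z x))" for x
  proof -
    have "?Z x * ln c \<le> ?Z x * (ln (?Z x) + (c / ?Z x - 1))"
      using Z[of x] c(1) by (intro mult_left_mono ln_le_tangent) auto
    also have "\<dots> = ?Z x * ln (?Z x) + c - ?Z x"
      using Z[of x] by (simp add: distrib_left right_diff_distrib less_imp_neq[THEN not_sym])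
    finally have "exp (- V / 2) * (?Z x * (1 + ln c) - c) \<le> exp (- V / 2) * (?Z x * ln (?Z x))"
      by (intro mult_left_mono) (auto simp: algebra_simps)
    moreover have "exp (- V / 2) * c = 2 ^ N"
      by (simp add: c_def mult.left_commute flip: exp_add)
    ultimately show ?thesis
      unfolding sum_distrib_right[symmetric] sum_w by (simp add: right_diff_distrib mult.assoc)
  qed
  have "prob_space (gauss ?K)" by (rule prob_space_gauss)
  then interpret prob_space "gauss ?K" .
  have "2 ^ N * ln c = (\<Sum>\<tau>\<in>?S. (LINT x|gauss ?K. w \<tau> x)) * (1 + ln c) - 2 ^ N"
    by (simp add: one card_spins algebra_simps)
  also have "\<dots> = (LINT x|gauss ?K. (\<Sum>\<tau>\<in>?S. w \<tau> x) * (1 + ln c) - 2 ^ N)"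
    using one(2) prob_space by (simp add: Bochner_Integration.integral_sum)
  also have "\<dots> \<le> (LINT x|gauss ?K. (\<Sum>\<tau>\<in>?S. w \<tau> x * ln (?Z x)))"
    using pointwise one(2) Wint
    by (intro integral_mono Bochner_Integration.integrable_diff integrable_mult_left
        Bochner_Integration.integrable_sum integrable_const) auto
  also have "\<dots> = (\<Sum>\<tau>\<in>?S. (LINT x|gauss ?K. w \<tau> x * ln (?Z x)))"
    by (rule Bochner_Integration.integral_sum) (rule Wint)
  also have "\<dots> = 2 ^ N * ?W" by (simp add: W[symmetric] card_spins)
  finally have "ln c \<le> ?W" by simp
  then show ?thesis unfolding c(2) by (simp add: V_def)
qed

text \<open>The identity m^2 = 2 \<mu> m - \<mu>^2 + (m - \<mu>)^2 replaces the quadratic energy by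
  a field for some grid point \<mu> within \<delta> of m. Summing over the grid costs ln (card G),
  and each random ln Z is replaced by its mean at the price of the total deviation
  \<open>?T\<close>, of expectation O(sqrt N).\<close>

lemma curie_weiss_free_energy_le:
  assumes N: "0 < N" and \<gamma>: "0 \<le> \<gamma>" and G: "finite G" "G \<noteq> {}"
    and grid: "\<And>m. \<bar>m\<bar> \<le> 1 \<Longrightarrow> \<exists>\<mu>\<in>G. \<bar>m - \<mu>\<bar> \<le> \<delta>"
    and U: "\<And>\<mu>. \<mu> \<in> G \<Longrightarrow> sk N \<beta> (\<gamma> * \<mu>) - real N * (\<gamma> * \<mu>\<^sup>2 / 2) \<le> U"
  shows "free_energy (pairs N) (spins N) (coupling N \<beta>) (curie_weiss N \<gamma>)
    \<le> ln (real (card G)) + U + real N * (\<gamma> * \<delta>\<^sup>2 / 2) + real (card G) * (\<bar>\<beta>\<bar> * sqrt (real N))"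
proof -
  let ?S = "spins N" and ?K = "pairs N" and ?v = "coupling N \<beta>"
  let ?Z = "\<lambda>\<mu>. partition_sum ?K ?S ?v (field_energy N (\<gamma> * \<mu>))"
  let ?T = "\<lambda>x. \<Sum>\<mu>\<in>G. \<bar>ln (?Z \<mu> x) - sk N \<beta> (\<gamma> * \<mu>)\<bar>"
  let ?e = "real N * (\<gamma> * \<delta>\<^sup>2 / 2)"
  have Z: "0 < ?Z \<mu> x" for \<mu> x by (rule partition_pos) auto
  have conc: "(LINT x|gauss ?K. \<bar>ln (?Z \<mu> x) - sk N \<beta> (\<gamma> * \<mu>)\<bar>) \<le> \<bar>\<beta>\<bar> * sqrt (real N)" for \<mu>
  proof -
    \<comment> \<open>The modulus of a coefficient is the same for all configurations, so any \<tau>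
      provides the Lipschitz constants.\<close>
    obtain \<tau> where \<tau>: "\<tau> \<in> ?S" using spins_nonempty by blast
    have "\<bar>?v \<sigma> k\<bar> \<le> \<bar>?v \<tau> k\<bar>" if "\<sigma> \<in> ?S" "k \<in> ?K" for \<sigma> k
      using that \<tau> by (auto simp: pairs_def coupling_def abs_mult spin_abs)
    then have "(LINT x|gauss ?K. \<bar>ln (?Z \<mu> x) - sk N \<beta> (\<gamma> * \<mu>)\<bar>) \<le> sqrt (\<Sum>k\<in>?K. \<bar>?v \<tau> k\<bar>\<^sup>2)"
      unfolding sk_def by (intro ln_partition_concentration) auto
    also have "(\<Sum>k\<in>?K. \<bar>?v \<tau> k\<bar>\<^sup>2) = \<beta>\<^sup>2 / 2 * (real N - 1)"
      using coupling_inner_self[OF \<tau> N] by (simp add: power2_eq_square)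
    also have "\<dots> \<le> \<beta>\<^sup>2 * real N"
    proof -
      have "\<beta>\<^sup>2 / 2 * (real N - 1) \<le> \<beta>\<^sup>2 * real N"
        using N by (intro mult_mono) auto
      then show ?thesis .
    qed
    also have "sqrt (\<beta>\<^sup>2 * real N) = \<bar>\<beta>\<bar> * sqrt (real N)" by (simp add: real_sqrt_mult)
    finally show ?thesis by simp
  qed
  have pointwise: "ln (partition_sum ?K ?S ?v (curie_weiss N \<gamma>) x) \<le> ln (real (card G)) + (U + ?e) + ?T x" for x
  proof -
    have en: "exp (energy ?K ?v (curie_weiss N \<gamma>) x \<sigma>)
        \<le> (\<Sum>\<mu>\<in>G. exp (?e - real N * (\<gamma> * \<mu>\<^sup>2 / 2)) * exp (energy ?K ?v (field_energy N (\<gamma> * \<mu>)) x \<sigma>))"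
      if \<sigma>: "\<sigma> \<in> ?S" for \<sigma>
    proof -
      define m where "m = (\<Sum>i = 1..N. \<sigma> i) / real N"
      have Nm: "(\<Sum>i = 1..N. \<sigma> i) = real N * m" using N by (simp add: m_def)
      have "\<bar>\<Sum>i = 1..N. \<sigma> i\<bar> \<le> (\<Sum>i = 1..N. \<bar>\<sigma> i\<bar>)" by (rule sum_abs)
      also have "\<dots> = (\<Sum>i = 1..N. 1)" using spin_abs[OF \<sigma>] by (intro sum.cong) auto
      finally have "\<bar>m\<bar> \<le> 1" using N by (simp add: m_def)
      then obtain \<mu> where \<mu>: "\<mu> \<in> G" "\<bar>m - \<mu>\<bar> \<le> \<delta>" using grid by blast
      have sq: "(m - \<mu>)\<^sup>2 \<le> \<delta>\<^sup>2" using power_mono[OF \<mu>(2), of 2] by simp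
      have "curie_weiss N \<gamma> \<sigma> = real N * (\<gamma> * m\<^sup>2 / 2) - \<gamma> / 2"
        unfolding curie_weiss_def Nm using N by (simp add: power_mult_distrib field_simps power2_eq_square)
      also have "\<dots> \<le> real N * (\<gamma> * m\<^sup>2 / 2)" using \<gamma> by simp
      also have "\<dots> = real N * \<gamma> / 2 * (m - \<mu>)\<^sup>2 + (\<gamma> * \<mu>) * (real N * m) - real N * (\<gamma> * \<mu>\<^sup>2 / 2)"
        by (simp add: power2_eq_square field_simps)
      also have "\<dots> \<le> real N * \<gamma> / 2 * \<delta>\<^sup>2 + (\<gamma> * \<mu>) * (real N * m) - real N * (\<gamma> * \<mu>\<^sup>2 / 2)"
        using sq \<gamma> by (intro diff_right_mono add_right_mono mult_left_mono) auto
      finally have "curie_weiss N \<gamma> \<sigma> \<le> ?e - real N * (\<gamma> * \<mu>\<^sup>2 / 2) + field_energy N (\<gamma> * \<mu>) \<sigma>"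
        unfolding field_energy_def Nm by simp
      then have "exp (energy ?K ?v (curie_weiss N \<gamma>) x \<sigma>)
          \<le> exp (?e - real N * (\<gamma> * \<mu>\<^sup>2 / 2)) * exp (energy ?K ?v (field_energy N (\<gamma> * \<mu>)) x \<sigma>)"
        unfolding exp_add[symmetric] energy_def by simp
      also have "\<dots> \<le> (\<Sum>\<mu>\<in>G. exp (?e - real N * (\<gamma> * \<mu>\<^sup>2 / 2)) * exp (energy ?K ?v (field_energy N (\<gamma> * \<mu>)) x \<sigma>))"
        using \<mu>(1) G(1) by (intro member_le_sum) auto
      finally show ?thesis .
    qed
    have term_le: "exp (?e - real N * (\<gamma> * \<mu>\<^sup>2 / 2)) * ?Z \<mu> x \<le> exp (U + ?e + ?T x)" if \<mu>: "\<mu> \<in> G" for \<mu>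
    proof -
      have "ln (?Z \<mu> x) - sk N \<beta> (\<gamma> * \<mu>) \<le> \<bar>ln (?Z \<mu> x) - sk N \<beta> (\<gamma> * \<mu>)\<bar>" by simp
      also have "\<dots> \<le> ?T x" using \<mu> G(1) by (intro member_le_sum) auto
      finally have "?e - real N * (\<gamma> * \<mu>\<^sup>2 / 2) + ln (?Z \<mu> x) \<le> U + ?e + ?T x"
        using U[OF \<mu>] by linarith
      then have "exp (?e - real N * (\<gamma> * \<mu>\<^sup>2 / 2) + ln (?Z \<mu> x)) \<le> exp (U + ?e + ?T x)" by simp
      then show ?thesis using Z[of \<mu> x] by (simp add: exp_add)
    qed
    have "partition_sum ?K ?S ?v (curie_weiss N \<gamma>) x
        \<le> (\<Sum>\<sigma>\<in>?S. \<Sum>\<mu>\<in>G. exp (?e - real N * (\<gamma> * \<mu>\<^sup>2 / 2)) * exp (energy ?K ?v (field_energy N (\<gamma> * \<mu>)) x \<sigma>))"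
      unfolding partition_sum_def by (intro sum_mono en)
    also have "\<dots> = (\<Sum>\<mu>\<in>G. exp (?e - real N * (\<gamma> * \<mu>\<^sup>2 / 2)) * ?Z \<mu> x)"
      unfolding partition_sum_def by (subst sum.swap) (simp add: sum_distrib_left)
    also have "\<dots> \<le> real (card G) * exp (U + ?e + ?T x)"
      by (intro sum_bounded_above term_le)
    finally have "ln (partition_sum ?K ?S ?v (curie_weiss N \<gamma>) x) \<le> ln (real (card G) * exp (U + ?e + ?T x))"
      using partition_pos[of ?S ?K ?v "curie_weiss N \<gamma>" x] by (intro ln_mono) auto
    then show ?thesis using G by (subst (asm) ln_mult) (auto simp: card_gt_0_iff)
  qed
  have "prob_space (gauss ?K)" by (rule prob_space_gauss)
  then interpret prob_space "gauss ?K" .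
  have int: "integrable (gauss ?K) (\<lambda>x. \<bar>ln (?Z \<mu> x) - sk N \<beta> (\<gamma> * \<mu>)\<bar>)" for \<mu>
    by (intro integrable_abs Bochner_Integration.integrable_diff integrable_const
        integrable_ln_partition finite_pairs finite_spins spins_nonempty)
  then have intT: "integrable (gauss ?K) ?T" by (intro Bochner_Integration.integrable_sum)
  have "free_energy ?K ?S ?v (curie_weiss N \<gamma>) \<le> (LINT x|gauss ?K. (ln (real (card G)) + (U + ?e)) + ?T x)"
    unfolding free_energy_def using pointwise intT
    by (intro integral_mono Bochner_Integration.integrable_add integrable_const
        integrable_ln_partition finite_pairs finite_spins spins_nonempty)
  also have "\<dots> = ln (real (card G)) + (U + ?e) + (LINT x|gauss ?K. ?T x)"
    using intT prob_space by simp
  also have "(LINT x|gauss ?K. ?T x) = (\<Sum>\<mu>\<in>G. (LINT x|gauss ?K. \<bar>ln (?Z \<mu> x) - sk N \<beta> (\<gamma> * \<mu>)\<bar>))"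
    by (rule Bochner_Integration.integral_sum) (rule int)
  also have "\<dots> \<le> real (card G) * (\<bar>\<beta>\<bar> * sqrt (real N))"
    by (intro sum_bounded_above conc)
  finally show ?thesis by simp
qed

lemma unit_interval_grid:
  assumes "0 < \<delta>"
  obtains G :: "real set" where "finite G" "G \<noteq> {}" "G \<subseteq> {-1..1}"
    "\<And>m. \<bar>m\<bar> \<le> 1 \<Longrightarrow> \<exists>\<mu>\<in>G. \<bar>m - \<mu>\<bar> \<le> \<delta>"
proof -
  have "seq_compact {-1..1 :: real}" by (simp add: compact_imp_seq_compact)
  from seq_compact_imp_totally_bounded[OF this, rule_format, OF assms]
  obtain G where G: "finite G" "G \<subseteq> {-1..1 :: real}" "{-1..1} \<subseteq> (\<Union>\<mu>\<in>G. ball \<mu> \<delta>)"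
    by (elim exE conjE)
  show thesis
  proof (rule that[OF G(1) _ G(2)])
    show grid: "\<exists>\<mu>\<in>G. \<bar>m - \<mu>\<bar> \<le> \<delta>" if "\<bar>m\<bar> \<le> 1" for m
    proof -
      have "m \<in> {-1..1}" using that by auto
      then obtain \<mu> where "\<mu> \<in> G" "m \<in> ball \<mu> \<delta>" using G(3) by blast
      then show ?thesis by (auto simp: dist_real_def abs_minus_commute intro!: bexI[of _ \<mu>])
    qed
    from grid[of 0] show "G \<noteq> {}" by auto
  qed
qed

text \<open>If every \<mu> failed by e, the grid bound would fall below the planted lower bound by
  at least N e/2, up to an error of order sqrt N.\<close>

lemma exists_planted_field:
  assumes g: "iid_std_gaussian M g" and e: "0 < e"
  shows "\<exists>\<mu>. \<bar>\<mu>\<bar> \<le> 1 \<and> ln 2 + \<beta>\<^sup>2 / 4 - e \<le> F_SK M g \<beta> (\<beta>\<^sup>2 * \<mu>) - \<beta>\<^sup>2 * \<mu>\<^sup>2 / 2"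
proof (rule ccontr)
  assume "\<not> ?thesis"
  then have less: "F_SK M g \<beta> (\<beta>\<^sup>2 * \<mu>) - \<beta>\<^sup>2 * \<mu>\<^sup>2 / 2 < ln 2 + \<beta>\<^sup>2 / 4 - e" if "\<bar>\<mu>\<bar> \<le> 1" for \<mu>
    using that by force
  \<comment> \<open>Chosen so that the grid error \<beta>^2 \<delta>^2/2 uses at most half of e;
    adding 1 to the denominator covers \<beta> = 0.\<close>
  define \<delta> where "\<delta> = sqrt (e / (1 + \<beta>\<^sup>2))"
  have \<delta>: "0 < \<delta>" "\<beta>\<^sup>2 * \<delta>\<^sup>2 / 2 \<le> e / 2"
    using e by (auto simp: \<delta>_def add_pos_nonneg field_simps)
  obtain G where G: "finite G" "G \<noteq> {}" "G \<subseteq> {-1..1 :: real}"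
    and grid: "\<And>m. \<bar>m\<bar> \<le> 1 \<Longrightarrow> \<exists>\<mu>\<in>G. \<bar>m - \<mu>\<bar> \<le> \<delta>"
    using unit_interval_grid[OF \<delta>(1)] by blast
  let ?c = "ln 2 + \<beta>\<^sup>2 / 4"
  have "\<forall>\<^sub>F N in sequentially. sk N \<beta> (\<beta>\<^sup>2 * \<mu>) / real N - \<beta>\<^sup>2 * \<mu>\<^sup>2 / 2 < ?c - e" if "\<mu> \<in> G" for \<mu>
  proof (rule order_tendstoD(2))
    show "(\<lambda>N. sk N \<beta> (\<beta>\<^sup>2 * \<mu>) / real N - \<beta>\<^sup>2 * \<mu>\<^sup>2 / 2) \<longlonglongrightarrow> F_SK M g \<beta> (\<beta>\<^sup>2 * \<mu>) - \<beta>\<^sup>2 * \<mu>\<^sup>2 / 2"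
      by (intro tendsto_diff F_SK_limit[OF g] tendsto_const)
    show "F_SK M g \<beta> (\<beta>\<^sup>2 * \<mu>) - \<beta>\<^sup>2 * \<mu>\<^sup>2 / 2 < ?c - e"
      using subsetD[OF G(3) that] by (intro less) (simp add: abs_le_iff)
  qed
  then have ev: "\<forall>\<^sub>F N in sequentially. \<forall>\<mu>\<in>G. sk N \<beta> (\<beta>\<^sup>2 * \<mu>) / real N - \<beta>\<^sup>2 * \<mu>\<^sup>2 / 2 < ?c - e"
    using G(1) by (intro eventually_ball_finite) auto
  let ?err = "\<lambda>N. ((ln (real (card G)) + \<beta>\<^sup>2 / 4) / real N + real (card G) * \<bar>\<beta>\<bar> / sqrt (real N))"
  have "\<forall>\<^sub>F N in sequentially. e / 2 \<le> ?err N"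
    using ev eventually_gt_at_top[of 0]
  proof eventually_elim
    case (elim N)
    have N: "0 < N" "0 < real N" using elim by auto
    have "sk N \<beta> (\<beta>\<^sup>2 * \<mu>) - real N * (\<beta>\<^sup>2 * \<mu>\<^sup>2 / 2) \<le> real N * (?c - e)" if "\<mu> \<in> G" for \<mu>
    proof -
      have "real N * (sk N \<beta> (\<beta>\<^sup>2 * \<mu>) / real N - \<beta>\<^sup>2 * \<mu>\<^sup>2 / 2) \<le> real N * (?c - e)"
        using elim that by (intro mult_left_mono) auto
      then show ?thesis using N by (simp add: right_diff_distrib)
    qed
    from curie_weiss_free_energy_le[OF N(1) zero_le_power2 G(1,2) grid this]
      planted_free_energy_ge[OF N(1), of \<beta>]
    have "real N * ln 2 + \<beta>\<^sup>2 * (real N - 1) / 4 \<le> ln (real (card G)) + real N * (?c - e)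
        + real N * (\<beta>\<^sup>2 * \<delta>\<^sup>2 / 2) + real (card G) * (\<bar>\<beta>\<bar> * sqrt (real N))"
      by linarith
    moreover have "real N * (\<beta>\<^sup>2 * \<delta>\<^sup>2 / 2) \<le> real N * (e / 2)" using \<delta>(2) by (intro mult_left_mono) auto
    moreover have "\<beta>\<^sup>2 * (real N - 1) / 4 = real N * (\<beta>\<^sup>2 / 4) - \<beta>\<^sup>2 / 4"
      "real N * (?c - e) = real N * ln 2 + real N * (\<beta>\<^sup>2 / 4) - 2 * (real N * (e / 2))"
      by (simp_all add: field_simps)
    ultimately have "real N * (e / 2) \<le> ln (real (card G)) + \<beta>\<^sup>2 / 4 + real (card G) * \<bar>\<beta>\<bar> * sqrt (real N)"
      unfolding mult.assoc[of "real (card G)"] by linarith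
    then have "e / 2 \<le> (ln (real (card G)) + \<beta>\<^sup>2 / 4 + real (card G) * \<bar>\<beta>\<bar> * sqrt (real N)) / real N"
      using N by (simp add: field_simps)
    also have "\<dots> = ?err N"
      using N by (simp add: add_divide_distrib) (simp add: real_div_sqrt field_simps)
    finally show ?case .
  qed
  moreover have "?err \<longlonglongrightarrow> 0 + 0"
    by (intro tendsto_add tendsto_divide_0[OF tendsto_const] filterlim_at_top_imp_at_infinity
        filterlim_real_sequentially filterlim_compose[OF sqrt_at_top])
  ultimately have "e / 2 \<le> 0 + 0"
    by (intro tendsto_lowerbound[where F = sequentially]) auto
  then show False using e by simp
qed

section \<open>Hyperbolic tangent and the overlap equation\<close>

lemma DERIV_tanh_real: "(tanh has_real_derivative 1 - (tanh y)\<^sup>2) (at (y :: real))"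
  by (rule derivative_eq_intros refl | simp)+

lemma nonneg_by_derivative:
  fixes f :: "real \<Rightarrow> real"
  assumes "0 \<le> y" "f 0 = 0" "\<And>x. 0 \<le> x \<Longrightarrow> (f has_real_derivative f' x) (at x)" "\<And>x. 0 \<le> x \<Longrightarrow> 0 \<le> f' x"
  shows "0 \<le> f y"
  using DERIV_nonneg_imp_nondecreasing[of 0 y f] assms by auto

lemma pos_by_derivative:
  fixes f :: "real \<Rightarrow> real"
  assumes "0 < y" "f 0 = 0" "\<And>x. 0 \<le> x \<Longrightarrow> (f has_real_derivative f' x) (at x)" "\<And>x. 0 < x \<Longrightarrow> 0 < f' x"
  shows "0 < f y"
proof -
  have "f 0 < f y"
  proof (rule DERIV_pos_imp_increasing_open[OF assms(1)])
    show "\<exists>d. (f has_real_derivative d) (at x) \<and> 0 < d" if "0 < x" "x < y" for x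
      using assms(3,4) that by (intro exI[of _ "f' x"]) auto
    show "continuous_on {0..y} f"
      using assms(3) by (intro continuous_at_imp_continuous_on ballI) (auto intro: DERIV_isCont)
  qed
  then show ?thesis using assms(2) by simp
qed

lemma tanh_square_less_1: "(tanh (y :: real))\<^sup>2 < 1"
  using tanh_real_bounds[of y] unfolding abs_square_less_1 by (auto simp: abs_less_iff)

lemma tanh_less_self:
  fixes y :: real
  assumes "0 < y" shows "tanh y < y"
proof -
  have "0 < (\<lambda>y. y - tanh y) y"
  proof (rule pos_by_derivative[OF assms])
    show "((\<lambda>y. y - tanh y) has_real_derivative (tanh x)\<^sup>2) (at x)" for x :: real
      using DERIV_diff[OF DERIV_ident DERIV_tanh_real[of x]] by simp
  qed auto
  then show ?thesis by simp
qed

lemma tanh_le_self: "0 \<le> y \<Longrightarrow> tanh y \<le> (y :: real)"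
  using tanh_less_self[of y] by (cases "y = 0") auto

text \<open>The difference has derivative x^2 - tanh^2 x, nonnegative since tanh x is at most
  x.\<close>

lemma tanh_ge_cubic:
  fixes y :: real
  assumes "0 \<le> y" shows "y - y ^ 3 / 3 \<le> tanh y"
proof -
  have "0 \<le> (\<lambda>y. tanh y - (y - y ^ 3 / 3)) y"
  proof (rule nonneg_by_derivative[OF assms])
    show "((\<lambda>y. tanh y - (y - y ^ 3 / 3)) has_real_derivative x\<^sup>2 - (tanh x)\<^sup>2) (at x)" for x :: real
      by (rule DERIV_cong[OF DERIV_diff[OF DERIV_tanh_real DERIV_diff[OF DERIV_ident
            DERIV_cdivide[OF DERIV_pow]]]]) simp
    show "0 \<le> x\<^sup>2 - (tanh x)\<^sup>2" if "0 \<le> x" for x :: real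
      using power_mono[OF tanh_le_self[OF that], of 2] that by simp
  qed simp
  then show ?thesis by simp
qed

text \<open>The cubic lower bound, squared, controls the tanh^2 in the derivative of the
  difference.\<close>

lemma tanh_le_quintic:
  fixes y :: real
  assumes "0 \<le> y" shows "tanh y \<le> y - y ^ 3 / 3 + 2 * y ^ 5 / 15"
proof -
  have "0 \<le> (\<lambda>y. y - y ^ 3 / 3 + 2 * y ^ 5 / 15 - tanh y) y"
  proof (rule nonneg_by_derivative[OF assms])
    show "((\<lambda>y. y - y ^ 3 / 3 + 2 * y ^ 5 / 15 - tanh y) has_real_derivative
        (tanh x)\<^sup>2 - x\<^sup>2 + 2 / 3 * x ^ 4) (at x)" for x
      by (auto intro!: derivative_eq_intros DERIV_tanh_real simp: eval_nat_numeral)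
  next
    fix x :: real assume x: "0 \<le> x"
    show "0 \<le> (tanh x)\<^sup>2 - x\<^sup>2 + 2 / 3 * x ^ 4"
    \<comment> \<open>Squaring the cubic bound requires its left side to be nonnegative, that is x^2
      at most 3; beyond that the quartic term alone dominates x^2.\<close>
    proof (cases "x\<^sup>2 \<le> 3")
      case True
      have "x * x\<^sup>2 \<le> x * 3" using True x by (rule mult_left_mono)
      then have "0 \<le> x - x ^ 3 / 3" by (simp add: eval_nat_numeral)
      then have "(x - x ^ 3 / 3)\<^sup>2 \<le> (tanh x)\<^sup>2" using tanh_ge_cubic[OF x] by (intro power_mono)
      moreover have "(x - x ^ 3 / 3)\<^sup>2 = x\<^sup>2 - 2 / 3 * x ^ 4 + (x ^ 3)\<^sup>2 / 9"
        by (simp add: power2_eq_square eval_nat_numeral algebra_simps)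
      moreover have "0 \<le> (x ^ 3)\<^sup>2 / 9" by simp
      ultimately show ?thesis by linarith
    next
      case False
      then have "3 * x\<^sup>2 \<le> x\<^sup>2 * x\<^sup>2" by (intro mult_right_mono) auto
      moreover have "x\<^sup>2 * x\<^sup>2 = x ^ 4" by (simp add: eval_nat_numeral)
      moreover have "0 \<le> x\<^sup>2" "0 \<le> (tanh x)\<^sup>2" by simp_all
      ultimately show ?thesis by linarith
    qed
  qed simp
  then show ?thesis by simp
qed

text \<open>Termwise integral of the quintic bound. The exact quartic term -y^4/12 decides the sign
  in the low-temperature estimate.\<close>

lemma ln_cosh_le_sextic: "ln (cosh y) \<le> y\<^sup>2 / 2 - y ^ 4 / 12 + y ^ 6 / 45" for y :: real
proof -
  have "0 \<le> (\<lambda>y. y\<^sup>2 / 2 - y ^ 4 / 12 + y ^ 6 / 45 - ln (cosh y)) y" if "0 \<le> y" for y :: real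
  proof (rule nonneg_by_derivative[OF that])
    show "((\<lambda>y. y\<^sup>2 / 2 - y ^ 4 / 12 + y ^ 6 / 45 - ln (cosh y)) has_real_derivative
        x - x ^ 3 / 3 + 2 * x ^ 5 / 15 - tanh x) (at x)" for x
      by (auto intro!: derivative_eq_intros simp: tanh_def)
    show "0 \<le> x - x ^ 3 / 3 + 2 * x ^ 5 / 15 - tanh x" if "0 \<le> x" for x :: real
      using tanh_le_quintic[OF that] by simp
  qed simp
  from this[of "\<bar>y\<bar>"] show ?thesis by (simp add: power_even_abs)
qed

lemma ln_cosh_less: 
  fixes y :: real
  assumes "y \<noteq> 0" shows "ln (cosh y) < y\<^sup>2 / 2"
proof -
  have "0 < (\<lambda>y. y\<^sup>2 / 2 - ln (cosh y)) y" if "0 < y" for y :: real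
  proof (rule pos_by_derivative[OF that])
    show "((\<lambda>y. y\<^sup>2 / 2 - ln (cosh y)) has_real_derivative x - tanh x) (at x)" for x
      by (auto intro!: derivative_eq_intros simp: tanh_def)
  qed (use tanh_less_self in auto)
  from this[of "\<bar>y\<bar>"] assms show ?thesis by simp
qed

text \<open>The continuous extension of tanh y / y. It decreases strictly on the half-line, which
  makes the positive fixed points of the tanh equations unique.\<close>

definition tanhc :: "real \<Rightarrow> real" where
  "tanhc y = (if y = 0 then 1 else tanh y / y)"

lemma tanhc_times_self: "tanhc y * y = tanh y"
  by (simp add: tanhc_def)

lemma tanhc_abs: "tanhc \<bar>y\<bar> = tanhc y"
  by (cases "y \<ge> 0") (auto simp: tanhc_def)

lemma tanhc_pos: "0 < tanhc y"
proof -
  have "0 < tanhc \<bar>y\<bar>" by (auto simp: tanhc_def)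
  then show ?thesis by (simp add: tanhc_abs)
qed

text \<open>The numerator of the derivative of tanh z / z is the negative of tanh z - z (1 - tanh^2
  z), a function that vanishes at 0 and increases.\<close>

lemma tanhc_less:
  assumes "0 \<le> x" "x < y" shows "tanhc y < tanhc x"
proof (cases "x = 0")
  case True
  then show ?thesis using assms tanh_less_self[of y] by (simp add: tanhc_def)
next
  case False
  then have x: "0 < x" using assms by simp
  have "tanh y / y < tanh x / x"
  proof (rule DERIV_neg_imp_decreasing[OF assms(2)])
    fix z assume "x \<le> z" "z \<le> y"
    then have z: "0 < z" using x by simp
    have "0 < (\<lambda>z. tanh z - (1 - (tanh z)\<^sup>2) * z) z"
    proof (rule pos_by_derivative[OF z])
      show "((\<lambda>z. tanh z - (1 - (tanh z)\<^sup>2) * z) has_real_derivative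
          2 * z * tanh z * (1 - (tanh z)\<^sup>2)) (at z)" for z :: real
        by (auto intro!: derivative_eq_intros DERIV_tanh_real)
      show "0 < 2 * z * tanh z * (1 - (tanh z)\<^sup>2)" if "0 < z" for z :: real
        using that tanh_square_less_1[of z] by simp
    qed simp
    then have "((1 - (tanh z)\<^sup>2) * z - tanh z * 1) / (z * z) < 0"
      using z by (intro divide_neg_pos) auto
    moreover have "((\<lambda>y. tanh y / y) has_real_derivative ((1 - (tanh z)\<^sup>2) * z - tanh z * 1) / (z * z)) (at z)"
      using z by (intro DERIV_divide DERIV_tanh_real DERIV_ident) auto
    ultimately show "\<exists>d. ((\<lambda>y. tanh y / y) has_real_derivative d) (at z) \<and> d < 0" by blast
  qed
  then show ?thesis using x assms(2) by (simp add: tanhc_def)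
qed

lemma isCont_tanhc: "isCont tanhc y"
proof (cases "y = 0")
  case True
  have "((\<lambda>h. (tanh (0 + h) - tanh 0) / h) \<longlongrightarrow> 1 - (tanh 0)\<^sup>2) (at (0 :: real))"
    using DERIV_tanh_real[of 0] by (simp only: DERIV_def)
  then have "((\<lambda>h. tanh h / h) \<longlongrightarrow> 1) (at (0 :: real))" by simp
  moreover have "\<forall>\<^sub>F h in at (0 :: real). tanh h / h = tanhc h"
    by (auto simp: eventually_at_filter tanhc_def)
  ultimately have "(tanhc \<longlongrightarrow> 1) (at 0)" by (rule Lim_transform_eventually)
  then show ?thesis by (simp add: True isCont_def tanhc_def)
next
  case False
  have "\<forall>\<^sub>F x in nhds y. x \<noteq> 0" using False by (rule t1_space_nhds)
  then have "\<forall>\<^sub>F x in nhds y. tanhc x = tanh x / x" by eventually_elim (simp add: tanhc_def)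
  moreover have "isCont (\<lambda>x. tanh x / x) y" using False by (intro continuous_intros) auto
  ultimately show ?thesis by (simp add: isCont_cong)
qed

lemma tanhc_le_1: "tanhc y \<le> 1"
proof (cases "y = 0")
  case False
  then show ?thesis using tanhc_less[of 0 "\<bar>y\<bar>"] unfolding tanhc_abs by (simp add: tanhc_def)
qed (simp add: tanhc_def)

text \<open>For \<theta> > 0 the equation reads
  \<open>tanhc (\<gamma> * \<theta>) = 1 / \<gamma>\<close>. Strict decrease gives uniqueness; the
  values 1 and tanh \<gamma> / \<gamma> < 1/\<gamma> at the ends of [0, \<gamma>] give
  existence.\<close>

lemma theta_unique:
  assumes "1 < \<gamma>"
  shows "{\<theta>. \<theta> > 0 \<and> tanh (\<gamma> * \<theta>) = \<theta>} = {theta \<gamma>}" "0 < theta \<gamma>" "theta \<gamma> < 1"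
proof -
  have char: "tanh (\<gamma> * \<theta>) = \<theta> \<longleftrightarrow> tanhc (\<gamma> * \<theta>) = 1 / \<gamma>" if "0 < \<theta>" for \<theta>
    using assms that by (auto simp: tanhc_def field_simps)
  have "\<exists>y. 0 \<le> y \<and> y \<le> \<gamma> \<and> tanhc y = 1 / \<gamma>"
  proof (rule IVT2)
    show "tanhc \<gamma> \<le> 1 / \<gamma>" using assms tanh_real_bounds[of \<gamma>] by (simp add: tanhc_def divide_right_mono)
    show "1 / \<gamma> \<le> tanhc 0" using assms by (simp add: tanhc_def)
  qed (use assms isCont_tanhc in auto)
  then obtain y where y: "0 \<le> y" "tanhc y = 1 / \<gamma>" by blast
  have "y \<noteq> 0" using y(2) assms by (auto simp: tanhc_def)
  then have ex: "0 < y / \<gamma> \<and> tanh (\<gamma> * (y / \<gamma>)) = y / \<gamma>"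
    using char[of "y / \<gamma>"] y assms by simp
  have uniq: "\<theta> = \<theta>'" if "0 < \<theta>" "tanh (\<gamma> * \<theta>) = \<theta>" "0 < \<theta>'" "tanh (\<gamma> * \<theta>') = \<theta>'" for \<theta> \<theta>'
  proof -
    have eq: "tanhc (\<gamma> * \<theta>) = tanhc (\<gamma> * \<theta>')" using char that by simp
    have "\<not> \<theta> < \<theta>'" "\<not> \<theta>' < \<theta>"
      using eq tanhc_less[of "\<gamma> * \<theta>" "\<gamma> * \<theta>'"] tanhc_less[of "\<gamma> * \<theta>'" "\<gamma> * \<theta>"] that assms by auto
    then show ?thesis by simp
  qed
  have theta: "theta \<gamma> = y / \<gamma>"
    unfolding theta_def using ex uniq by (intro the_equality) auto
  show "{\<theta>. \<theta> > 0 \<and> tanh (\<gamma> * \<theta>) = \<theta>} = {theta \<gamma>}"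
    unfolding theta using ex uniq by blast
  show "0 < theta \<gamma>" "theta \<gamma> < 1"
    using ex tanh_real_bounds[of "\<gamma> * (y / \<gamma>)"] unfolding theta by auto
qed

text \<open>For zero external field the overlap equation reads
  \<open>\<beta>\<^sup>2 * mean_tanhc_square (\<beta> * sqrt q) = 1\<close> when \<open>q > 0\<close>.\<close>

definition mean_tanhc_square :: "real \<Rightarrow> real" where
  "mean_tanhc_square x = (LINT z|std_normal_distribution. z\<^sup>2 * (tanhc (x * z))\<^sup>2)"

lemma measurable_tanhc [measurable]: "tanhc \<in> borel_measurable borel"
  using isCont_tanhc by (intro borel_measurable_continuous_onI continuous_at_imp_continuous_on) auto

lemma integrable_std_normal_square: "integrable std_normal_distribution (\<lambda>z. z\<^sup>2)"
  by (rule integrable_std_normal_distribution_moment)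

lemma std_normal_second_moment: "(LINT z|std_normal_distribution. z\<^sup>2) = 1"
  using std_normal_distribution_even_moments(1)[of 1] by (simp add: fact_numeral)

lemma tanhc_square_le_1: "(tanhc y)\<^sup>2 \<le> 1"
  using tanhc_le_1[of y] tanhc_pos[of y] by (simp add: power_le_one)

lemma integrable_tanhc_square: "integrable std_normal_distribution (\<lambda>z. z\<^sup>2 * (tanhc (x * z))\<^sup>2)"
proof (rule Bochner_Integration.integrable_bound[OF integrable_std_normal_square])
  have "z\<^sup>2 * (tanhc (x * z))\<^sup>2 \<le> z\<^sup>2" for z
    using tanhc_square_le_1[of "x * z"] by (simp add: mult_left_le)
  then show "AE z in std_normal_distribution. norm (z\<^sup>2 * (tanhc (x * z))\<^sup>2) \<le> norm (z\<^sup>2)" by simp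
qed simp

lemma AE_std_normal_nonzero: "AE z in std_normal_distribution. z \<noteq> 0"
  using AE_lborel_singleton[of "0 :: real"] by (subst AE_density) auto

lemma mean_tanhc_square_0: "mean_tanhc_square 0 = 1"
  by (simp add: mean_tanhc_square_def tanhc_def std_normal_second_moment)

text \<open>The integrand decreases strictly except at z = 0, a null set.\<close>

lemma mean_tanhc_square_less:
  assumes "0 \<le> x" "x < y" shows "mean_tanhc_square y < mean_tanhc_square x"
proof -
  have "prob_space std_normal_distribution" by (rule prob_space_std_normal)
  then interpret prob_space std_normal_distribution .
  show ?thesis
    unfolding mean_tanhc_square_def
  proof (rule integral_less_AE_space[OF integrable_tanhc_square integrable_tanhc_square])
    show "AE z in std_normal_distribution. z\<^sup>2 * (tanhc (y * z))\<^sup>2 < z\<^sup>2 * (tanhc (x * z))\<^sup>2"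
      using AE_std_normal_nonzero
    proof eventually_elim
      case (elim z)
      have "tanhc \<bar>y * z\<bar> < tanhc \<bar>x * z\<bar>"
        using assms elim by (intro tanhc_less) (auto simp: abs_mult mult_strict_right_mono)
      then have "(tanhc (y * z))\<^sup>2 < (tanhc (x * z))\<^sup>2"
        using tanhc_pos[of "y * z"] by (intro power_strict_mono) (auto simp: tanhc_abs)
      then show ?case using elim by simp
    qed
    show "emeasure std_normal_distribution (space std_normal_distribution) \<noteq> 0"
      by (simp only: emeasure_space_1) simp
  qed
qed

lemma isCont_mean_tanhc_square: "isCont mean_tanhc_square x"
  unfolding continuous_at_sequentially comp_def
proof (intro allI impI)
  fix u :: "nat \<Rightarrow> real" assume u: "u \<longlonglongrightarrow> x"
  show "(\<lambda>n. mean_tanhc_square (u n)) \<longlonglongrightarrow> mean_tanhc_square x"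
    unfolding mean_tanhc_square_def
  proof (rule integral_dominated_convergence[OF _ _ integrable_std_normal_square])
    have "(\<lambda>n. z\<^sup>2 * (tanhc (u n * z))\<^sup>2) \<longlonglongrightarrow> z\<^sup>2 * (tanhc (x * z))\<^sup>2" for z
      by (intro tendsto_intros isCont_tendsto_compose[OF isCont_tanhc] u)
    then show "AE z in std_normal_distribution. (\<lambda>n. z\<^sup>2 * (tanhc (u n * z))\<^sup>2) \<longlonglongrightarrow> z\<^sup>2 * (tanhc (x * z))\<^sup>2"
      by simp
    have "z\<^sup>2 * (tanhc (u n * z))\<^sup>2 \<le> z\<^sup>2" for z n
      using tanhc_square_le_1[of "u n * z"] by (simp add: mult_left_le)
    then show "AE z in std_normal_distribution. norm (z\<^sup>2 * (tanhc (u n * z))\<^sup>2) \<le> z\<^sup>2" for n by simp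
  qed simp_all
qed

lemma mean_tanh_square:
  "(LINT z|std_normal_distribution. (tanh (x * z))\<^sup>2) = x\<^sup>2 * mean_tanhc_square x"
proof -
  have "(tanh (x * z))\<^sup>2 = x\<^sup>2 * (z\<^sup>2 * (tanhc (x * z))\<^sup>2)" for z
    by (simp add: tanhc_times_self[symmetric] power_mult_distrib mult_ac)
  then show ?thesis by (simp add: mean_tanhc_square_def)
qed

text \<open>This strictness keeps the positive fixed point below 1.\<close>

lemma mean_tanh_square_less_1: "(LINT z|std_normal_distribution. (tanh (x * z))\<^sup>2) < 1"
proof -
  have "prob_space std_normal_distribution" by (rule prob_space_std_normal)
  then interpret prob_space std_normal_distribution .
  have "(LINT z|std_normal_distribution. (tanh (x * z))\<^sup>2) < (LINT z|std_normal_distribution. 1)"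
  proof (rule integral_less_AE_space)
    have "(\<lambda>z. x\<^sup>2 * (z\<^sup>2 * (tanhc (x * z))\<^sup>2)) = (\<lambda>z. (tanh (x * z))\<^sup>2)"
      by (simp add: tanhc_times_self[symmetric] power_mult_distrib mult_ac)
    then show "integrable std_normal_distribution (\<lambda>z. (tanh (x * z))\<^sup>2)"
      using integrable_mult_right[OF integrable_tanhc_square, of "x\<^sup>2" x] by simp
    show "AE z in std_normal_distribution. (tanh (x * z))\<^sup>2 < 1" by (simp add: tanh_square_less_1)
    show "emeasure std_normal_distribution (space std_normal_distribution) \<noteq> 0"
      by (simp only: emeasure_space_1) simp
  qed simp
  then show ?thesis using prob_space by simp
qed

lemma overlap_fixpoint_iff:
  assumes "0 \<le> q"
  shows "overlap_fixpoint \<beta> q \<longleftrightarrow> q = 0 \<or> \<beta>\<^sup>2 * mean_tanhc_square (\<beta> * sqrt q) = 1"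
proof -
  have "overlap_fixpoint \<beta> q \<longleftrightarrow> q = \<beta>\<^sup>2 * q * mean_tanhc_square (\<beta> * sqrt q)"
    using assms by (simp add: overlap_fixpoint_def mean_tanh_square power_mult_distrib)
  then show ?thesis using assms by auto
qed

lemma overlap_eqI:
  assumes "q \<in> {0..<1}" "overlap_fixpoint \<beta> q" "\<And>p. p \<in> {0..<1} \<Longrightarrow> overlap_fixpoint \<beta> p \<Longrightarrow> p \<le> q"
  shows "overlap \<beta> = q"
  unfolding overlap_def using assms by (intro Greatest_equality) auto

text \<open>For \<beta>, q > 0 the mean is strictly below its value 1 at the origin, so multiplying
  by \<beta>^2 \<le> 1 cannot give 1.\<close>

lemma overlap_high_temperature:
  assumes "0 \<le> \<beta>" "\<beta> \<le> 1" "0 < q" shows "\<not> overlap_fixpoint \<beta> q"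
proof
  assume "overlap_fixpoint \<beta> q"
  then have eq: "\<beta>\<^sup>2 * mean_tanhc_square (\<beta> * sqrt q) = 1" using assms by (simp add: overlap_fixpoint_iff)
  then have "0 < \<beta>" using assms by (cases "\<beta> = 0") auto
  then have "mean_tanhc_square (\<beta> * sqrt q) < 1"
    using mean_tanhc_square_less[of 0 "\<beta> * sqrt q"] assms by (simp add: mean_tanhc_square_0)
  then have "\<beta>\<^sup>2 * mean_tanhc_square (\<beta> * sqrt q) < \<beta>\<^sup>2 * 1"
    using \<open>0 < \<beta>\<close> by (intro mult_strict_left_mono) auto
  also have "\<dots> \<le> 1" using assms by (simp add: power_le_one)
  finally show False using eq by simp
qed

text \<open>In the variable x = \<beta> sqrt q the equation is
  \<open>mean_tanhc_square x = 1 / \<beta>\<^sup>2\<close>, with a strictly decreasing left side. It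
  is solved on [0, \<beta>], and x < \<beta> means q < 1.\<close>

lemma overlap_low_temperature:
  assumes "1 < \<beta>"
  obtains q where "0 < q" "q < 1" "{q \<in> {0<..}. overlap_fixpoint \<beta> q} = {q}"
proof -
  have "\<exists>x. 0 \<le> x \<and> x \<le> \<beta> \<and> mean_tanhc_square x = 1 / \<beta>\<^sup>2"
  proof (rule IVT2)
    show "mean_tanhc_square \<beta> \<le> 1 / \<beta>\<^sup>2"
      using mean_tanh_square_less_1[of \<beta>] assms unfolding mean_tanh_square by (simp add: field_simps)
    show "1 / \<beta>\<^sup>2 \<le> mean_tanhc_square 0" using assms by (simp add: mean_tanhc_square_0 one_le_power)
  qed (use assms isCont_mean_tanhc_square in auto)
  then obtain x where x: "0 \<le> x" "x \<le> \<beta>" "mean_tanhc_square x = 1 / \<beta>\<^sup>2" by blast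
  have "x \<noteq> 0" using x(3) one_less_power[OF assms, of 2] by (auto simp: mean_tanhc_square_0)
  moreover have "x \<noteq> \<beta>"
    using mean_tanh_square_less_1[of \<beta>] x(3) assms unfolding mean_tanh_square by auto
  ultimately have x': "0 < x" "x < \<beta>" using x by auto
  have uniq: "y = x" if "0 \<le> y" "mean_tanhc_square y = 1 / \<beta>\<^sup>2" for y
    using mean_tanhc_square_less[of x y] mean_tanhc_square_less[of y x] that x by (cases x y rule: linorder_cases) auto
  let ?q = "(x / \<beta>)\<^sup>2"
  have "overlap_fixpoint \<beta> q \<longleftrightarrow> q = ?q" if "0 < q" for q
  proof -
    have "overlap_fixpoint \<beta> q \<longleftrightarrow> mean_tanhc_square (\<beta> * sqrt q) = 1 / \<beta>\<^sup>2"
      using that assms by (simp add: overlap_fixpoint_iff field_simps)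
    also have "\<dots> \<longleftrightarrow> \<beta> * sqrt q = x"
      using uniq[of "\<beta> * sqrt q"] that assms x(3) by auto
    also have "\<dots> \<longleftrightarrow> sqrt q = x / \<beta>" using assms by (auto simp: field_simps)
    also have "\<dots> \<longleftrightarrow> q = ?q"
      using that x'(1) assms by (metis divide_pos_pos less_trans less_eq_real_def real_sqrt_pow2 real_sqrt_unique zero_less_one)
    finally show ?thesis .
  qed
  moreover have "0 < ?q" "?q < 1"
    using x' assms by (auto simp: power_less_one_iff abs_square_less_1)
  ultimately show thesis by (intro that[of ?q]) auto
qed

text \<open>In the expansion of Guerra's bound the linear terms \<beta>^2 q/2 cancel. The quadratic
  coefficient -\<beta>^2 (\<beta>^2 - 1)/4 is negative for \<beta> > 1, and a small trial q keeps
  the cubic term below it.\<close>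

lemma replica_symmetric_less_annealed:
  assumes "1 < \<beta>"
  shows "\<exists>q>0. (LINT z|std_normal_distribution. ln (cosh (\<beta> * sqrt q * z))) + \<beta>\<^sup>2 / 4 * (1 - q)\<^sup>2 < \<beta>\<^sup>2 / 4"
proof -
  have b: "1 < \<beta>\<^sup>2" using assms by (simp add: one_less_power)
  \<comment> \<open>With this q the cubic contribution \<beta>^6 q/3 is \<beta>^2 (\<beta>^2 -
    1)/12, one third of the quadratic gain.\<close>
  define q where "q = (\<beta>\<^sup>2 - 1) / (4 * \<beta> ^ 4)"
  have q: "0 < q" using b assms by (simp add: q_def)
  define x where "x = \<beta> * sqrt q"
  have x2: "x\<^sup>2 = \<beta>\<^sup>2 * q" using q by (simp add: x_def power_mult_distrib)
  have x4: "x ^ 4 = \<beta> ^ 4 * q\<^sup>2"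
  proof -
    have "x ^ 4 = (x\<^sup>2)\<^sup>2" "\<beta> ^ 4 = (\<beta>\<^sup>2)\<^sup>2" by (simp_all flip: power_mult)
    then show ?thesis by (simp only: x2 power_mult_distrib)
  qed
  have x6: "x ^ 6 = \<beta> ^ 6 * q ^ 3"
  proof -
    have "x ^ 6 = (x\<^sup>2) ^ 3" "\<beta> ^ 6 = (\<beta>\<^sup>2) ^ 3" by (simp_all flip: power_mult)
    then show ?thesis by (simp only: x2 power_mult_distrib)
  qed
  have moments: "(LINT z|std_normal_distribution. z ^ 4) = 3" "(LINT z|std_normal_distribution. z ^ 6) = 15"
    using std_normal_distribution_even_moments(1)[of 2] std_normal_distribution_even_moments(1)[of 3]
    by (simp_all add: fact_numeral)
  note int = integrable_std_normal_distribution_moment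
  have "(LINT z|std_normal_distribution. ln (cosh (x * z)))
      \<le> (LINT z|std_normal_distribution. x\<^sup>2 / 2 * z\<^sup>2 - x ^ 4 / 12 * z ^ 4 + x ^ 6 / 45 * z ^ 6)"
    using ln_cosh_le_sextic[of "x * z" for z]
    by (intro integral_mono integrable_ln_cosh Bochner_Integration.integrable_add
        Bochner_Integration.integrable_diff integrable_mult_right int) (simp add: power_mult_distrib)
  also have "\<dots> = x\<^sup>2 / 2 - x ^ 4 / 4 + x ^ 6 / 3"
    using int moments std_normal_second_moment by simp
  also have "\<dots> = \<beta>\<^sup>2 * q / 2 - \<beta> ^ 4 * q\<^sup>2 / 4 + \<beta> ^ 6 * q ^ 3 / 3"
    unfolding x2 x4 x6 ..
  finally have bound: "(LINT z|std_normal_distribution. ln (cosh (x * z)))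
      \<le> \<beta>\<^sup>2 * q / 2 - \<beta> ^ 4 * q\<^sup>2 / 4 + \<beta> ^ 6 * q ^ 3 / 3" .
  have le: "(LINT z|std_normal_distribution. ln (cosh (\<beta> * sqrt q * z))) + \<beta>\<^sup>2 / 4 * (1 - q)\<^sup>2
      \<le> \<beta>\<^sup>2 / 4 + q\<^sup>2 * (\<beta>\<^sup>2 / 4 - \<beta> ^ 4 / 4 + \<beta> ^ 6 * q / 3)"
  proof -
    have "\<beta>\<^sup>2 * q / 2 - \<beta> ^ 4 * q\<^sup>2 / 4 + \<beta> ^ 6 * q ^ 3 / 3 + \<beta>\<^sup>2 / 4 * (1 - q)\<^sup>2
        = \<beta>\<^sup>2 / 4 + q\<^sup>2 * (\<beta>\<^sup>2 / 4 - \<beta> ^ 4 / 4 + \<beta> ^ 6 * q / 3)"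
      by (simp add: field_simps eval_nat_numeral)
    then show ?thesis using bound unfolding x_def by linarith
  qed
  have "\<beta> ^ 6 * q = \<beta>\<^sup>2 * (\<beta>\<^sup>2 - 1) / 4"
    using assms by (simp add: q_def field_simps eval_nat_numeral)
  then have "\<beta>\<^sup>2 / 4 - \<beta> ^ 4 / 4 + \<beta> ^ 6 * q / 3 = - (\<beta>\<^sup>2 * (\<beta>\<^sup>2 - 1) / 6)"
    unfolding times_divide_eq_left by (simp add: field_simps eval_nat_numeral)
  also have "\<dots> < 0" using b assms by simp
  finally have "q\<^sup>2 * (\<beta>\<^sup>2 / 4 - \<beta> ^ 4 / 4 + \<beta> ^ 6 * q / 3) < 0" using q by (simp add: mult_pos_neg)
  with le q show ?thesis by (intro exI[of _ q]) auto
qed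

lemma DERIV_glue_at_0:
  fixes f g :: "real \<Rightarrow> real"
  assumes "(f has_real_derivative D) (at 0)" "(g has_real_derivative D) (at 0)" "f 0 = g 0"
  shows "((\<lambda>y. if 0 \<le> y then f y else g y) has_real_derivative D) (at 0)"
  unfolding DERIV_def filterlim_at_split
proof
  have "((\<lambda>h. (g (0 + h) - g 0) / h) \<longlongrightarrow> D) (at_left 0)"
    using assms(2) by (simp only: DERIV_def filterlim_at_split)
  then show "((\<lambda>h. ((if 0 \<le> 0 + h then f (0 + h) else g (0 + h)) - (if 0 \<le> (0 :: real) then f 0 else g 0)) / h) \<longlongrightarrow> D) (at_left 0)"
    by (rule Lim_transform_eventually) (use assms(3) in \<open>auto simp: eventually_at_filter\<close>)
  have "((\<lambda>h. (f (0 + h) - f 0) / h) \<longlongrightarrow> D) (at_right 0)"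
    using assms(1) by (simp only: DERIV_def filterlim_at_split)
  then show "((\<lambda>h. ((if 0 \<le> 0 + h then f (0 + h) else g (0 + h)) - (if 0 \<le> (0 :: real) then f 0 else g 0)) / h) \<longlongrightarrow> D) (at_right 0)"
    by (rule Lim_transform_eventually) (auto simp: eventually_at_filter)
qed

section \<open>The replica-symmetric bound at q = 1\<close>

lemma std_normal_abs_moment: "(LINT z|std_normal_distribution. \<bar>z\<bar>) = sqrt (2 / pi)"
  using std_normal_distribution_odd_moments_abs(1)[of 0] by simp

text \<open>c exp(-c |y|) is the derivative of the odd function sgn(y) (1 - exp(-c |y|)), which is
  bounded by 1. Integration by parts therefore bounds its mean by E |z| = sqrt (2/pi).\<close>

lemma std_normal_exp_abs_le:
  assumes c: "0 < c"
  shows "(LINT z|std_normal_distribution. exp (- c * \<bar>z\<bar>)) \<le> sqrt (2 / pi) / c"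
proof -
  define f where "f y = (if 0 \<le> y then 1 - exp (- c * y) else exp (c * y) - 1)" for y
  have right: "((\<lambda>y. 1 - exp (- c * y)) has_real_derivative c * exp (- c * y)) (at y)"
    and left: "((\<lambda>y. exp (c * y) - 1) has_real_derivative c * exp (c * y)) (at y)" for y
    by (auto intro!: derivative_eq_intros)
  have der: "(f has_real_derivative c * exp (- c * \<bar>y\<bar>)) (at y)" for y
  proof (rule linorder_cases[of y 0])
    assume "y = 0"
    have r: "((\<lambda>y. 1 - exp (- c * y)) has_real_derivative c) (at 0)"
      and l: "((\<lambda>y. exp (c * y) - 1) has_real_derivative c) (at 0)"
      using right[of 0] left[of 0] by simp_all
    have "(f has_real_derivative c) (at 0)"
      unfolding f_def by (rule DERIV_glue_at_0[OF r l]) simp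
    then show ?thesis using \<open>y = 0\<close> by simp
  next
    assume y: "0 < y"
    then have "\<forall>\<^sub>F x in nhds y. x \<in> {0<..}" by (intro eventually_nhds_in_open) auto
    then have "\<forall>\<^sub>F x in nhds y. f x = 1 - exp (- c * x)" by eventually_elim (simp add: f_def)
    then show ?thesis using right[of y] y by (subst DERIV_cong_ev[OF refl _ refl]) auto
  next
    assume y: "y < 0"
    then have "\<forall>\<^sub>F x in nhds y. x \<in> {..<0}" by (intro eventually_nhds_in_open) auto
    then have "\<forall>\<^sub>F x in nhds y. f x = exp (c * x) - 1" by eventually_elim (simp add: f_def)
    then show ?thesis using left[of y] y by (subst DERIV_cong_ev[OF refl _ refl]) auto
  qed
  have bound: "\<bar>f y\<bar> \<le> 1" for y
    using c by (auto simp: f_def mult_le_0_iff intro: less_imp_le)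
  have ibp: "(LINT z|std_normal_distribution. z * f z) = (LINT z|std_normal_distribution. c * exp (- c * \<bar>z\<bar>))"
  proof (rule std_normal_integral_by_parts[OF der])
    show "isCont (\<lambda>y. c * exp (- c * \<bar>y\<bar>)) y" for y by (intro continuous_intros)
    show "\<bar>c * exp (- c * \<bar>y\<bar>)\<bar> \<le> c" for y using c by (simp add: abs_mult)
  qed (rule bound)
  have "(LINT z|std_normal_distribution. z * f z) \<le> (LINT z|std_normal_distribution. \<bar>z\<bar>)"
  proof (rule integral_mono')
    show "z * f z \<le> \<bar>z\<bar>" for z
      using mult_left_mono[OF bound[of z], of "\<bar>z\<bar>"] abs_ge_self[of "z * f z"] by (simp add: abs_mult)
  qed (use integrable_std_normal_id in auto)
  then show ?thesis using c unfolding ibp std_normal_abs_moment by (simp add: field_simps)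
qed

lemma ln_2_cosh: "ln 2 + ln (cosh y) = \<bar>y\<bar> + ln (1 + exp (- 2 * \<bar>y\<bar>))" for y :: real
proof -
  have "2 * cosh y = exp \<bar>y\<bar> * (1 + exp (- 2 * \<bar>y\<bar>))"
    by (cases "0 \<le> y") (auto simp: cosh_def distrib_left simp flip: exp_add)
  then have "ln (2 * cosh y) = ln (exp \<bar>y\<bar> * (1 + exp (- 2 * \<bar>y\<bar>)))" by simp
  then show ?thesis by (simp add: ln_mult add_pos_pos less_imp_neq[THEN not_sym])
qed

text \<open>Split off |\<beta> z| and apply ln (1 + u) \<le> u to the rest. Twice the right side is
  the second entry of \<open>explicit_threshold\<close>.\<close>

lemma mean_ln_2_cosh_le:
  assumes "0 < \<beta>"
  shows "ln 2 + (LINT z|std_normal_distribution. ln (cosh (\<beta> * z))) \<le> sqrt (2 / pi) * (\<beta> + 1 / (2 * \<beta>))"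
proof -
  have "prob_space std_normal_distribution" by (rule prob_space_std_normal)
  then interpret prob_space std_normal_distribution .
  have e: "integrable std_normal_distribution (\<lambda>z. exp (- (2 * \<beta>) * \<bar>z\<bar>))"
    using assms by (intro std_normal_integrable_bounded[where B = 1]) auto
  have a: "integrable std_normal_distribution (\<lambda>z. \<bar>z\<bar>)" using integrable_std_normal_id by simp
  have "ln 2 + (LINT z|std_normal_distribution. ln (cosh (\<beta> * z)))
      = (LINT z|std_normal_distribution. ln 2 + ln (cosh (\<beta> * z)))"
    using Bochner_Integration.integral_add[OF integrable_const integrable_ln_cosh] prob_space by simp
  also have "\<dots> \<le> (LINT z|std_normal_distribution. \<beta> * \<bar>z\<bar> + exp (- (2 * \<beta>) * \<bar>z\<bar>))"
  proof (rule integral_mono)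
    fix z
    have "ln (1 + exp (- 2 * \<bar>\<beta> * z\<bar>)) \<le> exp (- 2 * \<bar>\<beta> * z\<bar>)" by (rule ln_add_one_self_le_self) simp
    then show "ln 2 + ln (cosh (\<beta> * z)) \<le> \<beta> * \<bar>z\<bar> + exp (- (2 * \<beta>) * \<bar>z\<bar>)"
      using assms unfolding ln_2_cosh by (simp add: abs_mult mult.assoc)
  qed (intro Bochner_Integration.integrable_add integrable_mult_right integrable_const integrable_ln_cosh e a)+
  also have "\<dots> = \<beta> * sqrt (2 / pi) + (LINT z|std_normal_distribution. exp (- (2 * \<beta>) * \<bar>z\<bar>))"
    using a e by (subst Bochner_Integration.integral_add) (auto simp: std_normal_abs_moment)
  also have "\<dots> \<le> \<beta> * sqrt (2 / pi) + sqrt (2 / pi) / (2 * \<beta>)"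
    using std_normal_exp_abs_le[of "2 * \<beta>"] assms by simp
  finally show ?thesis by (simp add: distrib_left mult.commute)
qed

section \<open>The maximizers\<close>

context
  fixes M :: "'a measure" and g :: "nat \<Rightarrow> nat \<Rightarrow> 'a \<Rightarrow> real"
  assumes g: "iid_std_gaussian M g"
begin

lemma F_SK_le:
  assumes "\<And>N. 0 < N \<Longrightarrow> sk N \<beta> h \<le> sk N \<beta>' h' + real N * c"
  shows "F_SK M g \<beta> h \<le> F_SK M g \<beta>' h' + c"
proof (rule LIMSEQ_le[OF F_SK_limit[OF g] tendsto_add[OF F_SK_limit[OF g] tendsto_const]])
  have "sk N \<beta> h / real N \<le> sk N \<beta>' h' / real N + c" if "1 \<le> N" for N
    using assms[of N] that by (simp add: field_simps)
  then show "\<exists>N. \<forall>n\<ge>N. sk n \<beta> h / real n \<le> sk n \<beta>' h' / real n + c" by blast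
qed

lemma F_SK_le_const:
  assumes "\<And>N. 0 < N \<Longrightarrow> sk N \<beta> h \<le> real N * c"
  shows "F_SK M g \<beta> h \<le> c"
proof (rule LIMSEQ_le_const2[OF F_SK_limit[OF g]])
  have "sk N \<beta> h / real N \<le> c" if "1 \<le> N" for N
    using assms[of N] that by (simp add: field_simps)
  then show "\<exists>N. \<forall>n\<ge>N. sk n \<beta> h / real n \<le> c" by blast
qed

lemma F_SK_le_replica_symmetric:
  "0 \<le> q \<Longrightarrow> F_SK M g \<beta> 0 \<le> ln 2 + (LINT z|std_normal_distribution. ln (cosh (\<beta> * sqrt q * z)))
    + \<beta>\<^sup>2 / 4 * (1 - q)\<^sup>2"
  by (rule F_SK_le_const) (rule sk_le_replica_symmetric)

lemma F_SK_le_annealed: "F_SK M g \<beta> 0 \<le> ln 2 + \<beta>\<^sup>2 / 4"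
  using F_SK_le_replica_symmetric[of 0 \<beta>] by simp

lemma F_SK_field_le: "F_SK M g \<beta> h \<le> F_SK M g \<beta> 0 + ln (cosh h)"
  by (rule F_SK_le) (rule sk_field_le)

lemma F_SK_beta_le: "\<beta>\<^sup>2 \<le> \<beta>'\<^sup>2 \<Longrightarrow> F_SK M g \<beta>' h \<le> F_SK M g \<beta> h + (\<beta>'\<^sup>2 - \<beta>\<^sup>2) / 4"
  by (rule F_SK_le) (rule sk_mono_beta(2))

text \<open>Monotonicity in \<beta> starting from \<beta> = 0, where the spins decouple.\<close>

lemma F_SK_ge: "ln 2 + ln (cosh h) \<le> F_SK M g \<beta> h"
proof (rule LIMSEQ_le_const[OF F_SK_limit[OF g]])
  have "ln 2 + ln (cosh h) \<le> sk N \<beta> h / real N" if "1 \<le> N" for N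
    using sk_mono_beta(1)[of N 0 \<beta> h] that by (simp add: sk_beta_zero field_simps)
  then show "\<exists>N. \<forall>n\<ge>N. ln 2 + ln (cosh h) \<le> sk n \<beta> h / real n" by blast
qed

lemma ground_state_energy_bounds:
  assumes "0 \<le> \<beta>"
  shows "F_SK M g \<beta> 0 \<le> ln 2 + \<beta> * ground_state_energy M g"
    and "\<beta> * ground_state_energy M g \<le> F_SK M g \<beta> 0"
proof -
  let ?E = "\<lambda>N. LINT \<omega>|M. Max ((\<lambda>\<sigma>. 1 / sqrt (real N) * pair_sum g N \<sigma> \<omega>) ` spins N)"
  have lim: "(\<lambda>N. \<beta> * (1 / real N * ?E N)) \<longlonglongrightarrow> \<beta> * ground_state_energy M g"
    by (intro tendsto_mult tendsto_const ground_state_energy_limit[OF g])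
  have div: "s / n \<le> l + b * (1 / n * e)" if "s \<le> n * l + b * e" "0 < n" for s n l b e :: real
    using that by (simp add: field_simps)
  have div': "b * (1 / n * e) \<le> s / n" if "b * e \<le> s" "0 < n" for s n b e :: real
    using that by (simp add: field_simps)
  have "sk N \<beta> 0 / real N \<le> ln 2 + \<beta> * (1 / real N * ?E N)" "\<beta> * (1 / real N * ?E N) \<le> sk N \<beta> 0 / real N"
    if "1 \<le> N" for N
    using max_energy_bounds[OF g assms, of N] that by (intro div div'; simp)+
  then have "\<exists>N. \<forall>n\<ge>N. sk n \<beta> 0 / real n \<le> ln 2 + \<beta> * (1 / real n * ?E n)"
    "\<exists>N. \<forall>n\<ge>N. \<beta> * (1 / real n * ?E n) \<le> sk n \<beta> 0 / real n"
    by blast+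
  then show "F_SK M g \<beta> 0 \<le> ln 2 + \<beta> * ground_state_energy M g"
    "\<beta> * ground_state_energy M g \<le> F_SK M g \<beta> 0"
    using LIMSEQ_le[OF F_SK_limit[OF g] tendsto_add[OF tendsto_const lim]] LIMSEQ_le[OF lim F_SK_limit[OF g]]
    by blast+
qed

text \<open>\<beta> E_0 is at most F(\<beta>, 0), hence at most ln 2 + \<beta>^2/4; after division
  by \<beta> this is smallest at \<beta> = 2 sqrt (ln 2).\<close>

lemma ground_state_energy_le: "ground_state_energy M g \<le> sqrt (ln 2)"
proof -
  have pos: "0 < sqrt (ln 2)" by simp
  have "2 * sqrt (ln 2) * ground_state_energy M g \<le> F_SK M g (2 * sqrt (ln 2)) 0"
    by (rule ground_state_energy_bounds(2)) simp
  also have "\<dots> \<le> ln 2 + (2 * sqrt (ln 2))\<^sup>2 / 4" by (rule F_SK_le_annealed)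
  also have "\<dots> = 2 * sqrt (ln 2) * sqrt (ln 2)" by (simp add: power_mult_distrib)
  finally show ?thesis using pos by (simp only: mult_le_cancel_left_pos)
qed

lemma zero_notin_Omega:
  assumes "\<bar>\<mu>\<bar> \<le> 1" "F_SK M g \<beta> 0 < F_SK M g \<beta> (\<gamma> * \<mu>) - \<gamma> * \<mu>\<^sup>2 / 2"
  shows "0 \<notin> Omega M g \<beta> \<gamma>"
  using assms unfolding Omega_def is_arg_max_def by (auto simp: abs_le_iff)

text \<open>For \<mu> \<noteq> 0 the field gains at most ln cosh (\<gamma> \<mu>) < \<gamma>^2
  \<mu>^2/2, and \<gamma> \<le> 1 makes this no more than the penalty \<gamma> \<mu>^2/2.\<close>

lemma Omega_weak_interaction:
  assumes "0 < \<gamma>" "\<gamma> \<le> 1"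
  shows "Omega M g \<beta> \<gamma> = {0}"
proof -
  have less: "F_SK M g \<beta> (\<gamma> * \<mu>) - \<gamma> * \<mu>\<^sup>2 / 2 < F_SK M g \<beta> 0" if "\<mu> \<noteq> 0" for \<mu>
  proof -
    have "F_SK M g \<beta> (\<gamma> * \<mu>) \<le> F_SK M g \<beta> 0 + ln (cosh (\<gamma> * \<mu>))" by (rule F_SK_field_le)
    moreover have "ln (cosh (\<gamma> * \<mu>)) < (\<gamma> * \<mu>)\<^sup>2 / 2" using assms that by (intro ln_cosh_less) auto
    moreover have "\<gamma>\<^sup>2 * \<mu>\<^sup>2 \<le> \<gamma> * \<mu>\<^sup>2"
      using assms by (intro mult_right_mono) (auto simp: power2_eq_square mult_left_le)
    ultimately show ?thesis by (simp add: power_mult_distrib)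
  qed
  have "0 \<in> Omega M g \<beta> \<gamma>"
  proof -
    have "F_SK M g \<beta> (\<gamma> * \<mu>) - \<gamma> * \<mu>\<^sup>2 / 2 \<le> F_SK M g \<beta> 0" for \<mu>
      using less[of \<mu>] by (cases "\<mu> = 0") auto
    then show ?thesis unfolding Omega_def is_arg_max_def by (auto simp: not_less)
  qed
  moreover have "\<mu> \<notin> Omega M g \<beta> \<gamma>" if "\<mu> \<noteq> 0" for \<mu>
    unfolding Omega_def is_arg_max_def using less[OF that] by (auto intro!: exI[of _ 0])
  ultimately show ?thesis by blast
qed

text \<open>The field found on the Nishimori line at an inverse temperature \<open>b \<ge> \<beta>\<close> with
  \<open>1 < b\<^sup>2 \<le> \<gamma>\<close> is transported to \<open>\<beta>\<close> by the Lipschitz bound in \<open>\<beta>\<^sup>2\<close>. It stays bounded away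
  from \<open>0\<close> because \<open>F(b, 0)\<close> is strictly below its annealed value, so that \<open>b\<^sup>2 < \<gamma>\<close> leaves a gain.\<close>

lemma zero_notin_Omega_strong_interaction:
  assumes \<beta>: "\<beta>\<^sup>2 \<le> \<gamma>" and \<gamma>: "1 < \<gamma>"
  shows "0 \<notin> Omega M g \<beta> \<gamma>"
proof -
  \<comment> \<open>If \<beta>^2 < \<gamma>, s lies strictly between max(\<beta>^2, 1) and \<gamma>.
    At \<beta>^2 = \<gamma> there is no such room, and the gain has to come from \<open>a\<close>
    instead.\<close>
  define s where "s = (if \<beta>\<^sup>2 = \<gamma> then \<gamma> else (max (\<beta>\<^sup>2) 1 + \<gamma>) / 2)"
  have s: "1 < s" "\<beta>\<^sup>2 \<le> s" "s \<le> \<gamma>" "s < \<gamma> \<or> s = \<beta>\<^sup>2" using \<beta> \<gamma> by (auto simp: s_def max_def)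
  define b where "b = sqrt s"
  have b: "1 < b" "b\<^sup>2 = s" using s(1) by (auto simp: b_def)
  define a where "a = ln 2 + b\<^sup>2 / 4 - F_SK M g b 0"
  have a: "0 < a"
  proof -
    obtain q where "0 < q" "(LINT z|std_normal_distribution. ln (cosh (b * sqrt q * z))) + b\<^sup>2 / 4 * (1 - q)\<^sup>2 < b\<^sup>2 / 4"
      using replica_symmetric_less_annealed[OF b(1)] by blast
    then show ?thesis using F_SK_le_replica_symmetric[of q b] by (simp add: a_def)
  qed
  \<comment> \<open>At a fixed field h the penalty is h^2/(2 s) for coupling s and h^2/(2 \<gamma>)
    for \<gamma>; \<kappa> h^2 is what the larger coupling saves.\<close>
  define \<kappa> where "\<kappa> = 1 / (2 * s) - 1 / (2 * \<gamma>)"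
  have \<kappa>: "0 \<le> \<kappa>" "s < \<gamma> \<Longrightarrow> 0 < \<kappa>" using s \<gamma> by (auto simp: \<kappa>_def frac_le divide_strict_left_mono)
  define e where "e = (if s < \<gamma> then min (a / 2) (\<kappa> * a / 2) else a / 2)"
  have e: "0 < e" "e \<le> a / 2" "s < \<gamma> \<Longrightarrow> e \<le> \<kappa> * a / 2" using a \<kappa> by (auto simp: e_def)
  obtain \<mu> where \<mu>: "\<bar>\<mu>\<bar> \<le> 1" "ln 2 + b\<^sup>2 / 4 - e \<le> F_SK M g b (b\<^sup>2 * \<mu>) - b\<^sup>2 * \<mu>\<^sup>2 / 2"
    using exists_planted_field[OF g e(1), of b] by blast
  define h where "h = s * \<mu>"
  have h2: "b\<^sup>2 * \<mu>\<^sup>2 / 2 = h\<^sup>2 / (2 * s)" unfolding b(2) h_def using s(1) by (simp add: power2_eq_square)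
  have F: "ln 2 + s / 4 - e + h\<^sup>2 / (2 * s) \<le> F_SK M g b h" using \<mu>(2) unfolding h2 by (simp add: h_def b(2))
  have F': "ln 2 + \<beta>\<^sup>2 / 4 - e + h\<^sup>2 / (2 * s) \<le> F_SK M g \<beta> h"
    using F F_SK_beta_le[of \<beta> b h] s(2) by (simp add: b(2) diff_divide_distrib)
  have split: "h\<^sup>2 / (2 * s) = h\<^sup>2 / (2 * \<gamma>) + \<kappa> * h\<^sup>2" by (simp add: \<kappa>_def algebra_simps)
  have "F_SK M g \<beta> 0 < F_SK M g \<beta> h - h\<^sup>2 / (2 * \<gamma>)"
  proof (cases "s < \<gamma>")
    case True
    have "F_SK M g b h \<le> F_SK M g b 0 + h\<^sup>2 / 2"
      using F_SK_field_le[of b h] ln_cosh_less[of h] by (cases "h = 0") auto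
    moreover have "0 \<le> h\<^sup>2 / (2 * s)" using s(1) by simp
    \<comment> \<open>From a - e \<le> h^2/2 and e \<le> a/2: a field that makes up for the gap
      \<open>a\<close> cannot be small.\<close>
    ultimately have "a \<le> h\<^sup>2" using F e(2) by (simp add: a_def b(2))
    then have "\<kappa> * a \<le> \<kappa> * h\<^sup>2" using \<kappa>(1) by (rule mult_left_mono)
    moreover have "0 < \<kappa> * a" using \<kappa>(2)[OF True] a by simp
    ultimately show ?thesis using F' e(3)[OF True] F_SK_le_annealed[of \<beta>] unfolding split by linarith
  next
    case False
    \<comment> \<open>Now b^2 = \<beta>^2, so F(\<beta>, 0) itself lies \<open>a\<close> below the
      annealed value, twice what e can consume.\<close>
    then have "s = \<beta>\<^sup>2" using s(4) by simp
    then have "F_SK M g \<beta> 0 \<le> F_SK M g b 0" using F_SK_beta_le[of b \<beta> 0] by (simp add: b(2))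
    moreover have "0 \<le> \<kappa> * h\<^sup>2" using \<kappa>(1) by simp
    ultimately show ?thesis using F' e(1,2) a \<open>s = \<beta>\<^sup>2\<close> unfolding split by (simp add: a_def b(2))
  qed
  \<comment> \<open>The trial magnetization h/\<gamma> reproduces the same field h under the
    coupling \<gamma>; it is admissible because |h| \<le> s \<le> \<gamma>.\<close>
  moreover have "\<gamma> * (h / \<gamma>) = h" "\<gamma> * (h / \<gamma>)\<^sup>2 / 2 = h\<^sup>2 / (2 * \<gamma>)"
    using \<gamma> by (simp_all add: power2_eq_square)
  moreover have "\<bar>h / \<gamma>\<bar> \<le> 1"
  proof -
    have "\<bar>h\<bar> \<le> s * 1" using \<mu>(1) s(1) unfolding h_def abs_mult by (intro mult_mono) auto
    then show ?thesis using s(3) \<gamma> by simp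
  qed
  ultimately show ?thesis using zero_notin_Omega[of "h / \<gamma>" \<beta> \<gamma>] by simp
qed

text \<open>\<theta> is the positive stationary point of the mean-field function ln cosh (\<gamma>
  \<mu>) - \<gamma> \<mu>^2/2, hence the natural trial magnetization.\<close>

lemma zero_notin_Omega_theta:
  assumes "1 < \<gamma>" "F_SK M g \<beta> 0 < ln 2 + (ln (cosh (\<gamma> * theta \<gamma>)) - \<gamma> * (theta \<gamma>)\<^sup>2 / 2)"
  shows "0 \<notin> Omega M g \<beta> \<gamma>"
  using theta_unique(2,3)[OF assms(1)] F_SK_ge[of "\<gamma> * theta \<gamma>" \<beta>] assms(2)
  by (intro zero_notin_Omega[of "theta \<gamma>"]) auto

text \<open>Trial magnetization 1: since ln (2 cosh \<gamma>) > \<gamma>, its value exceeds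
  \<gamma>/2. Twice any upper bound on F(\<beta>, 0) is therefore a threshold for \<gamma>.\<close>

lemma zero_notin_Omega_one:
  assumes "F_SK M g \<beta> 0 \<le> \<gamma> / 2"
  shows "0 \<notin> Omega M g \<beta> \<gamma>"
proof (rule zero_notin_Omega[of 1])
  have "0 < ln (1 + exp (- 2 * \<bar>\<gamma>\<bar>))" by (rule ln_gt_zero) simp
  then have "\<gamma> < ln 2 + ln (cosh \<gamma>)" unfolding ln_2_cosh by linarith
  then show "F_SK M g \<beta> 0 < F_SK M g \<beta> (\<gamma> * 1) - \<gamma> * 1\<^sup>2 / 2"
    using F_SK_ge[of \<gamma> \<beta>] assms by simp
qed simp

lemma zero_notin_Omega_explicit:
  assumes "0 \<le> \<beta>" "explicit_threshold \<beta> < ereal \<gamma>"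
  shows "0 \<notin> Omega M g \<beta> \<gamma>"
proof (rule zero_notin_Omega_one)
  from assms(2) consider "\<beta>\<^sup>2 / 2 + 2 * ln 2 < \<gamma>"
    | "ereal (sqrt (2 / pi)) * (2 * ereal \<beta> + 1 / ereal \<beta>) < ereal \<gamma>"
    unfolding explicit_threshold_def by (auto simp: min_less_iff_disj)
  then show "F_SK M g \<beta> 0 \<le> \<gamma> / 2"
  proof cases
    case 1
    then show ?thesis using F_SK_le_annealed[of \<beta>] by simp
  next
    case 2
    \<comment> \<open>At \<beta> = 0 the second entry of the threshold is infinite and cannot lie
      below \<gamma>.\<close>
    have \<beta>: "0 < \<beta>"
    proof (rule ccontr)
      assume "\<not> 0 < \<beta>"
      then have "\<beta> = 0" using assms(1) by simp
      with 2 show False by (simp add: divide_ereal_def flip: zero_ereal_def)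
    qed
    with 2 have "sqrt (2 / pi) * (2 * \<beta> + 1 / \<beta>) < \<gamma>" by (simp add: one_ereal_def numeral_eq_ereal)
    moreover have "sqrt (2 / pi) * (2 * \<beta> + 1 / \<beta>) = 2 * (sqrt (2 / pi) * (\<beta> + 1 / (2 * \<beta>)))"
      using \<beta> by (simp add: field_simps)
    moreover have "F_SK M g \<beta> 0 \<le> sqrt (2 / pi) * (\<beta> + 1 / (2 * \<beta>))"
      using F_SK_le_replica_symmetric[of 1 \<beta>] mean_ln_2_cosh_le[OF \<beta>] by simp
    ultimately show ?thesis by linarith
  qed
qed

end

section \<open>The overlap as the largest fixed point\<close>

lemma overlap_le_1:
  assumes "0 \<le> \<beta>" "\<beta> \<le> 1" shows "overlap \<beta> = 0"
proof (rule overlap_eqI)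
  show "p \<le> 0" if "overlap_fixpoint \<beta> p" for p
    using overlap_high_temperature[OF assms, of p] that by (auto simp: not_less[symmetric])
qed (auto simp: overlap_fixpoint_iff)

lemma overlap_gt_1:
  assumes "1 < \<beta>" shows "{q \<in> {0<..<1}. overlap_fixpoint \<beta> q} = {overlap \<beta>}"
proof -
  obtain q where q: "0 < q" "q < 1" "{q \<in> {0<..}. overlap_fixpoint \<beta> q} = {q}"
    using overlap_low_temperature[OF assms] .
  have eq: "p = q" if "0 < p" "overlap_fixpoint \<beta> p" for p
  proof -
    have "p \<in> {q \<in> {0<..}. overlap_fixpoint \<beta> q}" using that by simp
    then show ?thesis unfolding q(3) by simp
  qed
  have "q \<in> {q \<in> {0<..}. overlap_fixpoint \<beta> q}" unfolding q(3) by simp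
  then have fixpoint: "overlap_fixpoint \<beta> q" by simp
  have "overlap \<beta> = q"
  proof (rule overlap_eqI[OF _ fixpoint])
    show "q \<in> {0..<1}" using q(1,2) by simp
    show "p \<le> q" if "p \<in> {0..<1}" "overlap_fixpoint \<beta> p" for p
    proof (cases "p = 0")
      case False
      then have "p = q" using that by (intro eq) auto
      then show ?thesis by simp
    qed (use q(1) in simp)
  qed
  moreover have "{p \<in> {0<..<1}. overlap_fixpoint \<beta> p} = {q}"
  proof (intro equalityI subsetI)
    show "p \<in> {q}" if "p \<in> {p \<in> {0<..<1}. overlap_fixpoint \<beta> p}" for p
      using that eq[of p] by simp
    show "p \<in> {p \<in> {0<..<1}. overlap_fixpoint \<beta> p}" if "p \<in> {q}" for p
      using that q(1,2) fixpoint by simp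
  qed
  ultimately show ?thesis by simp
qed

text \<open>\<open>GREATEST\<close> carries information only once a greatest solution is known to
  exist; both temperature regimes supply one.\<close>

lemma overlap_greatest:
  assumes "0 \<le> \<beta>"
  shows "overlap \<beta> \<in> {0..<1}" "overlap_fixpoint \<beta> (overlap \<beta>)"
    "\<And>q. q \<in> {0..<1} \<Longrightarrow> overlap_fixpoint \<beta> q \<Longrightarrow> q \<le> overlap \<beta>"
proof -
  have "overlap \<beta> \<in> {0..<1} \<and> overlap_fixpoint \<beta> (overlap \<beta>) \<and>
    (\<forall>q\<in>{0..<1}. overlap_fixpoint \<beta> q \<longrightarrow> q \<le> overlap \<beta>)"
  proof (cases "\<beta> \<le> 1")
    case True
    have "q \<le> 0" if "overlap_fixpoint \<beta> q" for q
      using overlap_high_temperature[OF assms True, of q] that by (auto simp: not_less[symmetric])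
    then show ?thesis
      unfolding overlap_le_1[OF assms True] by (simp add: overlap_fixpoint_iff)
  next
    case False
    then have eq: "{q \<in> {0<..<1}. overlap_fixpoint \<beta> q} = {overlap \<beta>}" by (intro overlap_gt_1) simp
    then have o: "overlap \<beta> \<in> {0<..<1}" "overlap_fixpoint \<beta> (overlap \<beta>)" by blast+
    have "q \<le> overlap \<beta>" if "q \<in> {0..<1}" "overlap_fixpoint \<beta> q" for q
    proof (cases "q = 0")
      case False
      then have "q \<in> {q \<in> {0<..<1}. overlap_fixpoint \<beta> q}" using that by auto
      then show ?thesis unfolding eq by simp
    qed (use o in auto)
    then show ?thesis using o by auto
  qed
  then show "overlap \<beta> \<in> {0..<1}" "overlap_fixpoint \<beta> (overlap \<beta>)"
    "\<And>q. q \<in> {0..<1} \<Longrightarrow> overlap_fixpoint \<beta> q \<Longrightarrow> q \<le> overlap \<beta>"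
    by blast+
qed

theorem proposition1p1:
  fixes M :: "'a measure" and g :: "nat \<Rightarrow> nat \<Rightarrow> 'a \<Rightarrow> real"
  assumes "iid_std_gaussian M g"
  shows
    \<comment> \<open>(i)\<close>
    "(\<forall>\<beta> \<gamma>. 0 \<le> \<beta> \<and> 0 < \<gamma> \<and> \<gamma> \<le> 1 \<longrightarrow> Omega M g \<beta> \<gamma> = {0}) \<and>
    \<comment> \<open>(ii)\<close>
    (\<forall>\<beta> \<gamma>. 0 \<le> \<beta> \<and> \<beta> \<le> 1 \<and> 1 < \<gamma> \<longrightarrow> 0 \<notin> Omega M g \<beta> \<gamma>) \<and>
    \<comment> \<open>(iii)\<close>
    (\<forall>\<gamma>>1. {\<theta>. \<theta> > 0 \<and> tanh (\<gamma> * \<theta>) = \<theta>} = {theta \<gamma>}) \<and>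
    (\<forall>\<beta>\<ge>0. overlap \<beta> \<in> {0..<1} \<and> overlap_fixpoint \<beta> (overlap \<beta>) \<and>
       (\<forall>q\<in>{0..<1}. overlap_fixpoint \<beta> q \<longrightarrow> q \<le> overlap \<beta>)) \<and>
    (\<forall>\<beta>. 0 \<le> \<beta> \<and> \<beta> \<le> 1 \<longrightarrow> overlap \<beta> = 0) \<and>
    (\<forall>\<beta>>1. {q\<in>{0<..<1}. overlap_fixpoint \<beta> q} = {overlap \<beta>}) \<and>
    (\<forall>\<beta> \<gamma>. 0 \<le> \<beta> \<and> 1 < \<gamma> \<and>
       ln (cosh (\<gamma> * theta \<gamma>)) - \<gamma> * (theta \<gamma>)\<^sup>2 / 2
         > (LINT z|std_normal_distribution. ln (cosh (\<beta> * sqrt (overlap \<beta>) * z)))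
           + \<beta>\<^sup>2 / 4 * (1 - overlap \<beta>)\<^sup>2
       \<longrightarrow> 0 \<notin> Omega M g \<beta> \<gamma>) \<and>
    (\<forall>\<beta> \<gamma>. 0 \<le> \<beta> \<and> 1 < \<gamma> \<and> ereal \<gamma> > explicit_threshold \<beta> \<longrightarrow> 0 \<notin> Omega M g \<beta> \<gamma>) \<and>
    \<comment> \<open>(iv)\<close>
    (\<forall>\<beta> \<gamma>. 1 < \<beta> \<and> \<beta>\<^sup>2 \<le> \<gamma> \<longrightarrow> 0 \<notin> Omega M g \<beta> \<gamma>) \<and>
    \<comment> \<open>(v)\<close>
    (\<forall>\<beta> \<gamma>. 0 \<le> \<beta> \<and> 1 < \<gamma> \<and>
       ln (cosh (\<gamma> * theta \<gamma>)) - \<gamma> * (theta \<gamma>)\<^sup>2 / 2 > \<beta> * ground_state_energy M g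
       \<longrightarrow> 0 \<notin> Omega M g \<beta> \<gamma>) \<and>
    ground_state_energy M g \<le> sqrt (ln 2) \<and>
    (\<forall>\<beta> \<gamma>. 0 \<le> \<beta> \<and> 1 < \<gamma> \<and>
       ln (cosh (\<gamma> * theta \<gamma>)) - \<gamma> * (theta \<gamma>)\<^sup>2 / 2 > \<beta> * sqrt (ln 2)
       \<longrightarrow> 0 \<notin> Omega M g \<beta> \<gamma>)"
proof (intro conjI allI ballI impI; (elim conjE)?)
  note g = assms
  show "Omega M g \<beta> \<gamma> = {0}" if "0 < \<gamma>" "\<gamma> \<le> 1" for \<beta> \<gamma>
    using that by (rule Omega_weak_interaction[OF g])
  show "0 \<notin> Omega M g \<beta> \<gamma>" if "0 \<le> \<beta>" "\<beta> \<le> 1" "1 < \<gamma>" for \<beta> \<gamma>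
    using that power_le_one[of \<beta> 2] by (intro zero_notin_Omega_strong_interaction[OF g]) auto
  show "{\<theta>. \<theta> > 0 \<and> tanh (\<gamma> * \<theta>) = \<theta>} = {theta \<gamma>}" if "1 < \<gamma>" for \<gamma>
    using that by (rule theta_unique)
  show "overlap \<beta> \<in> {0..<1}" "overlap_fixpoint \<beta> (overlap \<beta>)" if "0 \<le> \<beta>" for \<beta>
    using that by (rule overlap_greatest)+
  show "q \<le> overlap \<beta>" if "0 \<le> \<beta>" "q \<in> {0..<1}" "overlap_fixpoint \<beta> q" for \<beta> q
    using that by (rule overlap_greatest)
  show "overlap \<beta> = 0" if "0 \<le> \<beta>" "\<beta> \<le> 1" for \<beta>
    using that by (rule overlap_le_1)
  show "{q \<in> {0<..<1}. overlap_fixpoint \<beta> q} = {overlap \<beta>}" if "1 < \<beta>" for \<beta>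
    using that by (rule overlap_gt_1)
  show "0 \<notin> Omega M g \<beta> \<gamma>"
    if "0 \<le> \<beta>" "1 < \<gamma>" "ln (cosh (\<gamma> * theta \<gamma>)) - \<gamma> * (theta \<gamma>)\<^sup>2 / 2
         > (LINT z|std_normal_distribution. ln (cosh (\<beta> * sqrt (overlap \<beta>) * z)))
           + \<beta>\<^sup>2 / 4 * (1 - overlap \<beta>)\<^sup>2" for \<beta> \<gamma>
    using that F_SK_le_replica_symmetric[OF g, of "overlap \<beta>" \<beta>] overlap_greatest(1)[OF that(1)]
    by (intro zero_notin_Omega_theta[OF g]) auto
  show "0 \<notin> Omega M g \<beta> \<gamma>" if "0 \<le> \<beta>" "explicit_threshold \<beta> < ereal \<gamma>" for \<beta> \<gamma>
    using that by (rule zero_notin_Omega_explicit[OF g])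
  show "0 \<notin> Omega M g \<beta> \<gamma>" if "1 < \<beta>" "\<beta>\<^sup>2 \<le> \<gamma>" for \<beta> \<gamma>
  proof (rule zero_notin_Omega_strong_interaction[OF g that(2)])
    show "1 < \<gamma>" using one_less_power[OF that(1) pos2] that(2) by linarith
  qed
  show v: "0 \<notin> Omega M g \<beta> \<gamma>"
    if "0 \<le> \<beta>" "1 < \<gamma>" "ln (cosh (\<gamma> * theta \<gamma>)) - \<gamma> * (theta \<gamma>)\<^sup>2 / 2 > \<beta> * ground_state_energy M g"
    for \<beta> \<gamma>
    using that ground_state_energy_bounds(1)[OF g that(1)] by (intro zero_notin_Omega_theta[OF g]) auto
  show E: "ground_state_energy M g \<le> sqrt (ln 2)" by (rule ground_state_energy_le[OF g])
  show "0 \<notin> Omega M g \<beta> \<gamma>"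
    if "0 \<le> \<beta>" "1 < \<gamma>" "ln (cosh (\<gamma> * theta \<gamma>)) - \<gamma> * (theta \<gamma>)\<^sup>2 / 2 > \<beta> * sqrt (ln 2)" for \<beta> \<gamma>
    using that mult_left_mono[OF E that(1)] by (intro v) auto
qed

end
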